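(* Let $n\ge1$ be an integer, let $1<p<\infty$ with $1/p+1/p'=1$, and let $\lambda,\alpha,\beta,\sigma$ be real numbers with $0<\lambda<n$, $\alpha<n/p$, $1-n/p<\beta<n/p'$ and $n+1=\lambda+\alpha+\beta+\sigma$. Then: (i) for every $f\in\mathcal{S}(\mathbb{R}^n)$, $$\big\|\,|x|^{-\alpha}\big(|x|^{-\lambda}*(|x|^{-\sigma}f)\big)\big\|_{L^p(\mathbb{R}^n)}\le F_{\alpha,\beta,\sigma}\,\big\|\,|x|^{\beta}\nabla f\big\|_{L^p(\mathbb{R}^n)},$$ where $$F_{\alpha,\beta,\sigma}=\pi^{n/2}\Big(\frac np+\beta-1\Big)^{-1}\left[\frac{\Gamma\big(\frac{\alpha+\beta+\sigma-1}{2}\big)\,\Gamma\big(\frac{n}{2p}-\frac{\alpha}{2}\big)\,\Gamma\big(\frac{n}{2p'}-\frac{\beta+\sigma-1}{2}\big)}{\Gamma\big(\frac{n+1-\alpha-\beta-\sigma}{2}\big)\,\Gamma\big(\frac{n}{2p'}+\frac{\alpha}{2}\big)\,\Gamma\big(\frac{n}{2p}+\frac{\beta+\sigma-1}{2}\big)}\right];$$ (ii) for every $g\in\mathcal{S}(\mathbb{R}^n)$, $$\big\|\,|x|^{-\alpha}g\big\|_{L^p(\mathbb{R}^n)}\le\frac{2^{-(\alpha+\beta+\sigma-1)}}{n/p+\beta-1}\left[\frac{\Gamma\big(\frac{n}{2p}-\frac{\alpha}{2}\big)\,\Gamma\big(\frac{n}{2p'}-\frac{\beta+\sigma-1}{2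}\big)}{\Gamma\big(\frac{n}{2p'}+\frac{\alpha}{2}\big)\,\Gamma\big(\frac{n}{2p}+\frac{\beta+\sigma-1}{2}\big)}\right]\Big\|\,|x|^{\beta}\,\nabla\Big(|x|^{\sigma}(-\Delta)^{(\alpha+\beta+\sigma-1)/2}g\Big)\Big\|_{L^p(\mathbb{R}^n)}.$$
   Context: $\mathcal{S}(\mathbb{R}^n)$ is the Schwartz class. $*$ denotes convolution on $\mathbb{R}^n$, so that $\big(|x|^{-\lambda}*F\big)(x)=\int_{\mathbb{R}^n}|x-y|^{-\lambda}F(y)\,dy$. The Fourier transform is $\hat f(y)=\int_{\mathbb{R}^n}e^{2\pi i x\cdot y}f(x)\,dx$. $\Delta$ is the Laplacian on $\mathbb{R}^n$, and for $s\ge0$ the operator $(-\Delta)^{s/2}$ is the Fourier multiplier operator with symbol $(2\pi|y|)^{s}$. $\nabla$ is the gradient, and the $L^p$ norm of a vector-valued function is the $L^p$ norm of its Euclidean length. $\Gamma$ is the Euler Gamma function.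
   Formalization: The hypothesis β+σ−1 < n/p' is added (it makes the third Gamma argument in the numerator positive); without it the statement is false, e.g. n=p=2, λ=1, α=−5/2, β=1/2, σ=4, where both constants are negative. *)

theory Defs
  imports "HOL-Analysis.Analysis"
begin

definition partial_deriv :: "'n::finite \<Rightarrow> (real^'n \<Rightarrow> 'b::real_normed_vector) \<Rightarrow> real^'n \<Rightarrow> 'b" where
  "partial_deriv i f x = frechet_derivative f (at x) (axis i 1)"

fun partial_derivs :: "'n::finite list \<Rightarrow> (real^'n \<Rightarrow> 'b::real_normed_vector) \<Rightarrow> real^'n \<Rightarrow> 'b" where
  "partial_derivs [] f = f"
| "partial_derivs (i # is) f = partial_deriv i (partial_derivs is f)"

(* Lists of coordinates play the role of multi-indices. Differentiability of all iterated
   partial derivatives is smoothness. *)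
definition schwartz :: "(real^'n::finite \<Rightarrow> complex) set" where
  "schwartz = {f. \<forall>is. (\<forall>x. partial_derivs is f differentiable (at x)) \<and>
     (\<forall>k::nat. bounded (range (\<lambda>x. (1 + norm x) ^ k *\<^sub>R partial_derivs is f x)))}"

(* frechet_derivative is unspecified at points of non-differentiability. In the theorem this
   concerns only the origin, a null set. *)
definition gradient :: "(real^'n::finite \<Rightarrow> complex) \<Rightarrow> real^'n \<Rightarrow> complex^'n" where
  "gradient f x = (\<chi> i. partial_deriv i f x)"

(* Values in [0,\<infinity>], so that an inequality between norms is meaningful without
   integrability assumptions. *)
definition Lp_norm :: "real \<Rightarrow> ('a::euclidean_space \<Rightarrow> 'b::real_normed_vector) \<Rightarrow> ennreal" where
  "Lp_norm p h =
     (let I = \<integral>\<^sup>+ x. ennreal (norm (h x) powr p) \<partial>lborel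
      in if I = \<infinity> then \<infinity> else ennreal (enn2real I powr (1 / p)))"

definition convolution ::
    "('a::euclidean_space \<Rightarrow> real) \<Rightarrow> ('a \<Rightarrow> complex) \<Rightarrow> 'a \<Rightarrow> complex" where
  "convolution K f x = (\<integral>y. K (x - y) *\<^sub>R f y \<partial>lborel)"

(* The transform has the kernel e^(2 pi i x.y), so the inverse transform has e^(-2 pi i x.y). *)
definition fourier :: "('a::euclidean_space \<Rightarrow> complex) \<Rightarrow> 'a \<Rightarrow> complex" where
  "fourier f y = (\<integral>x. exp (2 * pi * \<i> * complex_of_real (x \<bullet> y)) * f x \<partial>lborel)"

definition inverse_fourier :: "('a::euclidean_space \<Rightarrow> complex) \<Rightarrow> 'a \<Rightarrow> complex" where
  "inverse_fourier h x = (\<integral>y. exp (- (2 * pi * \<i> * complex_of_real (x \<bullet> y))) * h y \<partial>lborel)"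

(* frac_laplacian s is (-\<Delta>)^(s/2), of order s. *)
definition frac_laplacian ::
    "real \<Rightarrow> ('a::euclidean_space \<Rightarrow> complex) \<Rightarrow> 'a \<Rightarrow> complex" where
  "frac_laplacian s g =
     inverse_fourier (\<lambda>y. complex_of_real ((2 * pi * norm y) powr s) * fourier g y)"

definition F_const :: "nat \<Rightarrow> real \<Rightarrow> real \<Rightarrow> real \<Rightarrow> real \<Rightarrow> real \<Rightarrow> real" where
  "F_const n p p' \<alpha> \<beta> \<sigma> =
     pi powr (real n / 2) * inverse (real n / p + \<beta> - 1) *
     ((Gamma ((\<alpha> + \<beta> + \<sigma> - 1) / 2) * Gamma (real n / (2 * p) - \<alpha> / 2) *
       Gamma (real n / (2 * p') - (\<beta> + \<sigma> - 1) / 2)) /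
      (Gamma ((real n + 1 - \<alpha> - \<beta> - \<sigma>) / 2) * Gamma (real n / (2 * p') + \<alpha> / 2) *
       Gamma (real n / (2 * p) + (\<beta> + \<sigma> - 1) / 2)))"

end

theory Submission
  imports Defs "HOL-Probability.Characteristic_Functions"
begin

text \<open>
  Let \<open>n\<close> be the dimension, \<open>s = \<alpha> + \<beta> + \<sigma> - 1 = n - \<lambda>\<close> and \<open>b = \<beta> + \<sigma> - 1\<close>. The
  constant \<open>F_const\<close> is a product, and so is the argument.

  The first factor bounds the norm of the operator with kernel
  \<open>|x|^(-\<alpha>) |x - y|^(-\<lambda>) |y|^(-b)\<close> on \<open>L^p\<close>. This kernel is homogeneous of degree \<open>-n\<close>, so
  that \<open>|x|^(-n/p)\<close> is an eigenfunction of it and \<open>|x|^(-n/p')\<close> one of its transpose. The two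
  eigenvalues are equal, and Schur's test bounds the operator by them (\<open>Stein_Weiss\<close>). They are
  computed by \<open>Riesz_composition\<close>: every negative power of \<open>|x|\<close> is a superposition of Gaussians, and the
  convolution of two Gaussians is explicit.

  The second factor \<open>(n/p + \<beta> - 1)^(-1)\<close> comes from Hardy's inequality between
  \<open>|x|^(\<beta> - 1) f\<close> and \<open>|x|^\<beta> \<nabla>f\<close> (\<open>Hardy_inequality\<close>): a function that vanishes at infinity
  is the integral of its radial derivative along the ray from \<open>x\<close> to infinity, and dilation by
  \<open>t\<close> multiplies the norm of \<open>|x|^\<beta> \<nabla>f\<close> by a power of \<open>t\<close> that is integrable at infinity. Since
  \<open>|x|^(-\<sigma>) f = |x|^(-b) (|x|^(\<beta> - 1) f)\<close>, the two bounds combine to the first assertion.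

  For the second assertion put \<open>h = (-\<Delta>)^(s/2) g\<close> and \<open>f = |x|^\<sigma> h\<close>. Then \<open>g\<close> is a multiple of
  \<open>|x|^(-\<lambda>) * h = |x|^(-\<lambda>) * (|x|^(-\<sigma>) f)\<close>; the bound that is needed here is
  \<open>schwartz_le_Riesz_potential\<close>, proved by applying the superposition of Gaussians on the Fourier
  side. So the first argument applies to \<open>f\<close> once \<open>f\<close> is known to vanish at infinity along almost
  every ray. If the right-hand side is finite, then \<open>f\<close> has some limit \<open>L\<close> along almost every
  ray, and by Hardy's inequality the dilates \<open>j^\<sigma> h(j x)\<close> converge to \<open>|x|^(-\<sigma>) L(x)\<close> against
  Gaussian weights. But the symbol \<open>(2 \<pi> |y|)^s\<close> vanishes at the origin and \<open>\<sigma> < n\<close>, so the Fourier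
  transforms of the weighted dilates tend to zero. By injectivity of the Fourier transform
  \<open>L = 0\<close> almost everywhere (\<open>weighted_frac_laplacian_ray_limit\<close>).
\<close>

text \<open>Convolution means convolution of functions throughout, not of measures.\<close>

hide_const (open) Convolution.convolution

abbreviation gauss :: "real \<Rightarrow> 'a::real_normed_vector \<Rightarrow> real" where
  "gauss c x \<equiv> exp (- (c * (norm x)\<^sup>2))"

abbreviation wave :: "'a::real_inner \<Rightarrow> 'a \<Rightarrow> complex" where
  "wave x y \<equiv> cis (2 * pi * (x \<bullet> y))"

abbreviation wave' :: "'a::real_inner \<Rightarrow> 'a \<Rightarrow> complex" where
  "wave' x y \<equiv> cis (- (2 * pi * (x \<bullet> y)))"

section \<open>Powers of extended nonnegative reals and Schur's test\<close>

text \<open>Powers with values in \<open>[0, \<infinity>]\<close>. Every power of \<open>\<infinity>\<close> is \<open>\<infinity>\<close>; so \<open>L^p\<close> bounds can be chained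
  before anything is known to be finite.\<close>

definition epow :: "ennreal \<Rightarrow> real \<Rightarrow> ennreal" where
  "epow a p = (if a = \<infinity> then \<infinity> else ennreal (enn2real a powr p))"

lemma epow_ennreal [simp]: "0 \<le> r \<Longrightarrow> epow (ennreal r) p = ennreal (r powr p)"
  by (simp add: epow_def)

lemma epow_top [simp]: "epow \<infinity> p = \<infinity>" "epow top p = \<infinity>"
  by (simp_all add: epow_def)

lemma epow_zero [simp]: "epow 0 p = 0"
  by (simp add: epow_def)

lemma epow_one [simp]: "epow a 1 = a"
  by (cases a) auto

lemma epow_measurable [measurable]:
  assumes [measurable]: "f \<in> borel_measurable M"
  shows "(\<lambda>x. epow (f x) p) \<in> borel_measurable M"
  unfolding epow_def by measurable

lemma epow_mono: "a \<le> b \<Longrightarrow> 0 \<le> p \<Longrightarrow> epow a p \<le> epow b p"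
  by (cases a; cases b) (auto simp: powr_mono2 ennreal_leI top_unique)

lemma epow_mult:
  assumes "0 < p"
  shows "epow (a * b) p = epow a p * epow b p"
proof -
  have "epow (a * b) p = epow a p * epow b p" if "a = \<infinity> \<or> b = \<infinity>" for a b
    using that by (cases a; cases b) (auto simp: ennreal_mult_eq_top_iff ennreal_mult_top ennreal_top_mult
        top_unique epow_def)
  then show ?thesis
    by (cases a; cases b) (auto simp: ennreal_mult[symmetric] powr_mult)
qed

lemma epow_epow: "0 < p \<Longrightarrow> 0 < q \<Longrightarrow> epow (epow a p) q = epow a (p * q)"
  by (cases a) (auto simp: powr_powr)

lemma epow_eq_0_iff [simp]: "epow a p = 0 \<longleftrightarrow> a = 0"
  by (cases a) auto

lemma Lp_norm_epow: "Lp_norm p h = epow (\<integral>\<^sup>+ x. epow (ennreal (norm (h x))) p \<partial>lborel) (1 / p)"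
  by (simp add: Lp_norm_def Let_def epow_def)

text \<open>Jensen's inequality for the measure with density \<open>w\<close>, multiplied by the powers of its total
  mass. By Young's inequality \<open>v\<close> is at most a multiple of \<open>v^p\<close> plus a constant; integration
  against \<open>w\<close> gives the claim if the two terms are balanced.\<close>

lemma epow_nn_integral_le:
  assumes p: "1 < p"
    and [measurable]: "w \<in> borel_measurable M" "v \<in> borel_measurable M"
    and fin: "(\<integral>\<^sup>+ x. w x \<partial>M) < \<infinity>"
  shows "epow (\<integral>\<^sup>+ x. w x * v x \<partial>M) p
           \<le> epow (\<integral>\<^sup>+ x. w x \<partial>M) (p - 1) * (\<integral>\<^sup>+ x. w x * epow (v x) p \<partial>M)"
proof -
  define V where "V = (\<integral>\<^sup>+ x. w x * epow (v x) p \<partial>M)"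
  have zero: "(\<integral>\<^sup>+ x. w x * v x \<partial>M) = 0" if "AE x in M. w x = 0 \<or> v x = 0"
    using that by (subst nn_integral_0_iff_AE) auto
  obtain W where W: "(\<integral>\<^sup>+ x. w x \<partial>M) = ennreal W" "0 \<le> W"
    using fin by (cases "\<integral>\<^sup>+ x. w x \<partial>M") auto
  consider "W = 0" | "V = 0" | "W > 0" "V = \<infinity>" | A where "W > 0" "V = ennreal A" "A > 0"
    using W(2) by (cases V) (fastforce simp: less_le)+
  then show ?thesis
  proof cases
    case 1
    then have "AE x in M. w x = 0"
      using W by (simp add: nn_integral_0_iff_AE)
    then have "(\<integral>\<^sup>+ x. w x * v x \<partial>M) = 0" by (intro zero) auto
    then show ?thesis by simp
  next
    case 2
    then have "AE x in M. w x * epow (v x) p = 0"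
      unfolding V_def by (subst (asm) nn_integral_0_iff_AE) auto
    then have "(\<integral>\<^sup>+ x. w x * v x \<partial>M) = 0" by (intro zero) auto
    then show ?thesis by simp
  next
    case 3
    then show ?thesis unfolding V_def[symmetric] W by (simp add: ennreal_mult_top)
  next
    case 4
    define q where "q = p / (p - 1)"
    have q: "1 < q" "1 / p + 1 / q = 1" using p by (auto simp: q_def field_simps)
    \<comment> \<open>The \<open>p\<close>-th root of the \<open>w\<close>-mean of \<open>v^p\<close>: the scale at which the two terms of
        Young's inequality add up to \<open>a\<close> itself.\<close>
    define a where "a = (A / W) powr (1 / p)"
    have a: "0 < a" using 4 by (simp add: a_def)
    have ap: "a powr p = A / W" using 4 p by (simp add: a_def powr_powr)
    have young: "e \<le> epow e p * ennreal (1 / (p * a powr (p - 1))) + ennreal (a / q)" for e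
    proof (cases e)
      case (real r)
      have "(r / a) * 1 \<le> (r / a) powr p / p + 1 powr q / q"
        using p q a real by (intro Youngs_inequality) auto
      then have "(r / a) * a \<le> (r powr p / a powr p / p + 1 / q) * a"
        using a by (intro mult_right_mono) (auto simp: powr_divide)
      also have "\<dots> = r powr p * (1 / (p * a powr (p - 1))) + a / q"
        using a p by (simp add: powr_diff field_simps)
      finally show ?thesis
        using real a p q by (simp add: ennreal_mult[symmetric] ennreal_plus[symmetric] ennreal_leI del: ennreal_plus)
    next
      case top
      then show ?thesis using a p by (simp add: ennreal_top_mult)
    qed
    have "(\<integral>\<^sup>+ x. w x * v x \<partial>M)
        \<le> (\<integral>\<^sup>+ x. (w x * epow (v x) p) * ennreal (1 / (p * a powr (p - 1))) + w x * ennreal (a / q) \<partial>M)"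
      using young by (intro nn_integral_mono) (metis distrib_left mult.assoc mult_left_mono zero_le)
    also have "\<dots> = V * ennreal (1 / (p * a powr (p - 1))) + ennreal W * ennreal (a / q)"
      by (subst nn_integral_add) (auto simp: nn_integral_multc V_def W)
    also have "\<dots> = ennreal (A * (1 / (p * a powr (p - 1))) + W * (a / q))"
      using 4 a p q by (simp add: ennreal_mult[symmetric] ennreal_plus[symmetric] del: ennreal_plus)
    also have "A * (1 / (p * a powr (p - 1))) + W * (a / q) = W * a"
    proof -
      have "A = W * a powr p" using ap 4 by simp
      then have "A * (1 / (p * a powr (p - 1))) = W * a * (1 / p)"
        using a p by (simp add: powr_diff)
      then have "A * (1 / (p * a powr (p - 1))) + W * (a / q) = W * a * (1 / p + 1 / q)"
        by (simp add: distrib_left)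
      then show ?thesis using q by simp
    qed
    finally have "epow (\<integral>\<^sup>+ x. w x * v x \<partial>M) p \<le> epow (ennreal (W * a)) p"
      using p by (intro epow_mono) auto
    also have "\<dots> = ennreal (W powr (p - 1)) * ennreal A"
      using 4 a ap by (simp add: powr_mult ennreal_mult[symmetric] powr_diff)
    finally show ?thesis using 4 W by (simp add: V_def)
  qed
qed

text \<open>Write \<open>K h = (K u) (h / u)\<close> and apply Jensen's inequality to the measure with density
  \<open>K(x, y) u(y)\<close>, whose mass is at most \<open>C u(x)\<close>. After an exchange of the integrations the
  second condition bounds the integral over \<open>x\<close>. The form of the two conditions is adapted to
  homogeneous kernels, for which \<open>u\<close> is a power of the norm.\<close>

lemma Schur_test:
  fixes K :: "'a::euclidean_space \<Rightarrow> 'a \<Rightarrow> ennreal" and u :: "'a \<Rightarrow> real"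
  assumes p: "1 < p" and C: "0 \<le> C"
    and [measurable]: "(\<lambda>(x, y). K x y) \<in> borel_measurable (borel \<Otimes>\<^sub>M borel)"
      "u \<in> borel_measurable borel" "h \<in> borel_measurable borel"
    and u: "AE x in lborel. 0 < u x"
    and row: "AE x in lborel. (\<integral>\<^sup>+ y. K x y * ennreal (u y) \<partial>lborel) \<le> ennreal (C * u x)"
    and col: "AE y in lborel. (\<integral>\<^sup>+ x. K x y * ennreal (u x powr (p - 1)) \<partial>lborel)
                 \<le> ennreal (C * u y powr (p - 1))"
  shows "(\<integral>\<^sup>+ x. epow (\<integral>\<^sup>+ y. K x y * h y \<partial>lborel) p \<partial>lborel)
           \<le> ennreal (C powr p) * (\<integral>\<^sup>+ y. epow (h y) p \<partial>lborel)"
proof -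
  define v where "v y = ennreal (1 / u y) * h y" for y
  have [measurable]: "v \<in> borel_measurable borel" unfolding v_def by measurable
  have vh: "ennreal (u y) * v y = h y" if "0 < u y" for y
    using that by (simp add: v_def mult.assoc[symmetric] ennreal_mult[symmetric])
  have "AE x in lborel. epow (\<integral>\<^sup>+ y. K x y * h y \<partial>lborel) p
      \<le> ennreal (C powr (p - 1)) * (\<integral>\<^sup>+ y. (K x y * ennreal (u x powr (p - 1))) * (ennreal (u y) * epow (v y) p) \<partial>lborel)"
    using u row
  proof eventually_elim
    case (elim x)
    have "(\<integral>\<^sup>+ y. K x y * h y \<partial>lborel) = (\<integral>\<^sup>+ y. (K x y * ennreal (u y)) * v y \<partial>lborel)"
      using u by (intro nn_integral_cong_AE) (auto simp: vh mult.assoc)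
    also have "epow \<dots> p \<le> epow (\<integral>\<^sup>+ y. K x y * ennreal (u y) \<partial>lborel) (p - 1)
       * (\<integral>\<^sup>+ y. (K x y * ennreal (u y)) * epow (v y) p \<partial>lborel)"
      using elim p by (intro epow_nn_integral_le) (auto intro: le_less_trans)
    also have "\<dots> \<le> ennreal ((C * u x) powr (p - 1))
       * (\<integral>\<^sup>+ y. (K x y * ennreal (u y)) * epow (v y) p \<partial>lborel)"
      using epow_mono[OF elim(2), of "p - 1"] elim p C by (intro mult_right_mono) auto
    also have "\<dots> = ennreal (C powr (p - 1)) * (\<integral>\<^sup>+ y. (K x y * ennreal (u x powr (p - 1))) * (ennreal (u y) * epow (v y) p) \<partial>lborel)"
      by (simp add: powr_mult ennreal_mult nn_integral_cmult[symmetric] mult_ac)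
    finally show ?case .
  qed
  then have "(\<integral>\<^sup>+ x. epow (\<integral>\<^sup>+ y. K x y * h y \<partial>lborel) p \<partial>lborel)
    \<le> (\<integral>\<^sup>+ x. ennreal (C powr (p - 1)) * (\<integral>\<^sup>+ y. (K x y * ennreal (u x powr (p - 1))) * (ennreal (u y) * epow (v y) p) \<partial>lborel) \<partial>lborel)"
    by (rule nn_integral_mono_AE)
  also have "\<dots> = ennreal (C powr (p - 1)) * (\<integral>\<^sup>+ x. \<integral>\<^sup>+ y. (K x y * ennreal (u x powr (p - 1))) * (ennreal (u y) * epow (v y) p) \<partial>lborel \<partial>lborel)"
    by (subst nn_integral_cmult) auto
  also have "(\<integral>\<^sup>+ x. \<integral>\<^sup>+ y. (K x y * ennreal (u x powr (p - 1))) * (ennreal (u y) * epow (v y) p) \<partial>lborel \<partial>lborel)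
     = (\<integral>\<^sup>+ y. \<integral>\<^sup>+ x. (K x y * ennreal (u x powr (p - 1))) * (ennreal (u y) * epow (v y) p) \<partial>lborel \<partial>lborel)"
    by (rule lborel_pair.Fubini'[symmetric]) auto
  also have "\<dots> = (\<integral>\<^sup>+ y. (\<integral>\<^sup>+ x. (K x y * ennreal (u x powr (p - 1))) \<partial>lborel) * (ennreal (u y) * epow (v y) p) \<partial>lborel)"
    by (subst nn_integral_multc) auto
  also have "\<dots> \<le> (\<integral>\<^sup>+ y. ennreal C * epow (h y) p \<partial>lborel)"
    using u col
  proof (intro nn_integral_mono_AE, eventually_elim)
    case (elim y)
    have "(\<integral>\<^sup>+ x. (K x y * ennreal (u x powr (p - 1))) \<partial>lborel) * (ennreal (u y) * epow (v y) p)
       \<le> ennreal (C * u y powr (p - 1)) * (ennreal (u y) * epow (v y) p)"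
      using elim by (intro mult_right_mono) auto
    also have "\<dots> = ennreal C * (ennreal (u y powr (p - 1) * u y) * epow (v y) p)"
      using C elim by (simp add: ennreal_mult mult_ac)
    also have "u y powr (p - 1) * u y = u y powr p"
      using elim by (simp add: powr_diff)
    also have "ennreal (u y powr p) * epow (v y) p = epow (h y) p"
      using elim p by (subst vh[symmetric]) (auto simp: epow_mult)
    finally show ?case .
  qed
  also have "\<dots> = ennreal C * (\<integral>\<^sup>+ y. epow (h y) p \<partial>lborel)"
    by (rule nn_integral_cmult) auto
  finally have "(\<integral>\<^sup>+ x. epow (\<integral>\<^sup>+ y. K x y * h y \<partial>lborel) p \<partial>lborel)
     \<le> ennreal (C powr (p - 1)) * (ennreal C * (\<integral>\<^sup>+ y. epow (h y) p \<partial>lborel))"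
    by (simp add: mult_left_mono)
  also have "\<dots> = ennreal (C powr p) * (\<integral>\<^sup>+ y. epow (h y) p \<partial>lborel)"
    using C p by (cases "C = 0") (auto simp: mult.assoc[symmetric] ennreal_mult[symmetric] powr_diff)
  finally show ?thesis .
qed

section \<open>Gaussian subordination and the composition of Riesz kernels\<close>

lemma nn_integral_lborel_affine:
  fixes f :: "'a::euclidean_space \<Rightarrow> ennreal"
  assumes [measurable]: "f \<in> borel_measurable borel" and c: "c \<noteq> 0"
  shows "(\<integral>\<^sup>+x. f x \<partial>lborel) = ennreal (\<bar>c\<bar> ^ DIM('a)) * (\<integral>\<^sup>+x. f (t + c *\<^sub>R x) \<partial>lborel)"
  by (subst lborel_affine[OF c, of t])
     (simp add: nn_integral_density nn_integral_distr nn_integral_cmult)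

lemma nn_integral_lborel_reflect:
  fixes f :: "'a::euclidean_space \<Rightarrow> ennreal"
  assumes [measurable]: "f \<in> borel_measurable borel"
  shows "(\<integral>\<^sup>+x. f (t - x) \<partial>lborel) = (\<integral>\<^sup>+x. f x \<partial>lborel)"
  using nn_integral_lborel_affine[of f "-1" t] by simp

lemma nn_integral_Gamma_kernel:
  assumes a: "0 < a" and c: "0 < c"
  shows "(\<integral>\<^sup>+ t\<in>{0<..}. ennreal (t powr (a - 1) * exp (- (c * t))) \<partial>lborel) = ennreal (Gamma a * c powr (- a))"
proof -
  have "ennreal (Gamma a) = (\<integral>\<^sup>+ t. ennreal (indicator {0..} t * t powr (a - 1) / exp t) \<partial>lborel)"
    using Gamma_conv_nn_integral_real[OF a] .
  also have "\<dots> = ennreal \<bar>c\<bar> * (\<integral>\<^sup>+ t. ennreal (indicator {0..} (0 + c * t) * (0 + c * t) powr (a - 1) / exp (0 + c * t)) \<partial>lborel)"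
    using c by (intro nn_integral_real_affine) auto
  also have "(\<integral>\<^sup>+ t. ennreal (indicator {0..} (0 + c * t) * (0 + c * t) powr (a - 1) / exp (0 + c * t)) \<partial>lborel)
     = (\<integral>\<^sup>+ t. ennreal (c powr (a - 1)) * (ennreal (t powr (a - 1) * exp (- (c * t))) * indicator {0<..} t) \<partial>lborel)"
    using c by (intro nn_integral_cong)
      (auto simp: indicator_def zero_le_mult_iff exp_minus divide_inverse powr_mult ennreal_mult[symmetric] mult_ac)
  also have "\<dots> = ennreal (c powr (a - 1)) * (\<integral>\<^sup>+ t\<in>{0<..}. ennreal (t powr (a - 1) * exp (- (c * t))) \<partial>lborel)"
    by (rule nn_integral_cmult) auto
  finally have "ennreal (c powr (- a)) * ennreal (Gamma a)
    = ennreal (c powr (- a) * (c * c powr (a - 1))) * (\<integral>\<^sup>+ t\<in>{0<..}. ennreal (t powr (a - 1) * exp (- (c * t))) \<partial>lborel)"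
    using c by (simp add: ennreal_mult mult.assoc)
  also have "c powr (- a) * (c * c powr (a - 1)) = 1"
    using c by (simp add: powr_diff powr_minus)
  finally show ?thesis using a by (simp add: ennreal_mult mult.commute)
qed

lemma power2_powr: "0 < r \<Longrightarrow> (r\<^sup>2) powr a = r powr (2 * a)" for r :: real
  by (metis powr_numeral powr_powr less_imp_le)

text \<open>This writes a negative power of the norm as a superposition of Gaussians, whose convolutions and Fourier
  transforms are explicit.\<close>

lemma norm_powr_eq_Gamma_integral:
  fixes z :: "'a::real_normed_vector"
  assumes "z \<noteq> 0" "0 < l"
  shows "ennreal (Gamma (l / 2) * norm z powr (- l))
    = (\<integral>\<^sup>+ t\<in>{0<..}. ennreal (t powr (l / 2 - 1) * gauss t z) \<partial>lborel)"
proof -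
  have "((norm z)\<^sup>2) powr (- (l / 2)) = norm z powr (- l)"
    using assms by (simp add: power2_powr)
  then show ?thesis
    using nn_integral_Gamma_kernel[of "l / 2" "(norm z)\<^sup>2"] assms by (simp add: mult.commute)
qed

lemma nn_integral_Gaussian:
  assumes c: "0 < c"
  shows "(\<integral>\<^sup>+ (x::'a::euclidean_space). ennreal (gauss c x) \<partial>lborel)
    = ennreal ((pi / c) powr (real DIM('a) / 2))"
proof -
  have one: "(\<integral>\<^sup>+ x. ennreal (exp (- (c * x\<^sup>2))) \<partial>lborel) = ennreal (sqrt (pi / c))"
  proof -
    define s where "s = sqrt (1 / (2 * c))"
    have s: "0 < s" "2 * s\<^sup>2 = 1 / c" using c by (auto simp: s_def)
    have "(\<integral>\<^sup>+ x. ennreal (normal_density 0 s x) \<partial>lborel) = ennreal (\<integral> x. normal_density 0 s x \<partial>lborel)"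
      using s by (intro nn_integral_eq_integral) auto
    then have 1: "(\<integral>\<^sup>+ x. ennreal (normal_density 0 s x) \<partial>lborel) = 1"
      using s by simp
    have "exp (- (c * x\<^sup>2)) = sqrt (pi / c) * normal_density 0 s x" for x
    proof -
      have "2 * pi * s\<^sup>2 = pi / c" "x\<^sup>2 / (2 * s\<^sup>2) = c * x\<^sup>2"
        using s by (simp_all add: field_simps)
      then show ?thesis using c by (simp add: normal_density_def)
    qed
    then have "(\<integral>\<^sup>+ x. ennreal (exp (- (c * x\<^sup>2))) \<partial>lborel) = (\<integral>\<^sup>+ x. ennreal (sqrt (pi / c)) * ennreal (normal_density 0 s x) \<partial>lborel)"
      using c by (simp add: ennreal_mult')
    also have "\<dots> = ennreal (sqrt (pi / c))"
      using 1 by (simp add: nn_integral_cmult)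
    finally show ?thesis .
  qed
  have "ennreal (gauss c x) = (\<Prod>b\<in>Basis. ennreal (exp (- (c * (x \<bullet> b)\<^sup>2))))" for x :: 'a
  proof -
    have "(norm x)\<^sup>2 = (\<Sum>b\<in>Basis. (x \<bullet> b)\<^sup>2)"
      unfolding power2_norm_eq_inner euclidean_inner[of x x] by (simp add: power2_eq_square)
    then show ?thesis
      by (simp add: prod_ennreal exp_sum[symmetric] sum_distrib_left sum_negf)
  qed
  then have "(\<integral>\<^sup>+ (x::'a). ennreal (gauss c x) \<partial>lborel)
     = (\<Prod>b\<in>(Basis :: 'a set). (\<integral>\<^sup>+ x. ennreal (exp (- (c * x\<^sup>2))) \<partial>lborel))"
    by (simp only:) (rule nn_integral_lborel_prod[where f = "\<lambda>_ x. ennreal (exp (- (c * x\<^sup>2)))"], auto)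
  also have "\<dots> = ennreal (sqrt (pi / c) ^ DIM('a))"
    using c by (simp add: one ennreal_power)
  also have "sqrt (pi / c) ^ DIM('a) = (pi / c) powr (real DIM('a) / 2)"
    using c by (simp add: powr_half_sqrt[symmetric] powr_realpow[symmetric] powr_powr)
  finally show ?thesis .
qed

text \<open>Completing the square: the product is a multiple of a Gaussian in \<open>y\<close> centred at
  \<open>t x / (t + s)\<close>.\<close>

lemma nn_integral_Gaussian_product:
  fixes x :: "'a::euclidean_space"
  assumes t: "0 < t" and s: "0 < s"
  shows "(\<integral>\<^sup>+ y. ennreal (gauss t (x - y) * gauss s y) \<partial>lborel)
    = ennreal ((pi / (t + s)) powr (real DIM('a) / 2) * exp (- (t * s / (t + s) * (norm x)\<^sup>2)))"
proof -
  define a where "a = (t / (t + s)) *\<^sub>R x"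
  have sq: "t * (norm (x - y))\<^sup>2 + s * (norm y)\<^sup>2 = (t + s) * (norm (a - y))\<^sup>2 + t * s / (t + s) * (norm x)\<^sup>2" for y
  proof -
    define X Y Z where "X = x \<bullet> x" and "Y = y \<bullet> y" and "Z = x \<bullet> y"
    have "(norm (x - y))\<^sup>2 = X - 2 * Z + Y" "(norm y)\<^sup>2 = Y" "(norm x)\<^sup>2 = X"
      "(norm (a - y))\<^sup>2 = (t / (t + s))\<^sup>2 * X - 2 * (t / (t + s)) * Z + Y"
      unfolding X_def Y_def Z_def a_def power2_norm_eq_inner
      by (simp_all add: inner_diff_left inner_diff_right inner_commute power2_eq_square)
    moreover define q where "q = t / (t + s)"
    moreover have "t * s / (t + s) = q * s" by (simp add: q_def)
    moreover have q: "q * (t + s) = t" using t s by (simp add: q_def)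
    have q2: "(t + s) * (q\<^sup>2 * X - 2 * q * Z + Y) + q * s * X
      = (q * (t + s)) * q * X - 2 * (q * (t + s)) * Z + (t + s) * Y + q * s * X"
      by (simp add: algebra_simps power2_eq_square)
    have "t * q * X + q * s * X = (q * (t + s)) * X"
      by (simp add: algebra_simps)
    then have "t * (X - 2 * Z + Y) + s * Y = (t + s) * (q\<^sup>2 * X - 2 * q * Z + Y) + q * s * X"
      unfolding q2 unfolding q by (simp add: algebra_simps)
    ultimately show ?thesis by simp
  qed
  have "(\<integral>\<^sup>+ y. ennreal (gauss t (x - y) * gauss s y) \<partial>lborel)
     = (\<integral>\<^sup>+ y. ennreal (exp (- (t * s / (t + s) * (norm x)\<^sup>2))) * ennreal (gauss (t + s) (a - y)) \<partial>lborel)"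
  proof (intro nn_integral_cong)
    fix y
    have "gauss t (x - y) * gauss s y
      = exp (- (t * s / (t + s) * (norm x)\<^sup>2)) * gauss (t + s) (a - y)"
      using sq[of y] unfolding exp_add[symmetric] by (intro arg_cong[of _ _ exp]) linarith
    then show "ennreal (gauss t (x - y) * gauss s y)
      = ennreal (exp (- (t * s / (t + s) * (norm x)\<^sup>2))) * ennreal (gauss (t + s) (a - y))"
      by (simp only: ennreal_mult[OF exp_ge_zero exp_ge_zero])
  qed
  also have "\<dots> = ennreal (exp (- (t * s / (t + s) * (norm x)\<^sup>2))) * (\<integral>\<^sup>+ y. ennreal (gauss (t + s) (a - y)) \<partial>lborel)"
    by (rule nn_integral_cmult) auto
  also have "(\<integral>\<^sup>+ y. ennreal (gauss (t + s) (a - y)) \<partial>lborel) = (\<integral>\<^sup>+ (y::'a). ennreal (gauss (t + s) y) \<partial>lborel)"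
    by (rule nn_integral_lborel_reflect) auto
  also have "\<dots> = ennreal ((pi / (t + s)) powr (real DIM('a) / 2))"
    using t s by (intro nn_integral_Gaussian) auto
  finally show ?thesis by (simp add: ennreal_mult[symmetric] mult.commute)
qed

text \<open>Euler's beta integral on the half line: the power of \<open>1 + u\<close> is a Gamma integral, after which
  the integral over \<open>u\<close> is a Gamma integral as well.\<close>

lemma nn_integral_Beta_kernel:
  assumes x: "0 < x" and y: "0 < y"
  shows "(\<integral>\<^sup>+ u\<in>{0<..}. ennreal (u powr (x - 1) * (1 + u) powr (- (x + y))) \<partial>lborel)
    = ennreal (Gamma x * Gamma y / Gamma (x + y))"
proof -
  define I where "I = (\<integral>\<^sup>+ u\<in>{0<..}. ennreal (u powr (x - 1) * (1 + u) powr (- (x + y))) \<partial>lborel)"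
  have G: "0 < Gamma x" "0 < Gamma y" "0 < Gamma (x + y)" using x y by auto
  have "ennreal (Gamma (x + y)) * I
    = (\<integral>\<^sup>+ u. (ennreal (u powr (x - 1)) * indicator {0<..} u) * ennreal (Gamma (x + y) * (1 + u) powr (- (x + y))) \<partial>lborel)"
    unfolding I_def using G
    by (subst nn_integral_cmult[symmetric]) (auto intro!: nn_integral_cong simp: ennreal_mult mult_ac)
  also have "\<dots> = (\<integral>\<^sup>+ u. \<integral>\<^sup>+ t. (ennreal (u powr (x - 1)) * indicator {0<..} u) *
       (ennreal (t powr (x + y - 1) * exp (- ((1 + u) * t))) * indicator {0<..} t) \<partial>lborel \<partial>lborel)"
  proof (intro nn_integral_cong)
    fix u :: real
    show "(ennreal (u powr (x - 1)) * indicator {0<..} u) * ennreal (Gamma (x + y) * (1 + u) powr (- (x + y)))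
      = (\<integral>\<^sup>+ t. (ennreal (u powr (x - 1)) * indicator {0<..} u) *
         (ennreal (t powr (x + y - 1) * exp (- ((1 + u) * t))) * indicator {0<..} t) \<partial>lborel)"
      using x y by (cases "0 < u") (simp_all add: nn_integral_cmult nn_integral_Gamma_kernel)
  qed
  also have "\<dots> = (\<integral>\<^sup>+ t. \<integral>\<^sup>+ u. (ennreal (u powr (x - 1)) * indicator {0<..} u) *
       (ennreal (t powr (x + y - 1) * exp (- ((1 + u) * t))) * indicator {0<..} t) \<partial>lborel \<partial>lborel)"
    by (rule lborel_pair.Fubini'[symmetric]) measurable
  also have "\<dots> = (\<integral>\<^sup>+ t. ennreal (Gamma x) * (ennreal (t powr (y - 1) * exp (- (1 * t))) * indicator {0<..} t) \<partial>lborel)"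
  proof (intro nn_integral_cong)
    fix t :: real
    have "(\<integral>\<^sup>+ u. (ennreal (u powr (x - 1)) * indicator {0<..} u) *
       (ennreal (t powr (x + y - 1) * exp (- ((1 + u) * t))) * indicator {0<..} t) \<partial>lborel)
      = (\<integral>\<^sup>+ u. ennreal (t powr (x + y - 1) * exp (- t)) * (ennreal (u powr (x - 1) * exp (- (t * u))) * indicator {0<..} u) \<partial>lborel)"
      if "0 < t"
      using that by (intro nn_integral_cong) (auto simp: indicator_def ennreal_mult[symmetric] exp_add[symmetric] algebra_simps exp_diff exp_minus divide_inverse)
    also have "\<dots> = ennreal (t powr (x + y - 1) * exp (- t)) * ennreal (Gamma x * t powr (- x))" if "0 < t"
      using that x by (subst nn_integral_cmult) (auto simp: nn_integral_Gamma_kernel)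
    also have "\<dots> = ennreal (Gamma x) * (ennreal (t powr (y - 1) * exp (- (1 * t))) * indicator {0<..} t)" if "0 < t"
    proof -
      have "t powr (x + y - 1) * t powr (- x) = t powr (y - 1)"
        by (simp flip: powr_add)
      then have "t powr (x + y - 1) * exp (- t) * (Gamma x * t powr (- x)) = Gamma x * (t powr (y - 1) * exp (- t))"
        by (simp add: mult_ac)
      then show ?thesis using that G by (simp add: ennreal_mult[symmetric])
    qed
    finally show "(\<integral>\<^sup>+ u. (ennreal (u powr (x - 1)) * indicator {0<..} u) *
       (ennreal (t powr (x + y - 1) * exp (- ((1 + u) * t))) * indicator {0<..} t) \<partial>lborel)
       = ennreal (Gamma x) * (ennreal (t powr (y - 1) * exp (- (1 * t))) * indicator {0<..} t)"
      by (cases "0 < t") auto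
  qed
  also have "\<dots> = ennreal (Gamma x * Gamma y)"
    using y G nn_integral_Gamma_kernel[of y 1]
    by (subst nn_integral_cmult) (simp_all add: ennreal_mult[symmetric])
  finally have "ennreal (1 / Gamma (x + y)) * (ennreal (Gamma (x + y)) * I) = ennreal (1 / Gamma (x + y)) * ennreal (Gamma x * Gamma y)"
    by simp
  then show ?thesis unfolding I_def[symmetric]
    using G by (simp add: mult.assoc[symmetric] ennreal_mult[symmetric])
qed

text \<open>The factor \<open>t\<close> on the left is the Jacobian of the substitution \<open>s = t u\<close>, which separates
  the variables in the proof of the composition formula.\<close>

lemma Gaussian_product_kernel_dilate:
  fixes t u a b d E :: real
  assumes t: "0 < t" and u: "0 < u"
  shows "t * (t powr (a - 1) * ((t * u) powr (b - 1) * ((pi / (t * (1 + u))) powr d * E)))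
    = pi powr d * (u powr (b - 1) * (1 + u) powr (- d)) * (t powr (a + b - d - 1) * E)"
proof -
  have 3: "(pi / (t * (1 + u))) powr d = pi powr d * t powr (- d) * (1 + u) powr (- d)"
    using t u by (simp add: powr_divide powr_mult powr_minus_divide)
  have "t powr (a + b - d - 1) = t powr (1 + (a - 1) + (b - 1) + (- d))" by (simp add: algebra_simps)
  also have "\<dots> = t powr 1 * t powr (a - 1) * t powr (b - 1) * t powr (- d)" by (simp only: powr_add)
  finally have 4: "t powr (a + b - d - 1) = t * t powr (a - 1) * t powr (b - 1) * t powr (- d)" using t by simp
  show ?thesis unfolding 3 4 powr_mult by (simp only: mult_ac)
qed

text \<open>With \<open>k = 2 n - l - m\<close> this is \<open>\<pi>^(n/2)\<close> times the product of \<open>\<Gamma>((n - j)/2) / \<Gamma>(j/2)\<close> over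
  \<open>j = l, m, k\<close>, hence symmetric in \<open>l\<close>, \<open>m\<close> and \<open>k\<close>.\<close>

definition Riesz_const :: "nat \<Rightarrow> real \<Rightarrow> real \<Rightarrow> real" where
  "Riesz_const n l m = pi powr (real n / 2) *
     (Gamma ((l + m - real n) / 2) * Gamma ((real n - l) / 2) * Gamma ((real n - m) / 2)) /
     (Gamma (l / 2) * Gamma (m / 2) * Gamma ((2 * real n - l - m) / 2))"

text \<open>Both powers are written as superpositions of Gaussians, with parameters \<open>t\<close> and \<open>s\<close>. The
  integral over \<open>y\<close> is then that of a product of Gaussians. After the substitution \<open>s = t u\<close> the
  integral over \<open>t\<close> is a Gamma integral and the remaining one over \<open>u\<close> a beta integral.\<close>

lemma Riesz_composition:
  fixes x :: "'a::euclidean_space"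
  assumes l: "0 < l" "l < real DIM('a)" and m: "0 < m" "m < real DIM('a)"
    and lm: "real DIM('a) < l + m" and x: "x \<noteq> 0"
  shows "(\<integral>\<^sup>+ y. ennreal (norm (x - y) powr (- l) * norm y powr (- m)) \<partial>lborel)
    = ennreal (Riesz_const DIM('a) l m * norm x powr (real DIM('a) - l - m))"
proof -
  define a b d where "a = l / 2" and "b = m / 2" and "d = real DIM('a) / 2"
  define k where "k = a + b - d"
  define r where "r = norm x"
  have pos: "0 < a" "0 < b" "0 < d" "a < d" "b < d" "0 < k" "0 < r"
    using l m lm x by (auto simp: a_def b_def d_def k_def r_def)
  have G: "0 < Gamma a" "0 < Gamma b" "0 < Gamma k" "0 < Gamma (d - a)" "0 < Gamma (d - b)"
    "0 < Gamma ((d - a) + (d - b))"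
    using pos by (auto intro!: Gamma_real_pos)
  define J where "J = (\<integral>\<^sup>+ y. ennreal (norm (x - y) powr (- l) * norm y powr (- m)) \<partial>lborel)"
  define g where "g e t = ennreal (t powr (e - 1)) * indicator {0<..} t" for e t :: real
  have [measurable]: "g e \<in> borel_measurable borel" for e unfolding g_def by measurable
  have null: "AE y in lborel. y \<noteq> x \<and> y \<noteq> (0::'a)"
    using AE_lborel_singleton[of x] AE_lborel_singleton[of 0] by eventually_elim simp
  have "ennreal (Gamma a * Gamma b) * J
     = (\<integral>\<^sup>+ y. ennreal (Gamma (l / 2) * norm (x - y) powr (- l)) * ennreal (Gamma (m / 2) * norm y powr (- m)) \<partial>lborel)"
    unfolding J_def using pos
    by (subst nn_integral_cmult[symmetric]) (auto intro!: nn_integral_cong simp: ennreal_mult[symmetric] a_def b_def mult_ac)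
  also have "\<dots> = (\<integral>\<^sup>+ y. (\<integral>\<^sup>+ t\<in>{0<..}. ennreal (t powr (l / 2 - 1) * gauss t (x - y)) \<partial>lborel)
      * (\<integral>\<^sup>+ s\<in>{0<..}. ennreal (s powr (m / 2 - 1) * gauss s y) \<partial>lborel) \<partial>lborel)"
  proof (rule nn_integral_cong_AE, use null in eventually_elim)
    case (elim y)
    then have "x - y \<noteq> 0" by auto
    with elim show ?case
      using l m by (intro arg_cong2[of _ _ _ _ "(*)"] norm_powr_eq_Gamma_integral) auto
  qed
  also have "\<dots> = (\<integral>\<^sup>+ y. \<integral>\<^sup>+ t. \<integral>\<^sup>+ s. g a t * (g b s *
       ennreal (gauss t (x - y) * gauss s y)) \<partial>lborel \<partial>lborel \<partial>lborel)"
  proof (intro nn_integral_cong)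
    fix y :: 'a
    define A where "A t = ennreal (gauss t (x - y))" for t
    define B where "B s = ennreal (gauss s y)" for s
    have [measurable]: "A \<in> borel_measurable borel" "B \<in> borel_measurable borel"
      unfolding A_def B_def by measurable
    have "(\<integral>\<^sup>+ t\<in>{0<..}. ennreal (t powr (l / 2 - 1) * gauss t (x - y)) \<partial>lborel)
      * (\<integral>\<^sup>+ s\<in>{0<..}. ennreal (s powr (m / 2 - 1) * gauss s y) \<partial>lborel)
      = (\<integral>\<^sup>+ t. g a t * A t \<partial>lborel) * (\<integral>\<^sup>+ s. g b s * B s \<partial>lborel)"
    proof -
      have "ennreal (t powr (l / 2 - 1) * gauss t (x - y)) * indicator {0<..} t = g a t * A t"
        "ennreal (t powr (m / 2 - 1) * gauss t y) * indicator {0<..} t = g b t * B t" for t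
        by (simp_all add: A_def B_def g_def a_def b_def ennreal_mult' split: split_indicator)
      then show ?thesis by simp
    qed
    also have "\<dots> = (\<integral>\<^sup>+ t. g a t * A t * (\<integral>\<^sup>+ s. g b s * B s \<partial>lborel) \<partial>lborel)"
      by (rule nn_integral_multc[symmetric]) measurable
    also have "\<dots> = (\<integral>\<^sup>+ t. \<integral>\<^sup>+ s. g a t * A t * (g b s * B s) \<partial>lborel \<partial>lborel)"
      by (intro nn_integral_cong nn_integral_cmult[symmetric]) measurable
    also have "\<dots> = (\<integral>\<^sup>+ t. \<integral>\<^sup>+ s. g a t * (g b s *
       ennreal (gauss t (x - y) * gauss s y)) \<partial>lborel \<partial>lborel)"
      unfolding A_def B_def ennreal_mult[OF exp_ge_zero exp_ge_zero]
      by (intro nn_integral_cong) (simp only: mult_ac)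
    finally show "(\<integral>\<^sup>+ t\<in>{0<..}. ennreal (t powr (l / 2 - 1) * gauss t (x - y)) \<partial>lborel)
      * (\<integral>\<^sup>+ s\<in>{0<..}. ennreal (s powr (m / 2 - 1) * gauss s y) \<partial>lborel)
      = (\<integral>\<^sup>+ t. \<integral>\<^sup>+ s. g a t * (g b s *
       ennreal (gauss t (x - y) * gauss s y)) \<partial>lborel \<partial>lborel)" .
  qed
  also have "\<dots> = (\<integral>\<^sup>+ t. \<integral>\<^sup>+ y. \<integral>\<^sup>+ s. g a t * (g b s *
       ennreal (gauss t (x - y) * gauss s y)) \<partial>lborel \<partial>lborel \<partial>lborel)"
    by (rule lborel_pair.Fubini') measurable
  also have "\<dots> = (\<integral>\<^sup>+ t. \<integral>\<^sup>+ s. \<integral>\<^sup>+ y. g a t * (g b s *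
       ennreal (gauss t (x - y) * gauss s y)) \<partial>lborel \<partial>lborel \<partial>lborel)"
    by (intro nn_integral_cong lborel_pair.Fubini') measurable
  also have "\<dots> = (\<integral>\<^sup>+ t. \<integral>\<^sup>+ s. g a t * (g b s *
       ennreal ((pi / (t + s)) powr d * exp (- (t * s / (t + s) * r\<^sup>2)))) \<partial>lborel \<partial>lborel)"
  proof (intro nn_integral_cong)
    fix t s :: real
    show "(\<integral>\<^sup>+ y. g a t * (g b s *
       ennreal (gauss t (x - y) * gauss s y)) \<partial>lborel)
      = g a t * (g b s * ennreal ((pi / (t + s)) powr d * exp (- (t * s / (t + s) * r\<^sup>2))))"
      by (cases "0 < t \<and> 0 < s")
        (auto simp: g_def nn_integral_cmult nn_integral_Gaussian_product d_def r_def)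
  qed
  also have "\<dots> = (\<integral>\<^sup>+ t. \<integral>\<^sup>+ u. ennreal (pi powr d) * (ennreal (u powr (b - 1) * (1 + u) powr (- d)) * indicator {0<..} u) *
       (ennreal (t powr (k - 1) * exp (- ((u / (1 + u) * r\<^sup>2) * t))) * indicator {0<..} t) \<partial>lborel \<partial>lborel)"
  proof (rule nn_integral_cong, goal_cases)
    case (1 t)
    show ?case
    proof (cases "0 < t")
      case t: True
      have "(\<integral>\<^sup>+ s. g a t * (g b s * ennreal ((pi / (t + s)) powr d * exp (- (t * s / (t + s) * r\<^sup>2)))) \<partial>lborel)
        = ennreal \<bar>t\<bar> * (\<integral>\<^sup>+ u. g a t * (g b (0 + t * u) * ennreal ((pi / (t + (0 + t * u))) powr d * exp (- (t * (0 + t * u) / (t + (0 + t * u)) * r\<^sup>2)))) \<partial>lborel)"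
        using t by (intro nn_integral_real_affine) auto
      also have "\<dots> = (\<integral>\<^sup>+ u. ennreal \<bar>t\<bar> * (g a t * (g b (0 + t * u) * ennreal ((pi / (t + (0 + t * u))) powr d * exp (- (t * (0 + t * u) / (t + (0 + t * u)) * r\<^sup>2))))) \<partial>lborel)"
        by (rule nn_integral_cmult[symmetric]) measurable
      also have "\<dots> = (\<integral>\<^sup>+ u. ennreal (pi powr d) * (ennreal (u powr (b - 1) * (1 + u) powr (- d)) * indicator {0<..} u) *
       (ennreal (t powr (k - 1) * exp (- ((u / (1 + u) * r\<^sup>2) * t))) * indicator {0<..} t) \<partial>lborel)"
      proof (intro nn_integral_cong)
        fix u :: real
        show "ennreal \<bar>t\<bar> * (g a t * (g b (0 + t * u) * ennreal ((pi / (t + (0 + t * u))) powr d * exp (- (t * (0 + t * u) / (t + (0 + t * u)) * r\<^sup>2)))))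
          = ennreal (pi powr d) * (ennreal (u powr (b - 1) * (1 + u) powr (- d)) * indicator {0<..} u) *
       (ennreal (t powr (k - 1) * exp (- ((u / (1 + u) * r\<^sup>2) * t))) * indicator {0<..} t)"
        proof (cases "0 < u")
          case u: True
          have 1: "t + t * u = t * (1 + u)" by (simp add: distrib_left)
          have 2: "t * (t * u) / (t * (1 + u)) * r\<^sup>2 = u / (1 + u) * r\<^sup>2 * t"
            using t by simp
          have 3: "g a t = ennreal (t powr (a - 1))" "g b (t * u) = ennreal ((t * u) powr (b - 1))"
            unfolding g_def using t u by simp_all
          have 4: "indicator {0<..} t = (1 :: ennreal)" "indicator {0<..} u = (1 :: ennreal)"
            using t u by simp_all
          define E where "E = exp (- (u / (1 + u) * r\<^sup>2 * t))"
          have E: "0 \<le> E" by (simp add: E_def)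
          have "ennreal \<bar>t\<bar> * (ennreal (t powr (a - 1)) * (ennreal ((t * u) powr (b - 1)) * ennreal ((pi / (t * (1 + u))) powr d * E)))
            = ennreal (t * (t powr (a - 1) * ((t * u) powr (b - 1) * ((pi / (t * (1 + u))) powr d * E))))"
            using t E by (simp add: ennreal_mult[symmetric])
          also have "t * (t powr (a - 1) * ((t * u) powr (b - 1) * ((pi / (t * (1 + u))) powr d * E)))
            = pi powr d * (u powr (b - 1) * (1 + u) powr (- d)) * (t powr (k - 1) * E)"
            using Gaussian_product_kernel_dilate[OF t u] by (simp only: k_def)
          also have "ennreal \<dots> = ennreal (pi powr d) * ennreal (u powr (b - 1) * (1 + u) powr (- d)) * ennreal (t powr (k - 1) * E)"
            using E by (simp add: ennreal_mult)
          finally show ?thesis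
            unfolding add_0 1 2 3 4 mult_1_right E_def .
        next
          case False
          then show ?thesis using t by (simp add: g_def zero_less_mult_iff)
        qed
      qed
      finally show ?thesis .
    qed (simp add: g_def)
  qed
  also have "\<dots> = (\<integral>\<^sup>+ u. \<integral>\<^sup>+ t. ennreal (pi powr d) * (ennreal (u powr (b - 1) * (1 + u) powr (- d)) * indicator {0<..} u) *
       (ennreal (t powr (k - 1) * exp (- ((u / (1 + u) * r\<^sup>2) * t))) * indicator {0<..} t) \<partial>lborel \<partial>lborel)"
    by (rule lborel_pair.Fubini') measurable
  also have "\<dots> = (\<integral>\<^sup>+ u. ennreal (pi powr d * Gamma k * r powr (- (2 * k))) *
      (ennreal (u powr ((d - a) - 1) * (1 + u) powr (- ((d - a) + (d - b)))) * indicator {0<..} u) \<partial>lborel)"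
  proof (intro nn_integral_cong)
    fix u :: real
    show "(\<integral>\<^sup>+ t. ennreal (pi powr d) * (ennreal (u powr (b - 1) * (1 + u) powr (- d)) * indicator {0<..} u) *
       (ennreal (t powr (k - 1) * exp (- ((u / (1 + u) * r\<^sup>2) * t))) * indicator {0<..} t) \<partial>lborel)
      = ennreal (pi powr d * Gamma k * r powr (- (2 * k))) *
      (ennreal (u powr ((d - a) - 1) * (1 + u) powr (- ((d - a) + (d - b)))) * indicator {0<..} u)"
    proof (cases "0 < u")
      case u: True
      have 1: "(u / (1 + u) * r\<^sup>2) powr (- k) = u powr (- k) * (1 + u) powr k * r powr (- (2 * k))"
        using u pos by (simp add: powr_mult powr_divide powr_minus_divide power2_powr)
      have 2: "u powr (d - a - 1) = u powr (b - 1) * u powr (- k)"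
        by (simp add: k_def flip: powr_add)
      have 3: "(1 + u) powr (- ((d - a) + (d - b))) = (1 + u) powr (- d) * (1 + u) powr k"
        by (simp add: k_def algebra_simps flip: powr_add)
      show ?thesis
      proof -
        have 4: "0 < u / (1 + u) * r\<^sup>2" using u pos by simp
        have 5: "indicator {0<..} u = (1 :: ennreal)" using u by simp
        have "(\<integral>\<^sup>+ t. ennreal (pi powr d) * (ennreal (u powr (b - 1) * (1 + u) powr (- d)) * indicator {0<..} u) *
           (ennreal (t powr (k - 1) * exp (- ((u / (1 + u) * r\<^sup>2) * t))) * indicator {0<..} t) \<partial>lborel)
          = ennreal (pi powr d) * (ennreal (u powr (b - 1) * (1 + u) powr (- d)) * indicator {0<..} u) *
           (\<integral>\<^sup>+ t\<in>{0<..}. ennreal (t powr (k - 1) * exp (- ((u / (1 + u) * r\<^sup>2) * t))) \<partial>lborel)"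
          by (rule nn_integral_cmult) measurable
        also have "\<dots> = ennreal (pi powr d) * ennreal (u powr (b - 1) * (1 + u) powr (- d)) *
           ennreal (Gamma k * (u powr (- k) * (1 + u) powr k * r powr (- (2 * k))))"
          unfolding nn_integral_Gamma_kernel[OF \<open>0 < k\<close> 4] 1 5 mult_1_right ..
        also have "\<dots> = ennreal (pi powr d * Gamma k * r powr (- (2 * k)) * ((u powr (b - 1) * u powr (- k)) * ((1 + u) powr (- d) * (1 + u) powr k)))"
          using pos by (simp add: ennreal_mult[symmetric])
        finally show ?thesis
          unfolding 2 3 5 mult_1_right using pos by (simp add: ennreal_mult)
      qed
    qed simp
  qed
  also have "\<dots> = ennreal (pi powr d * Gamma k * r powr (- (2 * k))) * ennreal (Gamma (d - a) * Gamma (d - b) / Gamma ((d - a) + (d - b)))"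
  proof -
    have "0 < d - a" "0 < d - b" using pos by auto
    then show ?thesis
      unfolding nn_integral_Beta_kernel[of "d - a" "d - b", symmetric, OF \<open>0 < d - a\<close> \<open>0 < d - b\<close>]
      by (intro nn_integral_cmult) measurable
  qed
  also have "\<dots> = ennreal (pi powr d * Gamma k * r powr (- (2 * k)) * (Gamma (d - a) * Gamma (d - b) / Gamma ((d - a) + (d - b))))"
    using G by (intro ennreal_mult[symmetric]) auto
  finally have *: "ennreal (Gamma a * Gamma b) * J = \<dots>" .
  have "J = ennreal (1 / (Gamma a * Gamma b) * (Gamma a * Gamma b)) * J"
    using G by simp
  also have "\<dots> = ennreal (1 / (Gamma a * Gamma b)) * (ennreal (Gamma a * Gamma b) * J)"
    using G by (subst ennreal_mult) (auto simp: mult.assoc)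
  also have "\<dots> = ennreal (1 / (Gamma a * Gamma b) * (pi powr d * Gamma k * r powr (- (2 * k)) * (Gamma (d - a) * Gamma (d - b) / Gamma ((d - a) + (d - b)))))"
    unfolding * using G by (intro ennreal_mult[symmetric]) auto
  also have "1 / (Gamma a * Gamma b) * (pi powr d * Gamma k * r powr (- (2 * k)) * (Gamma (d - a) * Gamma (d - b) / Gamma ((d - a) + (d - b))))
    = Riesz_const DIM('a) l m * norm x powr (real DIM('a) - l - m)"
  proof -
    have "(l + m - real DIM('a)) / 2 = k" "(real DIM('a) - l) / 2 = d - a" "(real DIM('a) - m) / 2 = d - b"
      "(2 * real DIM('a) - l - m) / 2 = (d - a) + (d - b)" "real DIM('a) - l - m = - (2 * k)"
      by (auto simp: k_def a_def b_def d_def field_simps)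
    note eqs = this
    show ?thesis
      unfolding Riesz_const_def eqs a_def[symmetric] b_def[symmetric] d_def[symmetric] r_def[symmetric]
      by simp
  qed
  finally show ?thesis unfolding J_def .
qed

section \<open>The inequalities of Stein--Weiss and Hardy\<close>

text \<open>This is the symmetry that makes the two eigenvalues in Schur's test agree.\<close>

lemma Riesz_const_reflect:
  assumes "m + m' = 2 * real n - l"
  shows "Riesz_const n l m = Riesz_const n l m'"
proof -
  have "(l + m - real n) / 2 = (real n - m') / 2" "(real n - m) / 2 = (l + m' - real n) / 2"
    "(2 * real n - l - m) / 2 = m' / 2" "(2 * real n - l - m') / 2 = m / 2"
    using assms by auto
  then show ?thesis unfolding Riesz_const_def by (simp only: mult_ac)
qed

lemma Riesz_const_pos:
  assumes "0 < l" "l < real n" "0 < m" "m < real n" "real n < l + m"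
  shows "0 < Riesz_const n l m"
  unfolding Riesz_const_def using assms
  by (intro divide_pos_pos mult_pos_pos Gamma_real_pos) auto

text \<open>The kernel is homogeneous of degree \<open>-n\<close>. Hence \<open>|x|^(-n/p)\<close> and \<open>|x|^(-n/p')\<close> are
  eigenfunctions of the operator and of its transpose; by \<open>Riesz_composition\<close> the eigenvalues
  are Riesz constants with third indices exchanged, so they agree, and Schur's test applies with
  \<open>u = |x|^(-n/p)\<close>.\<close>

lemma Stein_Weiss:
  fixes h :: "'a::euclidean_space \<Rightarrow> ennreal"
  defines "n \<equiv> real DIM('a)"
  assumes p: "1 < p" and l: "0 < l" "l < n" and a: "\<alpha> < n / p" and b: "b < n - n / p"
    and hom: "l + \<alpha> + b = n"
    and [measurable]: "h \<in> borel_measurable borel"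
  shows "(\<integral>\<^sup>+ x. epow (\<integral>\<^sup>+ y. ennreal (norm x powr (- \<alpha>) * norm (x - y) powr (- l) * norm y powr (- b)) * h y \<partial>lborel) p \<partial>lborel)
    \<le> ennreal (Riesz_const DIM('a) l (b + n / p) powr p) * (\<integral>\<^sup>+ y. epow (h y) p \<partial>lborel)"
proof (rule Schur_test[where u = "\<lambda>x. norm x powr (- (n / p))"])
  define R where "R = Riesz_const DIM('a) l (b + n / p)"
  have m: "0 < b + n / p" "b + n / p < n" "n < l + (b + n / p)"
    using l a b hom by (auto simp: algebra_simps)
  have m': "0 < \<alpha> + n - n / p" "\<alpha> + n - n / p < n" "n < l + (\<alpha> + n - n / p)"
    using l a b hom by (auto simp: algebra_simps)
  have R: "0 < R" unfolding R_def using l m by (intro Riesz_const_pos) (auto simp: n_def)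
  then show "0 \<le> Riesz_const DIM('a) l (b + n / p)" by (simp add: R_def)
  have R': "R = Riesz_const DIM('a) l (\<alpha> + n - n / p)"
    unfolding R_def using hom by (intro Riesz_const_reflect) (simp add: n_def)
  have nz: "AE x in lborel. x \<noteq> (0::'a)" by (rule AE_lborel_singleton)
  show "AE x in lborel. 0 < norm (x::'a) powr (- (n / p))"
    using nz by eventually_elim simp
  show "AE x in lborel. (\<integral>\<^sup>+ y. ennreal (norm x powr (- \<alpha>) * norm (x - y) powr (- l) * norm y powr (- b)) * ennreal (norm y powr (- (n / p))) \<partial>lborel)
      \<le> ennreal (Riesz_const DIM('a) l (b + n / p) * norm (x::'a) powr (- (n / p)))"
    using nz
  proof eventually_elim
    case (elim x)
    have "(\<integral>\<^sup>+ y. ennreal (norm x powr (- \<alpha>) * norm (x - y) powr (- l) * norm y powr (- b)) * ennreal (norm y powr (- (n / p))) \<partial>lborel)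
      = (\<integral>\<^sup>+ y. ennreal (norm x powr (- \<alpha>)) * ennreal (norm (x - y) powr (- l) * norm y powr (- (b + n / p))) \<partial>lborel)"
    proof (rule nn_integral_cong, goal_cases)
      case (1 y)
      have "norm y powr (- (b + n / p)) = norm y powr (- b) * norm y powr (- (n / p))"
        by (simp flip: powr_add)
      then show ?case
        by (simp add: ennreal_mult[symmetric])
    qed
    also have "\<dots> = ennreal (norm x powr (- \<alpha>)) * (\<integral>\<^sup>+ y. ennreal (norm (x - y) powr (- l) * norm y powr (- (b + n / p))) \<partial>lborel)"
      by (rule nn_integral_cmult) measurable
    also have "(\<integral>\<^sup>+ y. ennreal (norm (x - y) powr (- l) * norm y powr (- (b + n / p))) \<partial>lborel) = ennreal (R * norm x powr (n - l - (b + n / p)))"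
      unfolding R_def n_def using l m elim by (intro Riesz_composition) (auto simp: n_def)
    also have "ennreal (norm x powr (- \<alpha>)) * \<dots> = ennreal (R * (norm x powr (- \<alpha>) * norm x powr (n - l - (b + n / p))))"
      using R by (simp add: ennreal_mult[symmetric])
    also have "norm x powr (- \<alpha>) * norm x powr (n - l - (b + n / p)) = norm x powr (- (n / p))"
      unfolding powr_add[symmetric] using hom by (intro arg_cong[of _ _ "(powr) _"]) linarith
    finally show ?case by (simp add: R_def)
  qed
  \<comment> \<open>The exponent of \<open>u^(p - 1)\<close> is \<open>-n/p'\<close>.\<close>
  have conj: "- (n / p) * (p - 1) = - (n - n / p)" using p by (simp add: field_simps)
  have u: "(norm y powr (- (n / p))) powr (p - 1) = norm y powr (- (n - n / p))" for y :: 'a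
    unfolding powr_powr conj ..
  show "AE y in lborel. (\<integral>\<^sup>+ x. ennreal (norm x powr (- \<alpha>) * norm (x - y) powr (- l) * norm y powr (- b)) * ennreal ((norm x powr (- (n / p))) powr (p - 1)) \<partial>lborel)
      \<le> ennreal (Riesz_const DIM('a) l (b + n / p) * (norm (y::'a) powr (- (n / p))) powr (p - 1))"
    using nz
  proof eventually_elim
    case (elim y)
    have "(\<integral>\<^sup>+ x. ennreal (norm x powr (- \<alpha>) * norm (x - y) powr (- l) * norm y powr (- b)) * ennreal ((norm x powr (- (n / p))) powr (p - 1)) \<partial>lborel)
      = (\<integral>\<^sup>+ x. ennreal (norm y powr (- b)) * ennreal (norm (y - x) powr (- l) * norm x powr (- (\<alpha> + n - n / p))) \<partial>lborel)"
    proof (rule nn_integral_cong, goal_cases)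
      case (1 x)
      have "norm x powr (- (\<alpha> + n - n / p)) = norm x powr (- \<alpha>) * norm x powr (- (n - n / p))"
        by (simp add: algebra_simps flip: powr_add)
      then show ?case
        unfolding u by (simp add: ennreal_mult[symmetric] norm_minus_commute mult_ac)
    qed
    also have "\<dots> = ennreal (norm y powr (- b)) * (\<integral>\<^sup>+ x. ennreal (norm (y - x) powr (- l) * norm x powr (- (\<alpha> + n - n / p))) \<partial>lborel)"
      by (rule nn_integral_cmult) measurable
    also have "(\<integral>\<^sup>+ x. ennreal (norm (y - x) powr (- l) * norm x powr (- (\<alpha> + n - n / p))) \<partial>lborel) = ennreal (R * norm y powr (n - l - (\<alpha> + n - n / p)))"
      unfolding R' n_def using l m' elim by (intro Riesz_composition) (auto simp: n_def)
    also have "ennreal (norm y powr (- b)) * \<dots> = ennreal (R * (norm y powr (- b) * norm y powr (n - l - (\<alpha> + n - n / p))))"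
      using R by (simp add: ennreal_mult[symmetric])
    also have "norm y powr (- b) * norm y powr (n - l - (\<alpha> + n - n / p)) = norm y powr (- (n - n / p))"
      unfolding powr_add[symmetric] using hom by (intro arg_cong[of _ _ "(powr) _"]) linarith
    finally show ?case unfolding u by (simp add: R_def)
  qed
qed (use p in measurable)

lemma nn_integral_powr_atLeast_1:
  assumes c: "1 < c"
  shows "(\<integral>\<^sup>+ t\<in>{1..}. ennreal (t powr (- c)) \<partial>lborel) = ennreal (1 / (c - 1))"
proof -
  have D: "((\<lambda>t. - (t powr (1 - c) / (c - 1))) has_real_derivative x powr (- c)) (at x)" if "1 \<le> x" for x
  proof -
    have "((\<lambda>t. - (t powr (1 - c) / (c - 1))) has_real_derivative - ((1 - c) * x powr (1 - c - 1) / (c - 1))) (at x)"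
      using that c by (intro derivative_intros DERIV_cdivide has_real_derivative_powr) auto
    moreover have "- ((1 - c) * e / (c - 1)) = e" for e :: real
      using c by (simp add: field_simps)
    ultimately show ?thesis by simp
  qed
  have "((\<lambda>t. - (t powr (1 - c) / (c - 1))) \<longlongrightarrow> - (0 / (c - 1))) at_top"
    using c by (intro tendsto_intros tendsto_neg_powr filterlim_ident) auto
  then have "(\<integral>\<^sup>+ t\<in>{1..}. ennreal (t powr (- c)) \<partial>lborel) = ennreal (- (0 / (c - 1)) - (- (1 powr (1 - c) / (c - 1))))"
    using c by (intro nn_integral_FTC_atLeast[where F = "\<lambda>t. - (t powr (1 - c) / (c - 1))"])
      (auto intro!: D)
  then show ?thesis by simp
qed

text \<open>With \<open>G(x) = |x|^\<beta> v(x)\<close> the function on the left is the integral of \<open>t^(-\<beta>) G(t x)\<close> over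
  \<open>t \<ge> 1\<close>. The \<open>L^p\<close> norm of \<open>G(t x)\<close> is \<open>t^(-n/p)\<close> times that of \<open>G\<close>. So the weight
  \<open>t^(-\<beta> - n/p)\<close>, whose total mass is the constant of the inequality, is the right one for
  Jensen's inequality.\<close>

lemma Hardy_inequality:
  fixes v :: "'a::euclidean_space \<Rightarrow> ennreal"
  defines "n \<equiv> real DIM('a)"
  assumes p: "1 < p" and b: "0 < n / p + \<beta> - 1"
    and [measurable]: "v \<in> borel_measurable borel"
  shows "(\<integral>\<^sup>+ x. epow (ennreal (norm x powr (\<beta> - 1)) * (\<integral>\<^sup>+ t\<in>{1..}. ennreal (norm x) * v (t *\<^sub>R x) \<partial>lborel)) p \<partial>lborel)
    \<le> ennreal ((1 / (n / p + \<beta> - 1)) powr p) * (\<integral>\<^sup>+ x. epow (ennreal (norm x powr \<beta>) * v x) p \<partial>lborel)"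
proof -
  define W where "W = 1 / (n / p + \<beta> - 1)"
  have W: "0 < W" using b by (simp add: W_def)
  define G where "G x = ennreal (norm x powr \<beta>) * v x" for x
  have [measurable]: "G \<in> borel_measurable borel" unfolding G_def by measurable
  define w where "w t = ennreal (t powr (- (\<beta> + n / p))) * indicator {1..} t" for t :: real
  have [measurable]: "w \<in> borel_measurable borel" unfolding w_def by measurable
  have Wint: "(\<integral>\<^sup>+ t. w t \<partial>lborel) = ennreal W"
    unfolding w_def using nn_integral_powr_atLeast_1[of "\<beta> + n / p"] b by (simp add: W_def add_ac)
  have "(\<integral>\<^sup>+ x. epow (ennreal (norm x powr (\<beta> - 1)) * (\<integral>\<^sup>+ t\<in>{1..}. ennreal (norm x) * v (t *\<^sub>R x) \<partial>lborel)) p \<partial>lborel)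
    \<le> (\<integral>\<^sup>+ x. ennreal (W powr (p - 1)) * (\<integral>\<^sup>+ t. w t * epow (ennreal (t powr (n / p)) * G (t *\<^sub>R x)) p \<partial>lborel) \<partial>lborel)"
  proof (rule nn_integral_mono_AE, use AE_lborel_singleton[of 0] in eventually_elim)
    case (elim x)
    have "ennreal (norm x powr (\<beta> - 1)) * (\<integral>\<^sup>+ t\<in>{1..}. ennreal (norm x) * v (t *\<^sub>R x) \<partial>lborel)
       = (\<integral>\<^sup>+ t. ennreal (norm x powr (\<beta> - 1)) * (ennreal (norm x) * v (t *\<^sub>R x) * indicator {1..} t) \<partial>lborel)"
      by (rule nn_integral_cmult[symmetric]) measurable
    also have "\<dots> = (\<integral>\<^sup>+ t. w t * (ennreal (t powr (n / p)) * G (t *\<^sub>R x)) \<partial>lborel)"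
    proof (rule nn_integral_cong, goal_cases)
      case (1 t)
      show ?case
      proof (cases "1 \<le> t")
        case t: True
        have "t powr (- (\<beta> + n / p)) * (t powr (n / p) * norm (t *\<^sub>R x) powr \<beta>)
            = (t powr (- (\<beta> + n / p)) * t powr (n / p) * t powr \<beta>) * norm x powr \<beta>"
          using t by (simp add: powr_mult)
        also have "t powr (- (\<beta> + n / p)) * t powr (n / p) * t powr \<beta> = 1"
          using t by (simp flip: powr_add)
        also have "1 * norm x powr \<beta> = norm x powr (\<beta> - 1) * norm x"
          using elim by (simp add: powr_diff)
        finally have "ennreal (t powr (- (\<beta> + n / p))) * (ennreal (t powr (n / p)) * ennreal (norm (t *\<^sub>R x) powr \<beta>))
            = ennreal (norm x powr (\<beta> - 1)) * ennreal (norm x)"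
          by (simp only: ennreal_mult[symmetric] powr_ge_zero norm_ge_zero mult_nonneg_nonneg)
        then show ?thesis using t by (simp add: w_def G_def mult.assoc[symmetric])
      qed (simp add: w_def)
    qed
    also have "epow \<dots> p \<le> epow (\<integral>\<^sup>+ t. w t \<partial>lborel) (p - 1) * (\<integral>\<^sup>+ t. w t * epow (ennreal (t powr (n / p)) * G (t *\<^sub>R x)) p \<partial>lborel)"
      using p by (intro epow_nn_integral_le) (auto simp: Wint)
    also have "epow (\<integral>\<^sup>+ t. w t \<partial>lborel) (p - 1) = ennreal (W powr (p - 1))"
      using W by (simp add: Wint)
    finally show ?case .
  qed
  also have "\<dots> = ennreal (W powr (p - 1)) * (\<integral>\<^sup>+ x. \<integral>\<^sup>+ t. w t * epow (ennreal (t powr (n / p)) * G (t *\<^sub>R x)) p \<partial>lborel \<partial>lborel)"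
    by (rule nn_integral_cmult) measurable
  also have "(\<integral>\<^sup>+ x. \<integral>\<^sup>+ t. w t * epow (ennreal (t powr (n / p)) * G (t *\<^sub>R x)) p \<partial>lborel \<partial>lborel)
     = (\<integral>\<^sup>+ t. \<integral>\<^sup>+ x. w t * epow (ennreal (t powr (n / p)) * G (t *\<^sub>R x)) p \<partial>lborel \<partial>lborel)"
    by (rule lborel_pair.Fubini') measurable
  also have "\<dots> = (\<integral>\<^sup>+ t. w t * (\<integral>\<^sup>+ x. epow (G x) p \<partial>lborel) \<partial>lborel)"
  proof (rule nn_integral_cong, goal_cases)
    case (1 t)
    show ?case
    proof (cases "1 \<le> t")
      case t: True
      have tn: "(t powr (n / p)) powr p = \<bar>t\<bar> ^ DIM('a)"
        using t p by (simp add: powr_powr n_def powr_realpow)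
      have "(\<integral>\<^sup>+ x. w t * epow (ennreal (t powr (n / p)) * G (t *\<^sub>R x)) p \<partial>lborel)
        = w t * (\<integral>\<^sup>+ x. epow (ennreal (t powr (n / p)) * G (t *\<^sub>R x)) p \<partial>lborel)"
        by (rule nn_integral_cmult) measurable
      also have "(\<integral>\<^sup>+ x. epow (ennreal (t powr (n / p)) * G (t *\<^sub>R x)) p \<partial>lborel)
        = (\<integral>\<^sup>+ x. ennreal (\<bar>t\<bar> ^ DIM('a)) * epow (G (0 + t *\<^sub>R x)) p \<partial>lborel)"
        using p by (simp add: epow_mult tn)
      also have "\<dots> = ennreal (\<bar>t\<bar> ^ DIM('a)) * (\<integral>\<^sup>+ x. epow (G (0 + t *\<^sub>R x)) p \<partial>lborel)"
        by (rule nn_integral_cmult) measurable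
      also have "\<dots> = (\<integral>\<^sup>+ x. epow (G x) p \<partial>lborel)"
        using t by (intro nn_integral_lborel_affine[symmetric]) auto
      finally show ?thesis .
    qed (simp add: w_def)
  qed
  also have "\<dots> = ennreal W * (\<integral>\<^sup>+ x. epow (G x) p \<partial>lborel)"
    by (subst nn_integral_multc) (auto simp: Wint)
  also have "ennreal (W powr (p - 1)) * (ennreal W * (\<integral>\<^sup>+ x. epow (G x) p \<partial>lborel)) = ennreal (W powr p) * (\<integral>\<^sup>+ x. epow (G x) p \<partial>lborel)"
    using W by (simp add: mult.assoc[symmetric] ennreal_mult[symmetric] powr_diff)
  finally show ?thesis unfolding W_def G_def .
qed

text \<open>The Stein--Weiss inequality for \<open>|x|^(\<beta> - 1) f\<close> with \<open>b = \<beta> + \<sigma> - 1\<close>, followed by Hardy's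
  inequality. Here \<open>v\<close> stands for the length of the gradient; the hypothesis on \<open>f\<close> and \<open>v\<close> is
  what the fundamental theorem of calculus gives if the function vanishes at infinity.\<close>

lemma Stein_Weiss_gradient:
  fixes f v :: "'a::euclidean_space \<Rightarrow> ennreal"
  assumes p: "1 < p" and p': "1 / p + 1 / p' = 1"
    and l: "0 < l" "l < real DIM('a)" and a: "\<alpha> < real DIM('a) / p"
    and b: "1 - real DIM('a) / p < \<beta>"
    and hom: "real DIM('a) + 1 = l + \<alpha> + \<beta> + \<sigma>"
    and bs: "0 < real DIM('a) / (2 * p') - (\<beta> + \<sigma> - 1) / 2"
    and [measurable]: "f \<in> borel_measurable borel" "v \<in> borel_measurable borel"
    and fv: "AE x in lborel. f x \<le> (\<integral>\<^sup>+ t\<in>{1..}. ennreal (norm x) * v (t *\<^sub>R x) \<partial>lborel)"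
  shows "epow (\<integral>\<^sup>+ x. epow (ennreal (norm x powr (- \<alpha>)) * (\<integral>\<^sup>+ y. ennreal (norm (x - y) powr (- l) * norm y powr (- \<sigma>)) * f y \<partial>lborel)) p \<partial>lborel) (1 / p)
    \<le> ennreal (F_const DIM('a) p p' \<alpha> \<beta> \<sigma>) * epow (\<integral>\<^sup>+ x. epow (ennreal (norm x powr \<beta>) * v x) p \<partial>lborel) (1 / p)"
proof -
  define n where "n = real DIM('a)"
  define b where "b = \<beta> + \<sigma> - 1"
  define R where "R = Riesz_const DIM('a) l (b + n / p)"
  define H where "H = 1 / (n / p + \<beta> - 1)"
  define h where "h y = ennreal (norm y powr (\<beta> - 1)) * f y" for y
  have [measurable]: "h \<in> borel_measurable borel" unfolding h_def by measurable
  have H: "0 < H" using assms(6) by (simp add: H_def n_def)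
  have np': "n / p' = n - n / p"
  proof -
    have "n / p + n / p' = n * (1 / p + 1 / p')" by (simp add: distrib_left)
    then show ?thesis by (simp add: p')
  qed
  have bn: "b < n - n / p" using bs np' by (simp add: b_def n_def field_simps)
  have m: "0 < b + n / p" "b + n / p < n" "n < l + (b + n / p)"
    using l a bn hom by (auto simp: b_def n_def)
  have R: "0 < R" unfolding R_def using l m by (intro Riesz_const_pos) (auto simp: n_def)
  have F: "F_const DIM('a) p p' \<alpha> \<beta> \<sigma> = R * H"
  proof -
    have eqs: "(l + (b + n / p) - n) / 2 = n / (2 * p) - \<alpha> / 2" "(n - l) / 2 = (\<alpha> + \<beta> + \<sigma> - 1) / 2"
      "(n - (b + n / p)) / 2 = n / (2 * p') - (\<beta> + \<sigma> - 1) / 2"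
      "l / 2 = (n + 1 - \<alpha> - \<beta> - \<sigma>) / 2" "(b + n / p) / 2 = n / (2 * p) + (\<beta> + \<sigma> - 1) / 2"
      "(2 * n - l - (b + n / p)) / 2 = n / (2 * p') + \<alpha> / 2"
    proof -
      have l': "l = n + 1 - \<alpha> - \<beta> - \<sigma>" using hom by (simp add: n_def)
      define q where "q = n / p"
      have h: "n / (2 * p) = q / 2" "n / (2 * p') = (n - q) / 2" "n / p = q"
        using np' by (simp_all add: q_def)
      show "(l + (b + n / p) - n) / 2 = n / (2 * p) - \<alpha> / 2" "(n - l) / 2 = (\<alpha> + \<beta> + \<sigma> - 1) / 2"
        "(n - (b + n / p)) / 2 = n / (2 * p') - (\<beta> + \<sigma> - 1) / 2"
        "l / 2 = (n + 1 - \<alpha> - \<beta> - \<sigma>) / 2" "(b + n / p) / 2 = n / (2 * p) + (\<beta> + \<sigma> - 1) / 2"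
        "(2 * n - l - (b + n / p)) / 2 = n / (2 * p') + \<alpha> / 2"
        unfolding h b_def l' by (simp_all add: field_simps)
    qed
    show ?thesis
      unfolding F_const_def R_def Riesz_const_def H_def n_def[symmetric] eqs
      by (simp only: divide_inverse mult_1_left inverse_mult_distrib mult_ac)
  qed
  have "(\<integral>\<^sup>+ x. epow (ennreal (norm x powr (- \<alpha>)) * (\<integral>\<^sup>+ y. ennreal (norm (x - y) powr (- l) * norm y powr (- \<sigma>)) * f y \<partial>lborel)) p \<partial>lborel)
    = (\<integral>\<^sup>+ x. epow (\<integral>\<^sup>+ y. ennreal (norm x powr (- \<alpha>) * norm (x - y) powr (- l) * norm y powr (- b)) * h y \<partial>lborel) p \<partial>lborel)"
  proof (rule nn_integral_cong, rule arg_cong[where f = "\<lambda>e. epow e p"])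
    fix x :: 'a
    have "ennreal (norm x powr (- \<alpha>)) * (\<integral>\<^sup>+ y. ennreal (norm (x - y) powr (- l) * norm y powr (- \<sigma>)) * f y \<partial>lborel)
      = (\<integral>\<^sup>+ y. ennreal (norm x powr (- \<alpha>)) * (ennreal (norm (x - y) powr (- l) * norm y powr (- \<sigma>)) * f y) \<partial>lborel)"
      by (rule nn_integral_cmult[symmetric]) measurable
    also have "\<dots> = (\<integral>\<^sup>+ y. ennreal (norm x powr (- \<alpha>) * norm (x - y) powr (- l) * norm y powr (- b)) * h y \<partial>lborel)"
    proof (rule nn_integral_cong, goal_cases)
      case (1 y)
      have "norm y powr (- \<sigma>) = norm y powr (- b) * norm y powr (\<beta> - 1)"
        by (simp add: b_def flip: powr_add)
      then show ?case
        by (simp add: h_def ennreal_mult mult.assoc)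
    qed
    finally show "ennreal (norm x powr (- \<alpha>)) * (\<integral>\<^sup>+ y. ennreal (norm (x - y) powr (- l) * norm y powr (- \<sigma>)) * f y \<partial>lborel)
      = (\<integral>\<^sup>+ y. ennreal (norm x powr (- \<alpha>) * norm (x - y) powr (- l) * norm y powr (- b)) * h y \<partial>lborel)" .
  qed
  also have "\<dots> \<le> ennreal (R powr p) * (\<integral>\<^sup>+ y. epow (h y) p \<partial>lborel)"
    unfolding R_def n_def using p l a bn hom by (intro Stein_Weiss) (auto simp: b_def n_def)
  also have "(\<integral>\<^sup>+ y. epow (h y) p \<partial>lborel)
    \<le> (\<integral>\<^sup>+ x. epow (ennreal (norm x powr (\<beta> - 1)) * (\<integral>\<^sup>+ t\<in>{1..}. ennreal (norm x) * v (t *\<^sub>R x) \<partial>lborel)) p \<partial>lborel)"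
    using p unfolding h_def
    by (intro nn_integral_mono_AE, use fv in eventually_elim) (intro epow_mono mult_left_mono, auto)
  also have "\<dots> \<le> ennreal (H powr p) * (\<integral>\<^sup>+ x. epow (ennreal (norm x powr \<beta>) * v x) p \<partial>lborel)"
    unfolding H_def n_def using p assms(6) by (intro Hardy_inequality) auto
  finally have "(\<integral>\<^sup>+ x. epow (ennreal (norm x powr (- \<alpha>)) * (\<integral>\<^sup>+ y. ennreal (norm (x - y) powr (- l) * norm y powr (- \<sigma>)) * f y \<partial>lborel)) p \<partial>lborel)
    \<le> ennreal (R powr p) * (ennreal (H powr p) * (\<integral>\<^sup>+ x. epow (ennreal (norm x powr \<beta>) * v x) p \<partial>lborel))"
    by (simp add: mult_left_mono)
  also have "\<dots> = epow (ennreal (R * H)) p * (\<integral>\<^sup>+ x. epow (ennreal (norm x powr \<beta>) * v x) p \<partial>lborel)"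
    using R H p by (simp add: epow_mult ennreal_mult mult.assoc)
  finally have "epow (\<integral>\<^sup>+ x. epow (ennreal (norm x powr (- \<alpha>)) * (\<integral>\<^sup>+ y. ennreal (norm (x - y) powr (- l) * norm y powr (- \<sigma>)) * f y \<partial>lborel)) p \<partial>lborel) (1 / p)
     \<le> epow (epow (ennreal (R * H)) p * (\<integral>\<^sup>+ x. epow (ennreal (norm x powr \<beta>) * v x) p \<partial>lborel)) (1 / p)"
    using p by (intro epow_mono) auto
  also have "\<dots> = ennreal (R * H) * epow (\<integral>\<^sup>+ x. epow (ennreal (norm x powr \<beta>) * v x) p \<partial>lborel) (1 / p)"
    using p by (simp add: epow_mult epow_epow del: epow_ennreal)
  finally show ?thesis unfolding F .
qed

section \<open>Integration along rays and the first inequality\<close>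

lemma partial_derivs_append: "partial_derivs (js @ is) f = partial_derivs js (partial_derivs is f)"
  by (induction js) auto

lemma schwartz_partial_derivs: "f \<in> schwartz \<Longrightarrow> partial_derivs is f \<in> schwartz"
  unfolding schwartz_def by (simp flip: partial_derivs_append)

lemma schwartz_partial_deriv: "f \<in> schwartz \<Longrightarrow> partial_deriv i f \<in> schwartz"
  using schwartz_partial_derivs[of f "[i]"] by simp

lemma schwartz_differentiable: "f \<in> schwartz \<Longrightarrow> f differentiable (at x)"
  unfolding schwartz_def by (metis (mono_tags, lifting) mem_Collect_eq partial_derivs.simps(1))

lemma schwartz_continuous: "f \<in> schwartz \<Longrightarrow> continuous_on A f"
  by (simp add: continuous_at_imp_continuous_on differentiable_imp_continuous_within schwartz_differentiable)

lemma schwartz_measurable: "f \<in> schwartz \<Longrightarrow> f \<in> borel_measurable borel"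
  by (intro borel_measurable_continuous_onI schwartz_continuous)

lemma schwartz_bound:
  assumes "f \<in> schwartz"
  obtains C where "0 \<le> C" "\<And>x. norm (f x) \<le> C / (1 + norm x) ^ k"
proof -
  have "bounded (range (\<lambda>x. (1 + norm x) ^ k *\<^sub>R partial_derivs [] f x))"
    using assms unfolding schwartz_def by blast
  then obtain C where C: "\<And>x. norm ((1 + norm x) ^ k *\<^sub>R f x) \<le> C"
    by (auto simp: bounded_iff)
  have "norm (f x) \<le> C / (1 + norm x) ^ k" for x
    using C[of x] by (simp add: pos_le_divide_eq add_pos_nonneg mult.commute)
  moreover have "0 \<le> C" using order_trans[OF norm_ge_zero C[of 0]] by simp
  ultimately show thesis using that by blast
qed

text \<open>The functions \<open>|x|^\<sigma> (-\<Delta>)^(s/2) g\<close> are in general not differentiable at the origin.\<close>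

definition punctured_C1 :: "(real^'n::finite \<Rightarrow> complex) \<Rightarrow> bool" where
  "punctured_C1 f \<longleftrightarrow> (\<forall>x. x \<noteq> 0 \<longrightarrow> f differentiable (at x)) \<and> continuous_on (- {0}) (gradient f)"

lemma schwartz_punctured_C1:
  assumes "f \<in> schwartz"
  shows "punctured_C1 f"
  unfolding punctured_C1_def gradient_def
  using assms by (auto intro!: continuous_on_vec_lambda schwartz_continuous schwartz_partial_deriv schwartz_differentiable)

lemma punctured_C1_gradient_measurable:
  "punctured_C1 f \<Longrightarrow> gradient f \<in> borel_measurable borel"
  unfolding punctured_C1_def by (intro borel_measurable_continuous_countable_exceptions[of "{0}"]) auto

lemma frechet_derivative_eq_sum_partial:
  fixes f :: "real^'n::finite \<Rightarrow> complex"
  assumes "f differentiable (at y)"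
  shows "frechet_derivative f (at y) x = (\<Sum>i\<in>UNIV. x $ i *\<^sub>R partial_deriv i f y)"
proof -
  interpret D: bounded_linear "frechet_derivative f (at y)"
    using assms has_derivative_bounded_linear frechet_derivative_works by blast
  have "x = (\<Sum>i\<in>UNIV. x $ i *\<^sub>R axis i 1)"
    using basis_expansion[of x] by (simp add: scalar_mult_eq_scaleR)
  then have "frechet_derivative f (at y) x = frechet_derivative f (at y) (\<Sum>i\<in>UNIV. x $ i *\<^sub>R axis i 1)"
    by simp
  then show ?thesis by (simp add: D.sum D.scale partial_deriv_def)
qed

lemma norm_frechet_derivative_le_gradient:
  fixes f :: "real^'n::finite \<Rightarrow> complex"
  assumes "f differentiable (at y)"
  shows "norm (frechet_derivative f (at y) x) \<le> norm x * norm (gradient f y)"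
proof -
  have "norm (frechet_derivative f (at y) x) \<le> (\<Sum>i\<in>UNIV. \<bar>norm (x $ i)\<bar> * \<bar>norm (gradient f y $ i)\<bar>)"
    unfolding frechet_derivative_eq_sum_partial[OF assms] gradient_def
    by (intro order_trans[OF norm_sum]) simp
  also have "\<dots> \<le> norm x * norm (gradient f y)"
    unfolding norm_vec_def by (rule L2_set_mult_ineq)
  finally show ?thesis .
qed

text \<open>The fundamental theorem of calculus for \<open>t \<mapsto> f(t x)\<close>, whose derivative is at most
  \<open>|x| |\<nabla>f(t x)|\<close>.\<close>

lemma ray_increment_le:
  fixes f :: "real^'n::finite \<Rightarrow> complex"
  assumes f: "punctured_C1 f" and x: "x \<noteq> 0" and T: "1 \<le> T"
  shows "ennreal (norm (f (T *\<^sub>R x) - f x))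
    \<le> (\<integral>\<^sup>+ t\<in>{1..}. ennreal (norm x) * ennreal (norm (gradient f (t *\<^sub>R x))) \<partial>lborel)"
proof -
  define g' where "g' t = frechet_derivative f (at (t *\<^sub>R x)) x" for t
  have nz: "t *\<^sub>R x \<noteq> 0" if "1 \<le> t" for t using that x by auto
  have diff: "f differentiable (at (t *\<^sub>R x))" if "1 \<le> t" for t
    using f nz[OF that] by (simp add: punctured_C1_def)
  have der: "((\<lambda>t. f (t *\<^sub>R x)) has_vector_derivative g' t) (at t within {1..T})" if "1 \<le> t" "t \<le> T" for t
  proof -
    have "((\<lambda>t. f (t *\<^sub>R x)) has_derivative (\<lambda>s. frechet_derivative f (at (t *\<^sub>R x)) (s *\<^sub>R x))) (at t)"
    proof (rule has_derivative_compose[where g = f and f = "\<lambda>t. t *\<^sub>R x" and f' = "\<lambda>s. s *\<^sub>R x"])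
      show "((\<lambda>t. t *\<^sub>R x) has_derivative (\<lambda>s. s *\<^sub>R x)) (at t)"
        by (rule bounded_linear_imp_has_derivative[OF bounded_linear_scaleR_left])
      show "(f has_derivative frechet_derivative f (at (t *\<^sub>R x))) (at (t *\<^sub>R x))"
        using diff[OF that(1)] by (simp add: frechet_derivative_works)
    qed
    moreover have "frechet_derivative f (at (t *\<^sub>R x)) (s *\<^sub>R x) = s *\<^sub>R g' t" for s
      unfolding g'_def using diff[OF that(1)]
      by (intro linear_cmul linear_frechet_derivative) 
    ultimately show ?thesis
      by (simp add: has_vector_derivative_def has_derivative_at_withinI)
  qed
  have eq: "g' t = (\<Sum>i\<in>UNIV. x $ i *\<^sub>R gradient f (t *\<^sub>R x) $ i)" if "1 \<le> t" for t
    unfolding g'_def frechet_derivative_eq_sum_partial[OF diff[OF that]] by (simp add: gradient_def)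
  have "continuous_on {1..T} (\<lambda>t. gradient f (t *\<^sub>R x))"
  proof (rule continuous_on_compose2[of "- {0}" "gradient f" "{1..T}" "\<lambda>t. t *\<^sub>R x"])
    show "continuous_on (- {0}) (gradient f)" using f by (simp add: punctured_C1_def)
    show "continuous_on {1..T} (\<lambda>t. t *\<^sub>R x)" by (intro continuous_intros)
    show "(\<lambda>t. t *\<^sub>R x) ` {1..T} \<subseteq> - {0}" using nz by force
  qed
  then have "continuous_on {1..T} (\<lambda>t. \<Sum>i\<in>UNIV. x $ i *\<^sub>R gradient f (t *\<^sub>R x) $ i)"
    by (intro continuous_intros)
  then have cont: "continuous_on {1..T} g'"
    by (subst continuous_on_cong[OF refl eq]) auto
  have "has_bochner_integral lborel (\<lambda>t. indicator {1..T} t *\<^sub>R g' t) (f (T *\<^sub>R x) - f (1 *\<^sub>R x))"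
    using T der cont by (intro has_bochner_integral_FTC_Icc) auto
  then have "ennreal (norm (f (T *\<^sub>R x) - f x)) = ennreal (norm (\<integral>t. indicator {1..T} t *\<^sub>R g' t \<partial>lborel))"
    by (simp add: has_bochner_integral_iff)
  also have "\<dots> \<le> (\<integral>\<^sup>+ t. ennreal (norm (indicator {1..T} t *\<^sub>R g' t)) \<partial>lborel)"
    by (rule integral_norm_bound_ennreal) (use \<open>has_bochner_integral _ _ _\<close> in \<open>simp add: has_bochner_integral_iff\<close>)
  also have "\<dots> \<le> (\<integral>\<^sup>+ t\<in>{1..}. ennreal (norm x) * ennreal (norm (gradient f (t *\<^sub>R x))) \<partial>lborel)"
  proof (rule nn_integral_mono, goal_cases)
    case (1 t)
    show ?case
      using norm_frechet_derivative_le_gradient[OF diff, of t x]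
      by (auto simp: indicator_def g'_def ennreal_mult[symmetric] ennreal_leI)
  qed
  finally show ?thesis .
qed

lemma ray_limit_le:
  fixes f :: "real^'n::finite \<Rightarrow> complex"
  assumes f: "punctured_C1 f" and x: "x \<noteq> 0"
    and lim: "(\<lambda>k. f (real k *\<^sub>R x)) \<longlonglongrightarrow> L"
  shows "ennreal (norm (f x - L))
    \<le> (\<integral>\<^sup>+ t\<in>{1..}. ennreal (norm x) * ennreal (norm (gradient f (t *\<^sub>R x))) \<partial>lborel)"
proof (rule LIMSEQ_le_const2)
  show "(\<lambda>k. ennreal (norm (f (real k *\<^sub>R x) - f x))) \<longlonglongrightarrow> ennreal (norm (f x - L))"
    unfolding norm_minus_commute[of "f x" L] by (intro tendsto_intros lim)
  show "\<exists>N. \<forall>k\<ge>N. ennreal (norm (f (real k *\<^sub>R x) - f x))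
    \<le> (\<integral>\<^sup>+ t\<in>{1..}. ennreal (norm x) * ennreal (norm (gradient f (t *\<^sub>R x))) \<partial>lborel)"
    using ray_increment_le[OF f x] by (intro exI[of _ 1]) auto
qed

text \<open>The common core of both inequalities. The function \<open>q\<close> is the convolution in the first and
  \<open>g\<close> itself in the second; in both cases it enters only through the upper bound for its
  absolute value by a Riesz potential.\<close>

lemma Riesz_potential_gradient_bound:
  fixes f :: "real^'n::finite \<Rightarrow> complex" and q :: "real^'n \<Rightarrow> complex"
  assumes p: "1 < p" and p': "1 / p + 1 / p' = 1"
    and l: "0 < l" "l < real CARD('n)" and a: "\<alpha> < real CARD('n) / p"
    and b: "1 - real CARD('n) / p < \<beta>"
    and hom: "real CARD('n) + 1 = l + \<alpha> + \<beta> + \<sigma>"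
    and bs: "0 < real CARD('n) / (2 * p') - (\<beta> + \<sigma> - 1) / 2"
    and f: "punctured_C1 f" and [measurable]: "f \<in> borel_measurable borel"
    and lim: "AE x in lborel. (\<lambda>k. f (real k *\<^sub>R x)) \<longlonglongrightarrow> 0"
    and c: "0 \<le> c"
    and q: "\<And>x. ennreal (norm (q x))
      \<le> ennreal c * (\<integral>\<^sup>+ y. ennreal (norm (x - y) powr (- l) * norm y powr (- \<sigma>)) * ennreal (norm (f y)) \<partial>lborel)"
  shows "Lp_norm p (\<lambda>x. norm x powr (- \<alpha>) *\<^sub>R q x)
    \<le> ennreal (c * F_const CARD('n) p p' \<alpha> \<beta> \<sigma>) * Lp_norm p (\<lambda>x. norm x powr \<beta> *\<^sub>R gradient f x)"
proof -
  define I where "I x = (\<integral>\<^sup>+ y. ennreal (norm (x - y) powr (- l) * norm y powr (- \<sigma>)) * ennreal (norm (f y)) \<partial>lborel)" for x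
  have [measurable]: "I \<in> borel_measurable borel" unfolding I_def by measurable
  have [measurable]: "gradient f \<in> borel_measurable borel" using f by (rule punctured_C1_gradient_measurable)
  have "AE x in lborel. ennreal (norm (f x)) \<le> (\<integral>\<^sup>+ t\<in>{1..}. ennreal (norm x) * ennreal (norm (gradient f (t *\<^sub>R x))) \<partial>lborel)"
    using lim AE_lborel_singleton[of 0]
  proof eventually_elim
    case (elim x)
    then show ?case using ray_limit_le[OF f, of x 0] by simp
  qed
  then have main: "epow (\<integral>\<^sup>+ x. epow (ennreal (norm x powr (- \<alpha>)) * I x) p \<partial>lborel) (1 / p)
    \<le> ennreal (F_const CARD('n) p p' \<alpha> \<beta> \<sigma>) * epow (\<integral>\<^sup>+ x. epow (ennreal (norm x powr \<beta>) * ennreal (norm (gradient f x))) p \<partial>lborel) (1 / p)"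
    unfolding I_def using assms(1-8) Stein_Weiss_gradient[of p p' l \<alpha> \<beta> \<sigma> "\<lambda>x. ennreal (norm (f x))" "\<lambda>x. ennreal (norm (gradient f x))"]
    by simp
  have "Lp_norm p (\<lambda>x. norm x powr (- \<alpha>) *\<^sub>R q x)
      = epow (\<integral>\<^sup>+ x. epow (ennreal (norm x powr (- \<alpha>)) * ennreal (norm (q x))) p \<partial>lborel) (1 / p)"
    by (simp add: Lp_norm_epow ennreal_mult)
  also have "\<dots> \<le> epow (\<integral>\<^sup>+ x. epow (ennreal c) p * epow (ennreal (norm x powr (- \<alpha>)) * I x) p \<partial>lborel) (1 / p)"
  proof (intro epow_mono nn_integral_mono)
    fix x :: "real^'n"
    have "ennreal (norm x powr (- \<alpha>)) * ennreal (norm (q x)) \<le> ennreal (norm x powr (- \<alpha>)) * (ennreal c * I x)"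
      unfolding I_def by (intro mult_left_mono q) auto
    also have "\<dots> = ennreal c * (ennreal (norm x powr (- \<alpha>)) * I x)" by (simp only: mult_ac)
    finally have "epow (ennreal (norm x powr (- \<alpha>)) * ennreal (norm (q x))) p \<le> epow (ennreal c * (ennreal (norm x powr (- \<alpha>)) * I x)) p"
      using p by (intro epow_mono) auto
    also have "\<dots> = epow (ennreal c) p * epow (ennreal (norm x powr (- \<alpha>)) * I x) p"
      using p by (intro epow_mult) auto
    finally show "epow (ennreal (norm x powr (- \<alpha>)) * ennreal (norm (q x))) p \<le> epow (ennreal c) p * epow (ennreal (norm x powr (- \<alpha>)) * I x) p" .
  qed (use p in auto)
  also have "\<dots> = ennreal c * epow (\<integral>\<^sup>+ x. epow (ennreal (norm x powr (- \<alpha>)) * I x) p \<partial>lborel) (1 / p)"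
    using p by (subst nn_integral_cmult) (auto simp: epow_mult epow_epow simp del: epow_ennreal)
  also have "\<dots> \<le> ennreal c * (ennreal (F_const CARD('n) p p' \<alpha> \<beta> \<sigma>) * epow (\<integral>\<^sup>+ x. epow (ennreal (norm x powr \<beta>) * ennreal (norm (gradient f x))) p \<partial>lborel) (1 / p))"
    by (intro mult_left_mono main) auto
  also have "\<dots> = ennreal (c * F_const CARD('n) p p' \<alpha> \<beta> \<sigma>) * epow (\<integral>\<^sup>+ x. epow (ennreal (norm x powr \<beta>) * ennreal (norm (gradient f x))) p \<partial>lborel) (1 / p)"
    using c by (simp add: ennreal_mult' mult.assoc)
  also have "epow (\<integral>\<^sup>+ x. epow (ennreal (norm x powr \<beta>) * ennreal (norm (gradient f x))) p \<partial>lborel) (1 / p) = Lp_norm p (\<lambda>x. norm x powr \<beta> *\<^sub>R gradient f x)"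
    by (simp add: Lp_norm_epow ennreal_mult)
  finally show ?thesis .
qed

lemma schwartz_ray_limit:
  assumes f: "f \<in> schwartz" and x: "x \<noteq> 0"
  shows "(\<lambda>k. f (real k *\<^sub>R x)) \<longlonglongrightarrow> 0"
proof -
  obtain C where C: "0 \<le> C" "\<And>x. norm (f x) \<le> C / (1 + norm x) ^ 1"
    using schwartz_bound[OF f] by metis
  show ?thesis
  proof (rule Lim_null_comparison[where g = "\<lambda>k. C / (1 + real k * norm x)"])
    show "\<forall>\<^sub>F k in sequentially. norm (f (real k *\<^sub>R x)) \<le> C / (1 + real k * norm x)"
      using C(2)[of "real _ *\<^sub>R x"] by (intro always_eventually) simp
    have "LIM k sequentially. 1 + norm x * real k :> at_top"
      using x by (intro filterlim_tendsto_add_at_top[OF tendsto_const]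
          filterlim_tendsto_pos_mult_at_top[OF tendsto_const _ filterlim_real_sequentially]) auto
    then show "(\<lambda>k. C / (1 + real k * norm x)) \<longlonglongrightarrow> 0"
      by (intro real_tendsto_divide_at_top[OF tendsto_const]) (simp add: mult.commute)
  qed
qed

text \<open>Where the convolution integral is not absolutely convergent, its value is zero by the
  convention for the Bochner integral; so the bound for its absolute value holds everywhere.\<close>

lemma Stein_Weiss_gradient_schwartz:
  fixes f :: "real^'n::finite \<Rightarrow> complex"
  assumes p: "1 < p" and p': "1 / p + 1 / p' = 1"
    and l: "0 < l" "l < real CARD('n)" and a: "\<alpha> < real CARD('n) / p"
    and b: "1 - real CARD('n) / p < \<beta>"
    and hom: "real CARD('n) + 1 = l + \<alpha> + \<beta> + \<sigma>"
    and bs: "0 < real CARD('n) / (2 * p') - (\<beta> + \<sigma> - 1) / 2"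
    and f: "f \<in> schwartz"
  shows "Lp_norm p (\<lambda>x. norm x powr (- \<alpha>) *\<^sub>R
            convolution (\<lambda>z. norm z powr (- l)) (\<lambda>y. norm y powr (- \<sigma>) *\<^sub>R f y) x)
        \<le> ennreal (F_const CARD('n) p p' \<alpha> \<beta> \<sigma>) * Lp_norm p (\<lambda>x. norm x powr \<beta> *\<^sub>R gradient f x)"
proof -
  have "AE x in lborel. (\<lambda>k. f (real k *\<^sub>R x)) \<longlonglongrightarrow> 0"
    using AE_lborel_singleton[of 0] by eventually_elim (rule schwartz_ray_limit[OF f])
  moreover have "ennreal (norm (convolution (\<lambda>z. norm z powr (- l)) (\<lambda>y. norm y powr (- \<sigma>) *\<^sub>R f y) x))
     \<le> ennreal 1 * (\<integral>\<^sup>+ y. ennreal (norm (x - y) powr (- l) * norm y powr (- \<sigma>)) * ennreal (norm (f y)) \<partial>lborel)" for x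
  proof (cases "integrable lborel (\<lambda>y. norm (x - y) powr (- l) *\<^sub>R (norm y powr (- \<sigma>) *\<^sub>R f y))")
    case True
    from integral_norm_bound_ennreal[OF this] show ?thesis
      unfolding Defs.convolution_def by (simp add: ennreal_mult mult.assoc)
  next
    case False
    then show ?thesis unfolding Defs.convolution_def by (simp add: not_integrable_integral_eq)
  qed
  ultimately show ?thesis
    using Riesz_potential_gradient_bound[OF assms(1-8) schwartz_punctured_C1[OF f] schwartz_measurable[OF f], of 1] by simp
qed

section \<open>Fourier inversion and uniqueness\<close>

lemma cis_measurable [measurable]: "cis \<in> borel_measurable borel"
  by (intro borel_measurable_continuous_onI continuous_intros)

lemma fourier_cis: "fourier f y = (\<integral>x. wave x y * f x \<partial>lborel)"
  unfolding fourier_def cis_conv_exp by (simp add: mult_ac)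

lemma inverse_fourier_cis: "inverse_fourier m x = (\<integral>y. wave' x y * m y \<partial>lborel)"
  unfolding inverse_fourier_def cis_conv_exp by (simp add: mult_ac)

lemma Fubini_swap:
  fixes f :: "'a::euclidean_space \<Rightarrow> 'b::euclidean_space \<Rightarrow> complex"
  assumes [measurable]: "(\<lambda>(x, y). f x y) \<in> borel_measurable (borel \<Otimes>\<^sub>M borel)"
    and fin: "(\<integral>\<^sup>+ x. \<integral>\<^sup>+ y. ennreal (norm (f x y)) \<partial>lborel \<partial>lborel) < \<infinity>"
  shows "(\<integral>x. \<integral>y. f x y \<partial>lborel \<partial>lborel) = (\<integral>y. \<integral>x. f x y \<partial>lborel \<partial>lborel)"
proof (rule lborel_pair.Fubini_integral[symmetric])
  show "integrable (lborel \<Otimes>\<^sub>M lborel) (\<lambda>(x, y). f x y)"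
  proof (rule integrableI_bounded)
    show "(\<lambda>(x, y). f x y) \<in> borel_measurable (lborel \<Otimes>\<^sub>M lborel)" by measurable
    have "(\<integral>\<^sup>+ z. ennreal (norm (case z of (x, y) \<Rightarrow> f x y)) \<partial>(lborel \<Otimes>\<^sub>M lborel))
       = (\<integral>\<^sup>+ x. \<integral>\<^sup>+ y. ennreal (norm (f x y)) \<partial>lborel \<partial>lborel)"
      by (subst lborel.nn_integral_fst[symmetric]) auto
    with fin show "(\<integral>\<^sup>+ z. ennreal (norm (case z of (x, y) \<Rightarrow> f x y)) \<partial>(lborel \<Otimes>\<^sub>M lborel)) < \<infinity>"
      by simp
  qed
qed

lemma Fubini_swap_product:
  fixes f :: "'a::euclidean_space \<Rightarrow> 'b::euclidean_space \<Rightarrow> complex" and F :: "'a \<Rightarrow> complex" and G :: "'b \<Rightarrow> real"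
  assumes [measurable]: "(\<lambda>(x, y). f x y) \<in> borel_measurable (borel \<Otimes>\<^sub>M borel)"
    and F: "integrable lborel F" and G: "integrable lborel G"
    and le: "\<And>x y. norm (f x y) \<le> norm (F x) * G y"
  shows "(\<integral>x. \<integral>y. f x y \<partial>lborel \<partial>lborel) = (\<integral>y. \<integral>x. f x y \<partial>lborel \<partial>lborel)"
proof (rule Fubini_swap)
  have [measurable]: "F \<in> borel_measurable borel" "G \<in> borel_measurable borel"
    using F G by auto
  have "(\<integral>\<^sup>+ x. \<integral>\<^sup>+ y. ennreal (norm (f x y)) \<partial>lborel \<partial>lborel)
    \<le> (\<integral>\<^sup>+ x. \<integral>\<^sup>+ y. ennreal (norm (F x)) * ennreal (norm (G y)) \<partial>lborel \<partial>lborel)"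
  proof (intro nn_integral_mono)
    fix x y
    have "norm (f x y) \<le> norm (F x) * norm (G y)"
      by (rule order_trans[OF le]) (auto intro: mult_left_mono)
    then show "ennreal (norm (f x y)) \<le> ennreal (norm (F x)) * ennreal (norm (G y))"
      by (simp add: ennreal_mult[symmetric] ennreal_leI)
  qed
  also have "\<dots> = (\<integral>\<^sup>+ x. ennreal (norm (F x)) * (\<integral>\<^sup>+ y. ennreal (norm (G y)) \<partial>lborel) \<partial>lborel)"
    by (intro nn_integral_cong nn_integral_cmult) measurable
  also have "\<dots> = (\<integral>\<^sup>+ x. ennreal (norm (F x)) \<partial>lborel) * (\<integral>\<^sup>+ y. ennreal (norm (G y)) \<partial>lborel)"
    by (rule nn_integral_multc) measurable
  also have "\<dots> < \<infinity>"
    using F G by (simp add: integrable_iff_bounded ennreal_mult_less_top)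
  finally show "(\<integral>\<^sup>+ x. \<integral>\<^sup>+ y. ennreal (norm (f x y)) \<partial>lborel \<partial>lborel) < \<infinity>" .
qed measurable

lemma integral_lborel_affine:
  fixes f :: "'a::euclidean_space \<Rightarrow> 'b::{banach, second_countable_topology}"
  assumes [measurable]: "f \<in> borel_measurable borel" and c: "c \<noteq> 0"
  shows "(\<integral>x. f x \<partial>lborel) = (\<bar>c\<bar> ^ DIM('a)) *\<^sub>R (\<integral>x. f (t + c *\<^sub>R x) \<partial>lborel)"
proof -
  have "(\<integral>x. f x \<partial>lborel) = (\<integral>x. f x \<partial>density (distr lborel borel (\<lambda>x. t + c *\<^sub>R x)) (\<lambda>_. ennreal (\<bar>c\<bar> ^ DIM('a))))"
    by (subst lborel_affine[OF c, of t]) (simp add: ennreal_power)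
  also have "\<dots> = (\<integral>x. (\<bar>c\<bar> ^ DIM('a)) *\<^sub>R f x \<partial>distr lborel borel (\<lambda>x. t + c *\<^sub>R x))"
    by (subst integral_density) auto
  also have "\<dots> = (\<integral>x. (\<bar>c\<bar> ^ DIM('a)) *\<^sub>R f (t + c *\<^sub>R x) \<partial>lborel)"
    by (subst integral_distr) auto
  finally show ?thesis by simp
qed

lemma integrable_lborel_affine:
  fixes f :: "'a::euclidean_space \<Rightarrow> 'b::{banach, second_countable_topology}"
  assumes f: "integrable lborel f" and c: "c \<noteq> 0"
  shows "integrable lborel (\<lambda>x. f (t + c *\<^sub>R x))"
proof -
  have [measurable]: "f \<in> borel_measurable borel" using f by auto
  show ?thesis
  proof (rule integrableI_bounded)
    have "ennreal (\<bar>c\<bar> ^ DIM('a)) * (\<integral>\<^sup>+ x. ennreal (norm (f (t + c *\<^sub>R x))) \<partial>lborel) < \<infinity>"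
      using f nn_integral_lborel_affine[of "\<lambda>x. ennreal (norm (f x))" c t] c
      by (simp add: integrable_iff_bounded)
    then show "(\<integral>\<^sup>+ x. ennreal (norm (f (t + c *\<^sub>R x))) \<partial>lborel) < \<infinity>"
      using c by (auto simp: ennreal_mult_less_top)
  qed measurable
qed

lemma integrable_Gaussian:
  assumes c: "0 < c"
  shows "integrable lborel (\<lambda>x::'a::euclidean_space. gauss c x)"
  using nn_integral_Gaussian[OF c, where 'a='a] by (intro integrableI_bounded) auto

lemma integral_Gaussian_unit: "(\<integral>(x::'a::euclidean_space). gauss pi x \<partial>lborel) = 1"
proof -
  have "ennreal (\<integral>(x::'a). gauss pi x \<partial>lborel) = 1"
    using nn_integral_Gaussian[of pi, where 'a='a]
    by (subst nn_integral_eq_integral[symmetric]) (auto intro: integrable_Gaussian)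
  then show ?thesis by simp
qed

text \<open>The characteristic function of the standard normal distribution, rescaled.\<close>

lemma fourier_Gaussian_real:
  assumes c: "0 < c"
  shows "(\<integral>x. cis (2 * pi * (x * y)) * complex_of_real (exp (- (c * x\<^sup>2))) \<partial>lborel)
    = complex_of_real (sqrt (pi / c) * exp (- (pi\<^sup>2 * y\<^sup>2 / c)))"
proof -
  define s where "s = sqrt (2 * c)"
  define t where "t = 2 * pi * y / s"
  have s: "0 < s" "s\<^sup>2 = 2 * c" using c by (auto simp: s_def)
  have "complex_of_real (exp (- (t\<^sup>2) / 2)) = (\<integral>x. iexp (t * x) \<partial>std_normal_distribution)"
    using fun_cong[OF char_std_normal_distribution, of t] by (simp add: char_def)
  also have "\<dots> = (\<integral>x. std_normal_density x *\<^sub>R cis (t * x) \<partial>lborel)"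
    by (subst integral_density) (auto simp: cis_conv_exp)
  also have "\<dots> = \<bar>s\<bar> *\<^sub>R (\<integral>x. std_normal_density (0 + s * x) *\<^sub>R cis (t * (0 + s * x)) \<partial>lborel)"
    using s by (intro lborel_integral_real_affine) auto
  also have "(\<integral>x. std_normal_density (0 + s * x) *\<^sub>R cis (t * (0 + s * x)) \<partial>lborel)
     = (\<integral>x. (1 / sqrt (2 * pi)) *\<^sub>R (cis (2 * pi * (x * y)) * complex_of_real (exp (- (c * x\<^sup>2)))) \<partial>lborel)"
  proof (rule Bochner_Integration.integral_cong[OF refl], goal_cases)
    case (1 x)
    have "- (s * x)\<^sup>2 / 2 = - (c * x\<^sup>2)" using s by (simp add: power_mult_distrib)
    then have d: "std_normal_density (0 + s * x) = 1 / sqrt (2 * pi) * exp (- (c * x\<^sup>2))"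
      unfolding std_normal_density_def add_0 by simp
    have e: "t * (0 + s * x) = 2 * pi * (x * y)" using s by (simp add: t_def)
    show ?case
      unfolding d e by (simp add: scaleR_conv_of_real)
  qed
  also have "\<dots> = (1 / sqrt (2 * pi)) *\<^sub>R (\<integral>x. cis (2 * pi * (x * y)) * complex_of_real (exp (- (c * x\<^sup>2))) \<partial>lborel)"
    by simp
  finally have "complex_of_real (exp (- (t\<^sup>2) / 2)) = (s / sqrt (2 * pi)) *\<^sub>R (\<integral>x. cis (2 * pi * (x * y)) * complex_of_real (exp (- (c * x\<^sup>2))) \<partial>lborel)"
    using s by simp
  then have "(sqrt (2 * pi) / s) *\<^sub>R complex_of_real (exp (- (t\<^sup>2) / 2)) = (\<integral>x. cis (2 * pi * (x * y)) * complex_of_real (exp (- (c * x\<^sup>2))) \<partial>lborel)"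
    using s by simp
  moreover have "sqrt (2 * pi) / s = sqrt (pi / c)"
    using c by (simp add: s_def real_sqrt_divide real_sqrt_mult)
  moreover have "t\<^sup>2 / 2 = pi\<^sup>2 * y\<^sup>2 / c"
    using s c by (simp add: t_def power_divide power_mult_distrib)
  ultimately show ?thesis by (simp add: scaleR_conv_of_real)
qed

lemma fourier_Gaussian:
  fixes y :: "'a::euclidean_space"
  assumes c: "0 < c"
  shows "(\<integral>x. wave x y * complex_of_real (gauss c x) \<partial>lborel)
    = complex_of_real ((pi / c) powr (real DIM('a) / 2) * exp (- (pi\<^sup>2 * (norm y)\<^sup>2 / c)))"
proof -
  interpret P: product_sigma_finite "\<lambda>_::'a. lborel :: real measure" ..
  define g where "g b t = cis (2 * pi * (t * (y \<bullet> b))) * complex_of_real (exp (- (c * t\<^sup>2)))" for b :: 'a and t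
  have [measurable]: "g b \<in> borel_measurable borel" for b unfolding g_def by measurable
  have gint: "integrable lborel (g b)" for b
    unfolding g_def
    by (rule Bochner_Integration.integrable_bound[OF integrable_Gaussian[OF c, where 'a=real]]) (auto simp: norm_mult)
  have split: "wave x y * complex_of_real (gauss c x) = (\<Prod>b\<in>Basis. g b (x \<bullet> b))" for x
  proof -
    have "(norm x)\<^sup>2 = (\<Sum>b\<in>Basis. (x \<bullet> b)\<^sup>2)"
      unfolding power2_norm_eq_inner euclidean_inner[of x x] by (simp add: power2_eq_square)
    moreover have "wave x y = (\<Prod>b\<in>Basis. cis (2 * pi * ((x \<bullet> b) * (y \<bullet> b))))"
      unfolding euclidean_inner[of x y] cis_conv_exp by (simp add: exp_sum[symmetric] sum_distrib_left)
    ultimately show ?thesis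
      by (simp add: g_def prod.distrib exp_sum[symmetric] sum_distrib_left flip: sum_negf of_real_prod)
  qed
  have "(\<integral>x. wave x y * complex_of_real (gauss c x) \<partial>lborel)
    = (\<integral>x. (\<Prod>b\<in>Basis. g b (x \<bullet> b)) \<partial>distr (\<Pi>\<^sub>M b\<in>Basis. lborel) borel (\<lambda>f. \<Sum>b\<in>Basis. f b *\<^sub>R b))"
    unfolding split by (subst lborel_eq) simp
  also have "\<dots> = (\<integral>f. (\<Prod>b\<in>Basis. g b ((\<Sum>b\<in>Basis. f b *\<^sub>R b) \<bullet> b)) \<partial>(\<Pi>\<^sub>M b\<in>Basis. lborel))"
    by (rule integral_distr) measurable
  also have "\<dots> = (\<integral>f. (\<Prod>b\<in>Basis. g b (f b)) \<partial>(\<Pi>\<^sub>M b\<in>Basis. lborel))"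
    by (intro Bochner_Integration.integral_cong prod.cong refl) (simp add: inner_sum_left_Basis)
  also have "\<dots> = (\<Prod>b\<in>Basis. \<integral>t. g b t \<partial>lborel)"
    by (rule P.product_integral_prod) (auto intro: gint)
  also have "\<dots> = (\<Prod>b\<in>Basis. complex_of_real (sqrt (pi / c) * exp (- (pi\<^sup>2 * (y \<bullet> b)\<^sup>2 / c))))"
    unfolding g_def fourier_Gaussian_real[OF c] ..
  also have "\<dots> = complex_of_real (sqrt (pi / c) ^ DIM('a) * (\<Prod>b\<in>Basis. exp (- (pi\<^sup>2 * (y \<bullet> b)\<^sup>2 / c))))"
    by (simp add: prod.distrib)
  also have "(\<Prod>b\<in>Basis. exp (- (pi\<^sup>2 * (y \<bullet> b)\<^sup>2 / c))) = exp (- (pi\<^sup>2 * (norm y)\<^sup>2 / c))"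
  proof -
    have "(norm y)\<^sup>2 = (\<Sum>b\<in>Basis. (y \<bullet> b)\<^sup>2)"
      unfolding power2_norm_eq_inner euclidean_inner[of y y] by (simp add: power2_eq_square)
    then show ?thesis by (simp add: exp_sum[symmetric] sum_distrib_left sum_divide_distrib sum_negf)
  qed
  also have "sqrt (pi / c) ^ DIM('a) = (pi / c) powr (real DIM('a) / 2)"
    using c by (simp add: powr_half_sqrt[symmetric] powr_realpow[symmetric] powr_powr)
  finally show ?thesis .
qed

text \<open>Multiplication of the transform by a Gaussian smooths \<open>F\<close> at scale \<open>r\<close>. Both the inversion
  formula and the injectivity of the transform follow by letting \<open>r\<close> tend to zero.\<close>

lemma Gaussian_mean_eq_fourier:
  fixes F :: "'a::euclidean_space \<Rightarrow> complex"
  assumes F: "integrable lborel F" and r: "0 < r"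
  shows "(\<integral>w. F (x + r *\<^sub>R w) * complex_of_real (gauss pi w) \<partial>lborel)
    = (\<integral>y. wave' x y * (fourier F y * complex_of_real (gauss (pi * r\<^sup>2) y)) \<partial>lborel)"
proof -
  have [measurable]: "F \<in> borel_measurable borel" using F by auto
  define G where "G y = gauss (pi * r\<^sup>2) y" for y :: 'a
  have [measurable]: "G \<in> borel_measurable borel" unfolding G_def by measurable
  have G: "integrable lborel G" unfolding G_def using r by (intro integrable_Gaussian) auto
  have ker: "(\<integral>y. wave (z - x) y * complex_of_real (G y) \<partial>lborel)
     = complex_of_real ((1 / r ^ DIM('a)) * exp (- (pi * (norm (z - x))\<^sup>2 / r\<^sup>2)))" for z
  proof -
    have "(\<integral>y. wave (z - x) y * complex_of_real (G y) \<partial>lborel)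
        = complex_of_real ((pi / (pi * r\<^sup>2)) powr (real DIM('a) / 2) * exp (- (pi\<^sup>2 * (norm (z - x))\<^sup>2 / (pi * r\<^sup>2))))"
      unfolding G_def inner_commute[of "z - x"] using r by (intro fourier_Gaussian) auto
    moreover have "(pi / (pi * r\<^sup>2)) powr (real DIM('a) / 2) = 1 / r ^ DIM('a)"
    proof -
      have "(pi / (pi * r\<^sup>2)) powr (real DIM('a) / 2) = 1 / (r\<^sup>2) powr (real DIM('a) / 2)"
        by (simp add: powr_divide)
      then show ?thesis using r by (simp add: power2_powr powr_realpow)
    qed
    moreover have "pi\<^sup>2 * (norm (z - x))\<^sup>2 / (pi * r\<^sup>2) = pi * (norm (z - x))\<^sup>2 / r\<^sup>2"
      by (simp add: power2_eq_square)
    ultimately show ?thesis by simp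
  qed
  have "(\<integral>y. wave' x y * (fourier F y * complex_of_real (gauss (pi * r\<^sup>2) y)) \<partial>lborel)
     = (\<integral>y. \<integral>z. F z * (wave (z - x) y * complex_of_real (G y)) \<partial>lborel \<partial>lborel)"
  proof (rule Bochner_Integration.integral_cong[OF refl], goal_cases)
    case (1 y)
    have "wave' x y * (fourier F y * complex_of_real (G y))
      = (wave' x y * complex_of_real (G y)) * (\<integral>z. wave z y * F z \<partial>lborel)"
      unfolding fourier_cis by (simp add: mult_ac)
    also have "\<dots> = (\<integral>z. (wave' x y * complex_of_real (G y)) * (wave z y * F z) \<partial>lborel)"
      by (rule integral_mult_right_zero[symmetric])
    also have "\<dots> = (\<integral>z. F z * (wave (z - x) y * complex_of_real (G y)) \<partial>lborel)"
    proof (rule Bochner_Integration.integral_cong[OF refl], goal_cases)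
      case (1 z)
      have "wave (z - x) y = wave' x y * wave z y"
        by (simp add: cis_mult inner_diff_left algebra_simps)
      then show ?case
        by (simp only: mult_ac)
    qed
    finally show ?case
      by (simp add: G_def)
  qed
  also have "\<dots> = (\<integral>z. \<integral>y. F z * (wave (z - x) y * complex_of_real (G y)) \<partial>lborel \<partial>lborel)"
    by (rule Fubini_swap_product[OF _ F G, symmetric]) (auto simp: norm_mult G_def)
  also have "\<dots> = (\<integral>z. F z * complex_of_real ((1 / r ^ DIM('a)) * exp (- (pi * (norm (z - x))\<^sup>2 / r\<^sup>2))) \<partial>lborel)"
    unfolding integral_mult_right_zero ker ..
  also have "\<dots> = (\<bar>r\<bar> ^ DIM('a)) *\<^sub>R (\<integral>w. F (x + r *\<^sub>R w) * complex_of_real ((1 / r ^ DIM('a)) * exp (- (pi * (norm (x + r *\<^sub>R w - x))\<^sup>2 / r\<^sup>2))) \<partial>lborel)"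
    using r by (intro integral_lborel_affine) auto
  also have "\<dots> = (\<integral>w. (\<bar>r\<bar> ^ DIM('a)) *\<^sub>R (F (x + r *\<^sub>R w) * complex_of_real ((1 / r ^ DIM('a)) * exp (- (pi * (norm (x + r *\<^sub>R w - x))\<^sup>2 / r\<^sup>2)))) \<partial>lborel)"
    by (rule integral_scaleR_right[symmetric])
  also have "\<dots> = (\<integral>w. F (x + r *\<^sub>R w) * complex_of_real (gauss pi w) \<partial>lborel)"
  proof (rule Bochner_Integration.integral_cong[OF refl], goal_cases)
    case (1 w)
    have "pi * (norm (x + r *\<^sub>R w - x))\<^sup>2 / r\<^sup>2 = pi * (norm w)\<^sup>2"
      using r by (simp add: power_mult_distrib)
    then show ?case
      using r by (simp add: scaleR_conv_of_real)
  qed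
  finally show ?thesis by (rule sym)
qed

lemma fourier_inversion:
  fixes F :: "'a::euclidean_space \<Rightarrow> complex"
  assumes F: "integrable lborel F" and FF: "integrable lborel (fourier F)"
    and cont: "continuous_on UNIV F" and bdd: "\<And>x. norm (F x) \<le> B"
  shows "inverse_fourier (fourier F) x = F x"
proof -
  have [measurable]: "F \<in> borel_measurable borel" "fourier F \<in> borel_measurable borel" using F FF by auto
  define r where "r k = inverse (real (Suc k))" for k
  have r: "0 < r k" for k by (simp add: r_def)
  have r0: "r \<longlonglongrightarrow> 0" unfolding r_def by (rule LIMSEQ_inverse_real_of_nat)
  have 1: "(\<lambda>k. \<integral>w. F (x + r k *\<^sub>R w) * complex_of_real (gauss pi w) \<partial>lborel)
     \<longlonglongrightarrow> (\<integral>(w::'a). F x * complex_of_real (gauss pi w) \<partial>lborel)"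
  proof (rule integral_dominated_convergence)
    show "integrable lborel (\<lambda>w::'a. B * gauss pi w)"
      by (intro integrable_mult_right integrable_Gaussian) simp
    show "AE w in lborel. (\<lambda>k. F (x + r k *\<^sub>R w) * complex_of_real (gauss pi w)) \<longlonglongrightarrow> F x * complex_of_real (gauss pi w)"
    proof (intro AE_I2 tendsto_mult tendsto_const)
      fix w
      have "(\<lambda>k. x + r k *\<^sub>R w) \<longlonglongrightarrow> x + 0 *\<^sub>R w" by (intro tendsto_intros r0)
      then have "(\<lambda>k. F (x + r k *\<^sub>R w)) \<longlonglongrightarrow> F (x + 0 *\<^sub>R w)"
        using cont by (intro isCont_tendsto_compose[of _ F]) (auto simp: continuous_on_eq_continuous_at)
      then show "(\<lambda>k. F (x + r k *\<^sub>R w)) \<longlonglongrightarrow> F x" by simp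
    qed
    show "AE w in lborel. norm (F (x + r k *\<^sub>R w) * complex_of_real (gauss pi w)) \<le> B * gauss pi w" for k
      using bdd by (auto simp: norm_mult intro!: AE_I2 mult_right_mono)
  qed auto
  have 2: "(\<lambda>k. \<integral>y. wave' x y * (fourier F y * complex_of_real (exp (- (pi * (r k)\<^sup>2 * (norm y)\<^sup>2)))) \<partial>lborel)
     \<longlonglongrightarrow> (\<integral>y. wave' x y * fourier F y \<partial>lborel)"
  proof (rule integral_dominated_convergence)
    show "integrable lborel (\<lambda>y. norm (fourier F y))" using FF by simp
    show "AE y in lborel. (\<lambda>k. wave' x y * (fourier F y * complex_of_real (exp (- (pi * (r k)\<^sup>2 * (norm y)\<^sup>2))))) \<longlonglongrightarrow> wave' x y * fourier F y"
    proof (rule AE_I2)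
      fix y
      have "(\<lambda>k. wave' x y * (fourier F y * complex_of_real (exp (- (pi * (r k)\<^sup>2 * (norm y)\<^sup>2)))))
        \<longlonglongrightarrow> wave' x y * (fourier F y * complex_of_real (exp (- (pi * 0\<^sup>2 * (norm y)\<^sup>2))))"
        by (intro tendsto_intros r0)
      then show "(\<lambda>k. wave' x y * (fourier F y * complex_of_real (exp (- (pi * (r k)\<^sup>2 * (norm y)\<^sup>2))))) \<longlonglongrightarrow> wave' x y * fourier F y"
        by simp
    qed
    show "AE y in lborel. norm (wave' x y * (fourier F y * complex_of_real (exp (- (pi * (r k)\<^sup>2 * (norm y)\<^sup>2))))) \<le> norm (fourier F y)" for k
      by (auto simp: norm_mult intro!: AE_I2 mult_left_le)
  qed auto
  have "(\<integral>(w::'a). F x * complex_of_real (gauss pi w) \<partial>lborel) = (\<integral>y. wave' x y * fourier F y \<partial>lborel)"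
    using LIMSEQ_unique[OF 1] 2 unfolding Gaussian_mean_eq_fourier[OF F r] by blast
  moreover have "(\<integral>(w::'a). F x * complex_of_real (gauss pi w) \<partial>(lborel :: 'a measure)) = F x"
    by (simp only: integral_mult_right_zero integral_complex_of_real integral_Gaussian_unit) simp
  ultimately show ?thesis by (simp add: inverse_fourier_cis)
qed

text \<open>All Gaussian means of \<open>F\<close> vanish, by the preceding formula. Tested against \<open>\<phi>\<close>, the mean can be
  moved from \<open>F\<close> to \<open>\<phi>\<close>, where it converges boundedly to \<open>\<phi>\<close> as the scale tends to zero.\<close>

lemma integral_continuous_test_eq_0:
  fixes F :: "'a::euclidean_space \<Rightarrow> complex" and \<phi> :: "'a \<Rightarrow> real"
  assumes F: "integrable lborel F" and zero: "\<And>y. fourier F y = 0"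
    and cont: "continuous_on UNIV \<phi>" and bdd: "\<And>x. \<bar>\<phi> x\<bar> \<le> 1"
  shows "(\<integral>z. \<phi> z *\<^sub>R F z \<partial>lborel) = 0"
proof -
  have [measurable]: "F \<in> borel_measurable borel" using F by auto
  have [measurable]: "\<phi> \<in> borel_measurable borel" using cont by (rule borel_measurable_continuous_onI)
  define E where "E w = gauss pi w" for w :: 'a
  have [measurable]: "E \<in> borel_measurable borel" unfolding E_def by measurable
  have E: "integrable lborel E" unfolding E_def by (intro integrable_Gaussian) simp
  have E0: "0 \<le> E w" for w by (simp add: E_def)
  define r where "r k = inverse (real (Suc k))" for k
  have r: "0 < r k" for k by (simp add: r_def)
  have r0: "r \<longlonglongrightarrow> 0" unfolding r_def by (rule LIMSEQ_inverse_real_of_nat)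
  have bound: "norm (\<phi> x *\<^sub>R c) \<le> norm c" for x and c :: complex
    using bdd[of x] by (auto intro!: mult_left_le_one_le)
  have S0: "(\<integral>w. E w *\<^sub>R (\<integral>z. \<phi> (z - r k *\<^sub>R w) *\<^sub>R F z \<partial>lborel) \<partial>lborel) = 0" for k
  proof -
    have "(\<integral>w. E w *\<^sub>R (\<integral>z. \<phi> (z - r k *\<^sub>R w) *\<^sub>R F z \<partial>lborel) \<partial>lborel)
      = (\<integral>w. \<integral>x. E w *\<^sub>R (\<phi> x *\<^sub>R F (x + r k *\<^sub>R w)) \<partial>lborel \<partial>lborel)"
    proof (rule Bochner_Integration.integral_cong[OF refl], goal_cases)
      case (1 w)
      have "(\<integral>z. \<phi> (z - r k *\<^sub>R w) *\<^sub>R F z \<partial>lborel)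
        = (\<bar>1\<bar> ^ DIM('a)) *\<^sub>R (\<integral>x. \<phi> (r k *\<^sub>R w + 1 *\<^sub>R x - r k *\<^sub>R w) *\<^sub>R F (r k *\<^sub>R w + 1 *\<^sub>R x) \<partial>lborel)"
        by (rule integral_lborel_affine) auto
      then show ?case
        by (simp add: add.commute del: scaleR_scaleR)
    qed
    also have "\<dots> = (\<integral>x. \<integral>w. E w *\<^sub>R (\<phi> x *\<^sub>R F (x + r k *\<^sub>R w)) \<partial>lborel \<partial>lborel)"
    proof (rule Fubini_swap)
      have "(\<integral>\<^sup>+ w. \<integral>\<^sup>+ x. ennreal (norm (E w *\<^sub>R (\<phi> x *\<^sub>R F (x + r k *\<^sub>R w)))) \<partial>lborel \<partial>lborel)
        \<le> (\<integral>\<^sup>+ w. \<integral>\<^sup>+ x. ennreal (E w) * ennreal (norm (F (x + r k *\<^sub>R w))) \<partial>lborel \<partial>lborel)"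
      proof (intro nn_integral_mono)
        fix w x
        have "norm (E w *\<^sub>R (\<phi> x *\<^sub>R F (x + r k *\<^sub>R w))) \<le> E w * norm (F (x + r k *\<^sub>R w))"
          unfolding norm_scaleR[of "E w"] using bound E0 by (auto intro!: mult_left_mono)
        then show "ennreal (norm (E w *\<^sub>R (\<phi> x *\<^sub>R F (x + r k *\<^sub>R w)))) \<le> ennreal (E w) * ennreal (norm (F (x + r k *\<^sub>R w)))"
          using E0 by (simp add: ennreal_mult[symmetric] ennreal_leI)
      qed
      also have "\<dots> = (\<integral>\<^sup>+ w. ennreal (E w) * (\<integral>\<^sup>+ x. ennreal (norm (F (x + r k *\<^sub>R w))) \<partial>lborel) \<partial>lborel)"
        by (intro nn_integral_cong nn_integral_cmult) measurable
      also have "\<dots> = (\<integral>\<^sup>+ w. ennreal (E w) * (\<integral>\<^sup>+ x. ennreal (norm (F x)) \<partial>lborel) \<partial>lborel)"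
      proof (rule nn_integral_cong, goal_cases)
        case (1 w)
        show ?case
          using nn_integral_lborel_affine[of "\<lambda>x. ennreal (norm (F x))" 1 "r k *\<^sub>R w"] by (simp add: add.commute)
      qed
      also have "\<dots> = (\<integral>\<^sup>+ w. ennreal (E w) \<partial>lborel) * (\<integral>\<^sup>+ x. ennreal (norm (F x)) \<partial>lborel)"
        by (rule nn_integral_multc) measurable
      also have "\<dots> < \<infinity>"
        using E F E0 by (simp add: integrable_iff_bounded ennreal_mult_less_top)
      finally show "(\<integral>\<^sup>+ w. \<integral>\<^sup>+ x. ennreal (norm (E w *\<^sub>R (\<phi> x *\<^sub>R F (x + r k *\<^sub>R w)))) \<partial>lborel \<partial>lborel) < \<infinity>" .
    qed measurable
    also have "\<dots> = (\<integral>x. 0 \<partial>(lborel :: 'a measure))"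
    proof (rule Bochner_Integration.integral_cong[OF refl], goal_cases)
      case (1 x)
      have "(\<integral>w. E w *\<^sub>R (\<phi> x *\<^sub>R F (x + r k *\<^sub>R w)) \<partial>lborel)
        = (\<integral>w. \<phi> x *\<^sub>R (F (x + r k *\<^sub>R w) * complex_of_real (gauss pi w)) \<partial>lborel)"
        by (rule Bochner_Integration.integral_cong[OF refl]) (simp add: E_def scaleR_conv_of_real)
      also have "\<dots> = \<phi> x *\<^sub>R (\<integral>w. F (x + r k *\<^sub>R w) * complex_of_real (gauss pi w) \<partial>lborel)"
        by (rule integral_scaleR_right)
      also have "\<dots> = 0"
        unfolding Gaussian_mean_eq_fourier[OF F r] zero by simp
      finally show ?case .
    qed
    finally show ?thesis by simp
  qed
  have lim: "(\<lambda>k. \<integral>w. E w *\<^sub>R (\<integral>z. \<phi> (z - r k *\<^sub>R w) *\<^sub>R F z \<partial>lborel) \<partial>lborel)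
    \<longlonglongrightarrow> (\<integral>w. E w *\<^sub>R (\<integral>z. \<phi> z *\<^sub>R F z \<partial>lborel) \<partial>lborel)"
  proof (rule integral_dominated_convergence)
    show "integrable lborel (\<lambda>w. E w * (\<integral>z. norm (F z) \<partial>lborel))"
      using E by (intro integrable_mult_left)
    show "AE w in lborel. norm (E w *\<^sub>R (\<integral>z. \<phi> (z - r k *\<^sub>R w) *\<^sub>R F z \<partial>lborel)) \<le> E w * (\<integral>z. norm (F z) \<partial>lborel)" for k
    proof (rule AE_I2)
      fix w
      have "norm (\<integral>z. \<phi> (z - r k *\<^sub>R w) *\<^sub>R F z \<partial>lborel) \<le> (\<integral>z. norm (F z) \<partial>lborel)"
      proof (rule order_trans[OF integral_norm_bound])
        show "(\<integral>z. norm (\<phi> (z - r k *\<^sub>R w) *\<^sub>R F z) \<partial>lborel) \<le> (\<integral>z. norm (F z) \<partial>lborel)"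
          by (rule integral_mono_AE') (use F bound in auto)
      qed
      then show "norm (E w *\<^sub>R (\<integral>z. \<phi> (z - r k *\<^sub>R w) *\<^sub>R F z \<partial>lborel)) \<le> E w * (\<integral>z. norm (F z) \<partial>lborel)"
        using E0 by (auto intro!: mult_left_mono)
    qed
    show "AE w in lborel. (\<lambda>k. E w *\<^sub>R (\<integral>z. \<phi> (z - r k *\<^sub>R w) *\<^sub>R F z \<partial>lborel)) \<longlonglongrightarrow> E w *\<^sub>R (\<integral>z. \<phi> z *\<^sub>R F z \<partial>lborel)"
    proof (intro AE_I2 tendsto_scaleR tendsto_const)
      fix w
      show "(\<lambda>k. \<integral>z. \<phi> (z - r k *\<^sub>R w) *\<^sub>R F z \<partial>lborel) \<longlonglongrightarrow> (\<integral>z. \<phi> z *\<^sub>R F z \<partial>lborel)"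
      proof (rule integral_dominated_convergence)
        show "integrable lborel (\<lambda>z. norm (F z))" using F by simp
        show "AE z in lborel. norm (\<phi> (z - r k *\<^sub>R w) *\<^sub>R F z) \<le> norm (F z)" for k
          by (intro AE_I2 bound)
        show "AE z in lborel. (\<lambda>k. \<phi> (z - r k *\<^sub>R w) *\<^sub>R F z) \<longlonglongrightarrow> \<phi> z *\<^sub>R F z"
        proof (intro AE_I2 tendsto_scaleR tendsto_const)
          fix z
          have "(\<lambda>k. z - r k *\<^sub>R w) \<longlonglongrightarrow> z - 0 *\<^sub>R w" by (intro tendsto_intros r0)
          then have "(\<lambda>k. \<phi> (z - r k *\<^sub>R w)) \<longlonglongrightarrow> \<phi> (z - 0 *\<^sub>R w)"
            using cont by (intro isCont_tendsto_compose[of _ \<phi>]) (auto simp: continuous_on_eq_continuous_at)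
          then show "(\<lambda>k. \<phi> (z - r k *\<^sub>R w)) \<longlonglongrightarrow> \<phi> z" by simp
        qed
      qed auto
    qed
  qed measurable
  have "(\<integral>w. E w *\<^sub>R (\<integral>z. \<phi> z *\<^sub>R F z \<partial>lborel) \<partial>lborel) = 0"
    using lim unfolding S0 by (simp add: LIMSEQ_const_iff)
  moreover have "(\<integral>w. E w *\<^sub>R (\<integral>z. \<phi> z *\<^sub>R F z \<partial>lborel) \<partial>lborel) = (\<integral>w. E w \<partial>lborel) *\<^sub>R (\<integral>z. \<phi> z *\<^sub>R F z \<partial>lborel)"
    using E by (intro integral_scaleR_left) auto
  ultimately show ?thesis by (simp add: E_def integral_Gaussian_unit)
qed

text \<open>The indicator of a closed set is a bounded limit of continuous functions, and the closed sets
  generate the Borel sets; so the integral of \<open>F\<close> over every Borel set vanishes.\<close>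

lemma fourier_injective:
  fixes F :: "'a::euclidean_space \<Rightarrow> complex"
  assumes F: "integrable lborel F" and zero: "\<And>y. fourier F y = 0"
  shows "AE x in lborel. F x = 0"
proof (rule sigma_finite_measure.density_zero[OF sigma_finite_lborel F])
  have [measurable]: "F \<in> borel_measurable borel" using F by auto
  have closed: "(LINT x:A|lborel. F x) = 0" if A: "closed A" for A
  proof (cases "A = {}")
    case False
    \<comment> \<open>Continuous functions that decrease to the indicator of the closed set \<open>A\<close>.\<close>
    define \<phi> where "\<phi> k x = max 0 (1 - real k * infdist x A)" for k x
    have [measurable]: "A \<in> sets borel" using A by simp
    have cont: "continuous_on UNIV (\<phi> k)" for k
      unfolding \<phi>_def by (intro continuous_intros)
    have [measurable]: "\<phi> k \<in> borel_measurable borel" for k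
      using cont by (rule borel_measurable_continuous_onI)
    have bdd: "\<bar>\<phi> k x\<bar> \<le> 1" for k x
      by (auto simp: \<phi>_def infdist_nonneg)
    have "(\<lambda>k. \<integral>x. \<phi> k x *\<^sub>R F x \<partial>lborel) \<longlonglongrightarrow> (\<integral>x. indicator A x *\<^sub>R F x \<partial>lborel)"
    proof (rule integral_dominated_convergence)
      show "integrable lborel (\<lambda>x. norm (F x))" using F by simp
      show "AE x in lborel. norm (\<phi> k x *\<^sub>R F x) \<le> norm (F x)" for k
        using bdd by (auto intro!: AE_I2 mult_left_le_one_le)
      show "AE x in lborel. (\<lambda>k. \<phi> k x *\<^sub>R F x) \<longlonglongrightarrow> indicator A x *\<^sub>R F x"
      proof (intro AE_I2 tendsto_scaleR tendsto_const)
        fix x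
        show "(\<lambda>k. \<phi> k x) \<longlonglongrightarrow> indicator A x"
        proof (cases "x \<in> A")
          case True
          then show ?thesis by (simp add: \<phi>_def)
        next
          case out: False
          then have d: "0 < infdist x A"
            using A False in_closed_iff_infdist_zero[of A x] infdist_nonneg[of x A] by auto
          obtain K :: nat where K: "1 / infdist x A < real K" using reals_Archimedean2 by blast
          have "\<phi> k x = 0" if "K \<le> k" for k
          proof -
            have "1 < real K * infdist x A" using K d by (simp add: field_simps)
            also have "\<dots> \<le> real k * infdist x A" using that d by (intro mult_right_mono) auto
            finally show ?thesis by (simp add: \<phi>_def)
          qed
          then have "(\<lambda>k. \<phi> k x) \<longlonglongrightarrow> 0"
            by (intro tendsto_eventually) (auto simp: eventually_sequentially)
          then show ?thesis using out by simp
        qed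
      qed
    qed measurable
    then show ?thesis
      unfolding set_lebesgue_integral_def integral_continuous_test_eq_0[OF F zero cont bdd]
      by (simp add: LIMSEQ_const_iff)
  qed (simp add: set_lebesgue_integral_def)
  fix A :: "'a set" assume "A \<in> sets lborel"
  then have "Int_stable (Collect closed :: 'a set set)" "Collect closed \<subseteq> Pow (UNIV :: 'a set)"
    "A \<in> sigma_sets UNIV (Collect closed)"
    by (auto simp: Int_stable_def borel_eq_closed)
  then show "(LINT x:A|lborel. F x) = 0"
  proof (induct A rule: sigma_sets_induct_disjoint)
    case (basic A)
    then show ?case using closed by simp
  next
    case empty
    show ?case by (simp add: set_lebesgue_integral_def)
  next
    case (compl A)
    then have [measurable]: "A \<in> sets borel" by (simp add: borel_eq_closed)
    have int: "integrable lborel (\<lambda>x. indicator A x *\<^sub>R F x)"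
      using F by (intro integrable_mult_indicator) auto
    have "(LINT x:UNIV - A|lborel. F x) = (\<integral>x. F x - indicator A x *\<^sub>R F x \<partial>lborel)"
      unfolding set_lebesgue_integral_def
      by (intro Bochner_Integration.integral_cong refl) (auto simp: indicator_def)
    also have "\<dots> = (LINT x:UNIV|lborel. F x) - (LINT x:A|lborel. F x)"
      using F int by (simp add: set_lebesgue_integral_def)
    finally show ?case using compl(2) closed[of UNIV] by simp
  next
    case (union A)
    then have [measurable]: "A i \<in> sets borel" for i by (auto simp: borel_eq_closed)
    have "(LINT x:(\<Union>i. A i)|lborel. F x) = (\<Sum>i. (LINT x:(A i)|lborel. F x))"
      using union(1) F
      by (intro lebesgue_integral_countable_add)
        (auto simp: disjoint_family_on_def set_integrable_def intro!: integrable_mult_indicator)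
    then show ?case using union(3) by simp
  qed
qed

section \<open>Fourier transforms of Schwartz functions\<close>

text \<open>It suffices to treat \<open>(1 + |x|^2)^(-(n + 1)/2)\<close>, which is a superposition of Gaussians.\<close>

lemma integrable_inverse_power:
  assumes K: "DIM('a) < K"
  shows "integrable lborel (\<lambda>x::'a::euclidean_space. 1 / (1 + norm x) ^ K)"
proof -
  define n where "n = real DIM('a)"
  define a where "a = (n + 1) / 2"
  have a: "0 < a" "0 < a - n / 2" by (auto simp: a_def n_def)
  have a2: "2 * a = n + 1" by (simp add: a_def)
  have G: "0 < Gamma a" using a by simp
  define g where "g t = ennreal (t powr (a - 1) * exp (- (1 * t))) * indicator {0<..} t" for t :: real
  have [measurable]: "g \<in> borel_measurable borel" unfolding g_def by measurable
  have le: "1 / (1 + norm x) ^ K \<le> (1 + (norm x)\<^sup>2) powr (- a)" for x :: 'a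
  proof -
    have "(1 + (norm x)\<^sup>2) powr a \<le> ((1 + norm x)\<^sup>2) powr a"
      using a by (intro powr_mono2) (auto simp: power2_eq_square algebra_simps)
    also have "\<dots> = (1 + norm x) powr (n + 1)"
      using power2_powr[of "1 + norm x" a] a2 by (simp add: add_pos_nonneg)
    also have "\<dots> \<le> (1 + norm x) powr real K"
      using K by (intro powr_mono) (auto simp: n_def)
    also have "\<dots> = (1 + norm x) ^ K" by (simp add: powr_realpow add_pos_nonneg)
    finally have "(1 + (norm x)\<^sup>2) powr a \<le> (1 + norm x) ^ K" .
    then have "1 / (1 + norm x) ^ K \<le> 1 / (1 + (norm x)\<^sup>2) powr a"
      by (intro divide_left_mono mult_pos_pos) (auto simp: add_pos_nonneg add_nonneg_eq_0_iff)
    then show ?thesis by (simp add: powr_minus_divide)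
  qed
  have "ennreal (Gamma a) * (\<integral>\<^sup>+ (x::'a). ennreal ((1 + (norm x)\<^sup>2) powr (- a)) \<partial>lborel)
    = (\<integral>\<^sup>+ (x::'a). ennreal (Gamma a * (1 + (norm x)\<^sup>2) powr (- a)) \<partial>lborel)"
    using G by (subst nn_integral_cmult[symmetric]) (auto simp: ennreal_mult)
  also have "\<dots> = (\<integral>\<^sup>+ (x::'a). \<integral>\<^sup>+ t. g t * ennreal (gauss t x) \<partial>lborel \<partial>lborel)"
  proof (rule nn_integral_cong, goal_cases)
    case (1 x)
    have "0 < 1 + (norm x)\<^sup>2" by (simp add: add_pos_nonneg)
    from nn_integral_Gamma_kernel[OF a(1) this]
    have "ennreal (Gamma a * (1 + (norm x)\<^sup>2) powr (- a)) = (\<integral>\<^sup>+ t\<in>{0<..}. ennreal (t powr (a - 1) * exp (- ((1 + (norm x)\<^sup>2) * t))) \<partial>lborel)" by simp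
    also have "\<dots> = (\<integral>\<^sup>+ t. g t * ennreal (gauss t x) \<partial>lborel)"
    proof (rule nn_integral_cong, goal_cases)
      case (1 t)
      have "exp (- ((1 + (norm x)\<^sup>2) * t)) = exp (- (1 * t)) * gauss t x"
        by (simp add: algebra_simps flip: exp_add)
      then show ?case
        by (cases "0 < t") (simp_all add: g_def ennreal_mult[symmetric])
    qed
    finally show ?case .
  qed
  also have "\<dots> = (\<integral>\<^sup>+ t. \<integral>\<^sup>+ (x::'a). g t * ennreal (gauss t x) \<partial>lborel \<partial>lborel)"
    by (rule lborel_pair.Fubini') measurable
  also have "\<dots> = (\<integral>\<^sup>+ t. ennreal (pi powr (n / 2)) * (ennreal (t powr (a - n / 2 - 1) * exp (- (1 * t))) * indicator {0<..} t) \<partial>lborel)"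
  proof (rule nn_integral_cong, goal_cases)
    case (1 t)
    have "(\<integral>\<^sup>+ (x::'a). g t * ennreal (gauss t x) \<partial>lborel) = g t * (\<integral>\<^sup>+ (x::'a). ennreal (gauss t x) \<partial>lborel)"
      by (rule nn_integral_cmult) measurable
    also have "\<dots> = ennreal (pi powr (n / 2)) * (ennreal (t powr (a - n / 2 - 1) * exp (- (1 * t))) * indicator {0<..} t)"
    proof (cases "0 < t")
      case True
      have "t powr (a - 1) * exp (- (1 * t)) * (pi / t) powr (n / 2) = pi powr (n / 2) * (t powr (a - n / 2 - 1) * exp (- (1 * t)))"
      proof -
        have "t powr (a - n / 2 - 1) = t powr (a - 1) / t powr (n / 2)"
          by (simp add: algebra_simps flip: powr_diff)
        then show ?thesis by (simp add: powr_divide)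
      qed
      then show ?thesis
        using True by (simp add: g_def nn_integral_Gaussian n_def[symmetric] ennreal_mult[symmetric])
    qed (simp add: g_def)
    finally show ?case .
  qed
  also have "\<dots> = ennreal (pi powr (n / 2)) * (\<integral>\<^sup>+ t\<in>{0<..}. ennreal (t powr (a - n / 2 - 1) * exp (- (1 * t))) \<partial>lborel)"
    by (rule nn_integral_cmult) measurable
  also have "\<dots> < \<infinity>"
    using nn_integral_Gamma_kernel[OF a(2), of 1] by (simp only: zero_less_one) (simp add: ennreal_mult_less_top)
  finally have "(\<integral>\<^sup>+ (x::'a). ennreal ((1 + (norm x)\<^sup>2) powr (- a)) \<partial>lborel) < \<infinity>"
    using G by (auto simp: ennreal_mult_less_top)
  moreover have "(\<integral>\<^sup>+ (x::'a). ennreal (norm (1 / (1 + norm x) ^ K)) \<partial>lborel) \<le> (\<integral>\<^sup>+ (x::'a). ennreal ((1 + (norm x)\<^sup>2) powr (- a)) \<partial>lborel)"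
    using le by (intro nn_integral_mono ennreal_leI) simp
  ultimately have "(\<integral>\<^sup>+ (x::'a). ennreal (norm (1 / (1 + norm x) ^ K)) \<partial>lborel) < \<infinity>"
    by (rule le_less_trans[rotated])
  then show ?thesis by (intro integrableI_bounded) measurable
qed

lemma schwartz_integrable:
  fixes f :: "real^'n::finite \<Rightarrow> complex"
  assumes f: "f \<in> schwartz"
  shows "integrable lborel f"
proof -
  obtain C where C: "0 \<le> C" "\<And>x. norm (f x) \<le> C / (1 + norm x) ^ (CARD('n) + 1)"
    using schwartz_bound[OF f, of "CARD('n) + 1"] by blast
  have "integrable lborel (\<lambda>x::real^'n. C * (1 / (1 + norm x) ^ (CARD('n) + 1)))"
    by (intro integrable_mult_right integrable_inverse_power) simp
  then show ?thesis
    using schwartz_measurable[OF f] C by (rule_tac Bochner_Integration.integrable_bound) (auto intro!: AE_I2 intro: order_trans[OF _ abs_ge_self])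
qed

text \<open>The integral of \<open>u(x + e) - u(x)\<close> vanishes by translation invariance. By the fundamental theorem
  of calculus this increment is the mean of the translates \<open>v(x + t e)\<close> over \<open>0 \<le> t \<le> 1\<close>, so
  its integral is also that of \<open>v\<close>.\<close>

lemma integral_directional_derivative_eq_0:
  fixes u v :: "'a::euclidean_space \<Rightarrow> complex"
  assumes der: "\<And>x. (u has_derivative D x) (at x)" and v: "\<And>x. v x = D x e"
    and cont: "continuous_on UNIV v"
    and u_int: "integrable lborel u" and v_int: "integrable lborel v"
  shows "(\<integral>x. v x \<partial>lborel) = 0"
proof -
  have [measurable]: "u \<in> borel_measurable borel" "v \<in> borel_measurable borel" using u_int v_int by auto
  have shift: "(\<integral>x. w (x + t *\<^sub>R e) \<partial>lborel) = (\<integral>x. w x \<partial>lborel)"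
    if [measurable]: "w \<in> borel_measurable borel" for w :: "'a \<Rightarrow> complex" and t
    using integral_lborel_affine[of w 1 "t *\<^sub>R e"] by (simp add: add.commute)
  have nn_shift: "(\<integral>\<^sup>+ x. ennreal (norm (v (x + t *\<^sub>R e))) \<partial>lborel) = (\<integral>\<^sup>+ x. ennreal (norm (v x)) \<partial>lborel)" for t
    using nn_integral_lborel_affine[of "\<lambda>x. ennreal (norm (v x))" 1 "t *\<^sub>R e"] by (simp add: add.commute)
  have ftc: "u (x + 1 *\<^sub>R e) - u x = (\<integral>t. indicator {0..1} t *\<^sub>R v (x + t *\<^sub>R e) \<partial>lborel)" for x
  proof -
    have "has_bochner_integral lborel (\<lambda>t. indicator {0..1::real} t *\<^sub>R v (x + t *\<^sub>R e)) (u (x + 1 *\<^sub>R e) - u (x + 0 *\<^sub>R e))"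
    proof (rule has_bochner_integral_FTC_Icc)
      fix t :: real
      have "((\<lambda>t. u (x + t *\<^sub>R e)) has_derivative (\<lambda>s. D (x + t *\<^sub>R e) (s *\<^sub>R e))) (at t)"
      proof (rule has_derivative_compose[where g = u and f = "\<lambda>t. x + t *\<^sub>R e" and f' = "\<lambda>s. s *\<^sub>R e"])
        show "((\<lambda>t. x + t *\<^sub>R e) has_derivative (\<lambda>s. s *\<^sub>R e)) (at t)"
          by (auto intro!: derivative_eq_intros)
      qed (rule der)
      moreover have "D (x + t *\<^sub>R e) (s *\<^sub>R e) = s *\<^sub>R v (x + t *\<^sub>R e)" for s
        unfolding v by (rule linear_cmul[OF has_derivative_linear[OF der]])
      ultimately show "((\<lambda>t. u (x + t *\<^sub>R e)) has_vector_derivative v (x + t *\<^sub>R e)) (at t within {0..1})"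
        by (simp add: has_vector_derivative_def has_derivative_at_withinI)
    next
      show "continuous_on {0..1} (\<lambda>t. v (x + t *\<^sub>R e))"
        by (rule continuous_on_compose2[OF cont]) (auto intro!: continuous_intros)
    qed simp
    then show ?thesis by (simp add: has_bochner_integral_iff)
  qed
  have "(\<integral>x. v x \<partial>lborel) = (\<integral>t. indicator {0..1::real} t *\<^sub>R (\<integral>x. v x \<partial>lborel) \<partial>lborel)"
    by simp
  also have "\<dots> = (\<integral>t. \<integral>x. indicator {0..1::real} t *\<^sub>R v (x + t *\<^sub>R e) \<partial>lborel \<partial>lborel)"
    by (rule Bochner_Integration.integral_cong[OF refl]) (simp add: shift)
  also have "\<dots> = (\<integral>x. \<integral>t. indicator {0..1::real} t *\<^sub>R v (x + t *\<^sub>R e) \<partial>lborel \<partial>lborel)"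
  proof (rule Fubini_swap)
    have "(\<integral>\<^sup>+ t. \<integral>\<^sup>+ x. ennreal (norm (indicator {0..1::real} t *\<^sub>R v (x + t *\<^sub>R e))) \<partial>lborel \<partial>lborel)
      = (\<integral>\<^sup>+ t. indicator {0..1::real} t * (\<integral>\<^sup>+ x. ennreal (norm (v x)) \<partial>lborel) \<partial>lborel)"
    proof (rule nn_integral_cong, goal_cases)
      case (1 t)
      show ?case
        by (cases "t \<in> {0..1}") (simp_all add: nn_shift)
    qed
    also have "\<dots> = (\<integral>\<^sup>+ x. ennreal (norm (v x)) \<partial>lborel)"
      by (subst nn_integral_multc) auto
    also have "\<dots> < \<infinity>" using v_int by (simp add: integrable_iff_bounded)
    finally show "(\<integral>\<^sup>+ t. \<integral>\<^sup>+ x. ennreal (norm (indicator {0..1::real} t *\<^sub>R v (x + t *\<^sub>R e))) \<partial>lborel \<partial>lborel) < \<infinity>" .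
  qed measurable
  also have "\<dots> = (\<integral>x. u (x + 1 *\<^sub>R e) - u x \<partial>lborel)"
    unfolding ftc ..
  also have "\<dots> = (\<integral>x. u (x + 1 *\<^sub>R e) \<partial>lborel) - (\<integral>x. u x \<partial>lborel)"
    using u_int integrable_lborel_affine[OF u_int, of 1 e]
    by (intro Bochner_Integration.integral_diff) (auto simp: add.commute)
  also have "(\<integral>x. u (x + 1 *\<^sub>R e) \<partial>lborel) = (\<integral>x. u x \<partial>lborel)"
    by (rule shift) measurable
  also have "(\<integral>x. u x \<partial>lborel) - (\<integral>x. u x \<partial>lborel) = 0" by simp
  finally show ?thesis .
qed

text \<open>Integration by parts: the preceding lemma for the product of \<open>g\<close> and the character.\<close>

lemma fourier_partial_deriv:
  fixes g :: "real^'n::finite \<Rightarrow> complex"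
  assumes g: "g \<in> schwartz"
  shows "fourier (partial_deriv i g) y = - (\<i> * complex_of_real (2 * pi * y $ i)) * fourier g y"
proof -
  define d where "d = partial_deriv i g"
  have d: "d \<in> schwartz" unfolding d_def by (rule schwartz_partial_deriv[OF g])
  have [measurable]: "g \<in> borel_measurable borel" "d \<in> borel_measurable borel"
    using g d by (auto intro: schwartz_measurable)
  define c where "c x = wave x y" for x :: "real^'n"
  have c_int: "integrable lborel (\<lambda>x. c x * f x)" if "f \<in> schwartz" for f
    by (rule Bochner_Integration.integrable_bound[OF schwartz_integrable[OF that]])
      (use schwartz_measurable[OF that] in \<open>auto simp: c_def norm_mult\<close>)
  define D where "D x = (\<lambda>h. c x * frechet_derivative g (at x) h + ((2 * pi * (h \<bullet> y)) *\<^sub>R (\<i> * c x)) * g x)" for x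
  have "(\<integral>x. c x * d x + (2 * pi * y $ i) *\<^sub>R (\<i> * (c x * g x)) \<partial>lborel) = 0"
  proof (rule integral_directional_derivative_eq_0[where u = "\<lambda>x. c x * g x" and D = D and e = "axis i 1"])
    fix x
    have "(g has_derivative frechet_derivative g (at x)) (at x)"
      using schwartz_differentiable[OF g] by (simp add: frechet_derivative_works)
    moreover have "(c has_derivative (\<lambda>h. (2 * pi * (h \<bullet> y)) *\<^sub>R (\<i> * c x))) (at x)"
      unfolding c_def by (intro has_derivative_cis) (auto intro!: derivative_eq_intros)
    ultimately show "((\<lambda>x. c x * g x) has_derivative D x) (at x)"
      unfolding D_def by (intro has_derivative_mult)
    show "c x * d x + (2 * pi * y $ i) *\<^sub>R (\<i> * (c x * g x)) = D x (axis i 1)"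
      by (simp add: D_def d_def partial_deriv_def inner_axis')
    show "continuous_on UNIV (\<lambda>x. c x * d x + (2 * pi * y $ i) *\<^sub>R (\<i> * (c x * g x)))"
      unfolding c_def using g d by (intro continuous_intros schwartz_continuous)
    show "integrable lborel (\<lambda>x. c x * g x)" using g by (rule c_int)
    show "integrable lborel (\<lambda>x. c x * d x + (2 * pi * y $ i) *\<^sub>R (\<i> * (c x * g x)))"
      using c_int[OF g] c_int[OF d] by (intro Bochner_Integration.integrable_add integrable_scaleR_right integrable_mult_right)
  qed
  moreover have "(\<integral>x. c x * d x + (2 * pi * y $ i) *\<^sub>R (\<i> * (c x * g x)) \<partial>lborel)
      = (\<integral>x. c x * d x \<partial>lborel) + (\<integral>x. (2 * pi * y $ i) *\<^sub>R (\<i> * (c x * g x)) \<partial>lborel)"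
    using c_int[OF g] c_int[OF d] by (intro Bochner_Integration.integral_add integrable_scaleR_right integrable_mult_right)
  moreover have "(\<integral>x. (2 * pi * y $ i) *\<^sub>R (\<i> * (c x * g x)) \<partial>lborel) = (2 * pi * y $ i) *\<^sub>R (\<i> * (\<integral>x. c x * g x \<partial>lborel))"
    by (simp only: integral_scaleR_right integral_mult_right_zero)
  ultimately have "fourier d y + (2 * pi * y $ i) *\<^sub>R (\<i> * fourier g y) = 0"
    unfolding fourier_cis c_def by simp
  then have "fourier d y = - ((2 * pi * y $ i) *\<^sub>R (\<i> * fourier g y))"
    by (rule eq_neg_iff_add_eq_0[THEN iffD2])
  then show ?thesis by (simp add: d_def scaleR_conv_of_real)
qed

lemma norm_fourier_le: "norm (fourier f y) \<le> (\<integral>x. norm (f x) \<partial>lborel)"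
  using integral_norm_bound[of lborel "\<lambda>x. wave x y * f x"]
  by (simp add: fourier_cis norm_mult)

lemma fourier_measurable [measurable]: 
  assumes [measurable]: "f \<in> borel_measurable borel"
  shows "fourier f \<in> borel_measurable borel"
  unfolding fourier_cis[abs_def] by measurable

lemma fourier_schwartz_decay:
  fixes g :: "real^'n::finite \<Rightarrow> complex"
  assumes g: "g \<in> schwartz"
  obtains C where "0 \<le> C" "\<And>y. norm (fourier g y) \<le> C / (1 + norm y) ^ K"
proof -
  define n where "n = real CARD('n)"
  define B where "B i = (\<integral>x. norm (partial_derivs (replicate K i) g x) \<partial>lborel)" for i
  define B0 where "B0 = (\<integral>x. norm (g x) \<partial>lborel)"
  have B: "0 \<le> B i" for i unfolding B_def by simp
  have B0: "0 \<le> B0" unfolding B0_def by simp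
  have rep: "fourier (partial_derivs (replicate k i) g) y = (- (\<i> * complex_of_real (2 * pi * y $ i))) ^ k * fourier g y" for k i y
  proof (induction k)
    case (Suc k)
    have "fourier (partial_deriv i (partial_derivs (replicate k i) g)) y = - (\<i> * complex_of_real (2 * pi * y $ i)) * fourier (partial_derivs (replicate k i) g) y"
      by (rule fourier_partial_deriv[OF schwartz_partial_derivs[OF g]])
    then show ?case using Suc by simp
  qed simp
  have coord: "\<bar>y $ i\<bar> ^ K * norm (fourier g y) \<le> B i" for y i
  proof -
    have "\<bar>y $ i\<bar> ^ K \<le> (2 * pi * \<bar>y $ i\<bar>) ^ K"
    proof (rule power_mono)
      have "1 * \<bar>y $ i\<bar> \<le> 2 * pi * \<bar>y $ i\<bar>" using pi_gt3 by (intro mult_right_mono) auto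
      then show "\<bar>y $ i\<bar> \<le> 2 * pi * \<bar>y $ i\<bar>" by simp
    qed simp
    then have "\<bar>y $ i\<bar> ^ K * norm (fourier g y) \<le> (2 * pi * \<bar>y $ i\<bar>) ^ K * norm (fourier g y)"
      by (intro mult_right_mono) auto
    also have "\<dots> = norm (fourier (partial_derivs (replicate K i) g) y)"
      unfolding rep by (simp add: norm_mult norm_power abs_mult)
    also have "\<dots> \<le> B i" unfolding B_def by (rule norm_fourier_le)
    finally show ?thesis .
  qed
  define C where "C = 2 ^ K * (B0 + n ^ K * (\<Sum>i\<in>UNIV. B i))"
  have n: "1 \<le> n" unfolding n_def by (simp add: Suc_leI)
  have S: "0 \<le> (\<Sum>i\<in>UNIV. B i)" using B by (intro sum_nonneg) auto
  show thesis
  proof (rule that)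
    show "0 \<le> C" unfolding C_def using B0 S n by (intro mult_nonneg_nonneg add_nonneg_nonneg) auto
    fix y :: "real^'n"
    define a where "a = norm (fourier g y)"
    have a: "0 \<le> a" "a \<le> B0" unfolding a_def B0_def by (auto intro: norm_fourier_le)
    have "norm y ^ K * a \<le> n ^ K * (\<Sum>i\<in>UNIV. B i)"
    proof -
      \<comment> \<open>The bounds control powers of single coordinates; the largest coordinate controls \<open>|y|\<close>.\<close>
      have "\<exists>i. norm y \<le> n * \<bar>y $ i\<bar>"
      proof (rule ccontr)
        assume "\<nexists>i. norm y \<le> n * \<bar>y $ i\<bar>"
        then have "(\<Sum>i\<in>UNIV. n * \<bar>y $ i\<bar>) < (\<Sum>i\<in>(UNIV::'n set). norm y)"
          by (intro sum_strict_mono) (auto simp: not_le)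
        then have "n * (\<Sum>i\<in>UNIV. \<bar>y $ i\<bar>) < n * norm y"
          by (simp add: sum_distrib_left n_def)
        then show False using norm_le_l1_cart[of y] n by (simp add: mult_less_cancel_left)
      qed
      then obtain i where "norm y \<le> n * \<bar>y $ i\<bar>" ..
      then have "norm y ^ K * a \<le> (n * \<bar>y $ i\<bar>) ^ K * a"
        using a by (intro mult_right_mono power_mono) auto
      also have "\<dots> = n ^ K * (\<bar>y $ i\<bar> ^ K * a)" by (simp add: power_mult_distrib)
      also have "\<dots> \<le> n ^ K * (\<Sum>i\<in>UNIV. B i)"
        using n coord[of y i] B unfolding a_def
        by (intro mult_left_mono order_trans[OF coord[of y i]] member_le_sum) auto
      finally show ?thesis .
    qed
    moreover have "(1 + norm y) ^ K \<le> 2 ^ K * (1 + norm y ^ K)"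
    proof -
      have "(1 + norm y) ^ K \<le> (2 * max 1 (norm y)) ^ K" by (intro power_mono) auto
      also have "\<dots> = 2 ^ K * max 1 (norm y) ^ K" by (simp add: power_mult_distrib)
      also have "max 1 (norm y) ^ K \<le> 1 + norm y ^ K" by (simp add: max_def)
      finally show ?thesis by simp
    qed
    then have "(1 + norm y) ^ K * a \<le> 2 ^ K * (a + norm y ^ K * a)"
      using mult_right_mono[OF _ a(1)] by (fastforce simp: algebra_simps)
    ultimately have "(1 + norm y) ^ K * a \<le> C"
      using a unfolding C_def by (smt (verit) mult_left_mono zero_le_power)
    then show "norm (fourier g y) \<le> C / (1 + norm y) ^ K"
      unfolding a_def by (simp add: pos_le_divide_eq add_pos_nonneg mult.commute)
  qed
qed

text \<open>The symbol \<open>|y|^s\<close> is not smooth at the origin, so the transform of \<open>(-\<Delta>)^(s/2) g\<close> need not be a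
  Schwartz function. Its moments are all finite, which makes its inverse transform smooth.\<close>

definition has_all_moments :: "('a::euclidean_space \<Rightarrow> complex) \<Rightarrow> bool" where
  "has_all_moments m \<longleftrightarrow> m \<in> borel_measurable borel \<and> (\<forall>k::nat. integrable lborel (\<lambda>y. norm y ^ k * norm (m y)))"

lemma has_all_moments_bound:
  fixes m :: "'a::euclidean_space \<Rightarrow> complex" and f :: "'a \<Rightarrow> 'b::{banach, second_countable_topology}"
  assumes m: "has_all_moments m" and [measurable]: "f \<in> borel_measurable borel"
    and le: "\<And>y. norm (f y) \<le> C * (norm y ^ k * norm (m y))"
  shows "integrable lborel f"
proof (rule Bochner_Integration.integrable_bound)
  show "integrable lborel (\<lambda>y. C * (norm y ^ k * norm (m y)))"
    using m by (intro integrable_mult_right) (simp add: has_all_moments_def)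
  show "AE y in lborel. norm (f y) \<le> norm (C * (norm y ^ k * norm (m y)))"
    using le by (intro AE_I2) (auto intro: order_trans[OF _ abs_ge_self])
qed measurable

lemma has_all_moments_integrable: "has_all_moments m \<Longrightarrow> integrable lborel m"
  by (rule has_all_moments_bound[where C = 1 and k = 0]) (auto simp: has_all_moments_def)

lemma fourier_schwartz_moments:
  fixes g :: "real^'n::finite \<Rightarrow> complex"
  assumes g: "g \<in> schwartz" and s: "0 \<le> s"
  shows "has_all_moments (\<lambda>y. complex_of_real ((2 * pi * norm y) powr s) * fourier g y)"
  unfolding has_all_moments_def
proof (intro conjI allI)
  have [measurable]: "g \<in> borel_measurable borel" using g by (rule schwartz_measurable)
  show "(\<lambda>y. complex_of_real ((2 * pi * norm y) powr s) * fourier g y) \<in> borel_measurable borel" by measurable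
  fix k :: nat
  obtain l :: nat where l: "s \<le> real l" using real_arch_simple by blast
  define N where "N = CARD('n) + 1"
  obtain C where C: "0 \<le> C" "\<And>y. norm (fourier g y) \<le> C / (1 + norm y) ^ (k + l + N)"
    using fourier_schwartz_decay[OF g] by metis
  show "integrable lborel (\<lambda>y. norm y ^ k * norm (complex_of_real ((2 * pi * norm y) powr s) * fourier g y))"
  proof (rule Bochner_Integration.integrable_bound)
    show "integrable lborel (\<lambda>y::real^'n. ((2 * pi) powr s * C) * (1 / (1 + norm y) ^ N))"
      unfolding N_def by (intro integrable_mult_right integrable_inverse_power) simp
    show "AE y in lborel. norm (norm y ^ k * norm (complex_of_real ((2 * pi * norm y) powr s) * fourier g y))
      \<le> norm (((2 * pi) powr s * C) * (1 / (1 + norm (y::real^'n)) ^ N))"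
    proof (rule AE_I2)
      fix y :: "real^'n"
      define b where "b = 1 + norm y"
      have b: "1 \<le> b" by (simp add: b_def)
      have "norm y powr s \<le> b powr s" using s by (intro powr_mono2) (auto simp: b_def)
      also have "\<dots> \<le> b powr real l" using b l by (intro powr_mono) auto
      also have "\<dots> = b ^ l" using b by (simp add: powr_realpow)
      finally have 1: "norm y powr s \<le> b ^ l" .
      have 2: "norm y ^ k \<le> b ^ k" by (intro power_mono) (auto simp: b_def)
      have "norm (norm y ^ k * norm (complex_of_real ((2 * pi * norm y) powr s) * fourier g y))
        = (2 * pi) powr s * (norm y ^ k * norm y powr s * norm (fourier g y))"
        by (simp add: norm_mult powr_mult abs_mult)
      also have "\<dots> \<le> (2 * pi) powr s * (b ^ k * b ^ l * (C / b ^ (k + l + N)))"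
        using 1 2 C(1) C(2)[of y, folded b_def] b
        by (intro mult_left_mono mult_mono) auto
      also have "b ^ k * b ^ l * (C / b ^ (k + l + N)) = C * (1 / b ^ N)"
        using b by (simp add: power_add)
      finally show "norm (norm y ^ k * norm (complex_of_real ((2 * pi * norm y) powr s) * fourier g y))
        \<le> norm (((2 * pi) powr s * C) * (1 / (1 + norm y) ^ N))"
        using C b by (simp add: b_def)
    qed
  qed measurable
qed

lemma norm_cis_remainder_le: "norm (cis t - 1 - \<i> * complex_of_real t) \<le> t\<^sup>2 / 2"
  using iexp_approx1[of t 1] by (simp add: cis_conv_exp algebra_simps power2_eq_square)

text \<open>The remainder of the first-order expansion of the character is at most quadratic, so the second
  moment of \<open>m\<close> bounds the error by a multiple of \<open>|z - x|^2\<close>.\<close>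

lemma inverse_fourier_has_derivative:
  fixes m :: "'a::euclidean_space \<Rightarrow> complex"
  assumes m: "has_all_moments m"
  shows "(inverse_fourier m has_derivative
    (\<lambda>v. inverse_fourier (\<lambda>y. - (\<i> * complex_of_real (2 * pi * (v \<bullet> y))) * m y) x)) (at x)"
proof -
  have [measurable]: "m \<in> borel_measurable borel" using m by (simp add: has_all_moments_def)
  define M where "M k = (\<integral>y. norm y ^ k * norm (m y) \<partial>lborel)" for k
  have M_int: "integrable lborel (\<lambda>y. norm y ^ k * norm (m y))" for k
    using m by (simp add: has_all_moments_def)
  define e where "e y = wave' x y" for y
  have [measurable]: "e \<in> borel_measurable borel" unfolding e_def by measurable
  have ne: "norm (e y) = 1" for y by (simp add: e_def)
  define d where "d v y = e y * (- (\<i> * complex_of_real (2 * pi * (v \<bullet> y))) * m y)" for v y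
  define D where "D v = (\<integral>y. d v y \<partial>lborel)" for v
  have D_eq: "inverse_fourier (\<lambda>y. - (\<i> * complex_of_real (2 * pi * (v \<bullet> y))) * m y) x = D v" for v
    unfolding inverse_fourier_cis D_def d_def e_def ..
  have [measurable]: "d v \<in> borel_measurable borel" for v unfolding d_def by measurable
  have dn: "norm (d v y) \<le> 2 * pi * norm v * (norm y ^ 1 * norm (m y))" for v y
  proof -
    have "norm (d v y) = 2 * pi * \<bar>v \<bullet> y\<bar> * norm (m y)" by (simp add: d_def norm_mult ne abs_mult)
    also have "\<dots> \<le> 2 * pi * (norm v * norm y) * norm (m y)"
      by (intro mult_right_mono mult_left_mono Cauchy_Schwarz_ineq2) auto
    finally show ?thesis by (simp add: mult_ac)
  qed
  have d_int: "integrable lborel (d v)" for v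
    by (rule has_all_moments_bound[OF m _ dn]) measurable
  have lin: "bounded_linear D"
  proof (rule bounded_linear_intro[where K = "2 * pi * M 1"])
    fix v w
    have "D (v + w) = (\<integral>y. d v y + d w y \<partial>lborel)"
      unfolding D_def by (intro Bochner_Integration.integral_cong refl) (simp add: d_def inner_add_left algebra_simps)
    then show "D (v + w) = D v + D w"
      unfolding D_def using d_int by simp
  next
    fix r v
    have "D (r *\<^sub>R v) = (\<integral>y. r *\<^sub>R d v y \<partial>lborel)"
      unfolding D_def by (intro Bochner_Integration.integral_cong refl) (simp add: d_def scaleR_conv_of_real)
    then show "D (r *\<^sub>R v) = r *\<^sub>R D v"
      unfolding D_def by simp
  next
    fix v
    have "norm (D v) \<le> (\<integral>y. norm (d v y) \<partial>lborel)" unfolding D_def by (rule integral_norm_bound)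
    also have "\<dots> \<le> (\<integral>y. 2 * pi * norm v * (norm y ^ 1 * norm (m y)) \<partial>lborel)"
      by (intro integral_mono integrable_mult_right M_int integrable_norm d_int dn)
    also have "\<dots> = norm v * (2 * pi * M 1)" unfolding M_def by simp
    finally show "norm (D v) \<le> norm v * (2 * pi * M 1)" .
  qed
  have rem: "norm (inverse_fourier m z - inverse_fourier m x - D (z - x)) \<le> 2 * pi\<^sup>2 * M 2 * (norm (z - x))\<^sup>2" for z
  proof -
    define v where "v = z - x"
    have ez: "wave' z y = e y * wave' v y" for y
      unfolding e_def cis_mult v_def by (simp add: inner_diff_left algebra_simps)
    have int1: "integrable lborel (\<lambda>y. e y * wave' v y * m y)" "integrable lborel (\<lambda>y. e y * m y)"
      by (auto intro!: has_all_moments_bound[OF m, where C = 1 and k = 0] simp: norm_mult ne)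
    have "inverse_fourier m z - inverse_fourier m x - D v
       = (\<integral>y. e y * wave' v y * m y - e y * m y - d v y \<partial>lborel)"
      unfolding inverse_fourier_cis ez unfolding e_def[symmetric] D_def
      using int1 d_int by simp
    also have "norm \<dots> \<le> (\<integral>y. norm (e y * wave' v y * m y - e y * m y - d v y) \<partial>lborel)"
      by (rule integral_norm_bound)
    also have "\<dots> \<le> (\<integral>y. (2 * pi\<^sup>2 * (norm v)\<^sup>2) * (norm y ^ 2 * norm (m y)) \<partial>lborel)"
    proof (rule integral_mono)
      show "integrable lborel (\<lambda>y. norm (e y * wave' v y * m y - e y * m y - d v y))"
        using int1 d_int by simp
      show "integrable lborel (\<lambda>y. (2 * pi\<^sup>2 * (norm v)\<^sup>2) * (norm y ^ 2 * norm (m y)))"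
        using m by (intro integrable_mult_right) (simp add: has_all_moments_def)
      fix y
      define t where "t = - (2 * pi * (v \<bullet> y))"
      have "e y * wave' v y * m y - e y * m y - d v y = e y * (cis t - 1 - \<i> * complex_of_real t) * m y"
        by (simp add: d_def t_def algebra_simps)
      then have "norm (e y * wave' v y * m y - e y * m y - d v y) = norm (cis t - 1 - \<i> * complex_of_real t) * norm (m y)"
        by (simp add: norm_mult ne)
      also have "\<dots> \<le> t\<^sup>2 / 2 * norm (m y)"
        by (intro mult_right_mono norm_cis_remainder_le) simp
      also have "t\<^sup>2 / 2 = 2 * pi\<^sup>2 * (v \<bullet> y)\<^sup>2" by (simp add: t_def power_mult_distrib)
      also have "2 * pi\<^sup>2 * (v \<bullet> y)\<^sup>2 * norm (m y) \<le> 2 * pi\<^sup>2 * (norm v * norm y)\<^sup>2 * norm (m y)"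
      proof (intro mult_right_mono mult_left_mono)
        have "\<bar>v \<bullet> y\<bar>\<^sup>2 \<le> (norm v * norm y)\<^sup>2" by (intro power_mono Cauchy_Schwarz_ineq2) simp
        then show "(v \<bullet> y)\<^sup>2 \<le> (norm v * norm y)\<^sup>2" by simp
      qed auto
      finally show "norm (e y * wave' v y * m y - e y * m y - d v y) \<le> (2 * pi\<^sup>2 * (norm v)\<^sup>2) * (norm y ^ 2 * norm (m y))"
        by (simp add: power_mult_distrib mult_ac)
    qed
    also have "\<dots> = 2 * pi\<^sup>2 * M 2 * (norm v)\<^sup>2" unfolding M_def integral_mult_right_zero by (simp only: mult_ac)
    finally show ?thesis unfolding v_def .
  qed
  have "(inverse_fourier m has_derivative D) (at x)"
  proof (rule has_derivativeI_sandwich[where e = 1 and H = "\<lambda>z. 2 * pi\<^sup>2 * M 2 * norm (z - x)"])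
    fix z assume "z \<noteq> x"
    then show "norm (inverse_fourier m z - inverse_fourier m x - D (z - x)) / norm (z - x) \<le> 2 * pi\<^sup>2 * M 2 * norm (z - x)"
      using rem[of z] by (simp add: pos_divide_le_eq power2_eq_square mult_ac)
  next
    have "((\<lambda>z. 2 * pi\<^sup>2 * M 2 * norm (z - x)) \<longlongrightarrow> 2 * pi\<^sup>2 * M 2 * norm (x - x)) (at x)"
      by (intro tendsto_intros)
    then show "((\<lambda>z. 2 * pi\<^sup>2 * M 2 * norm (z - x)) \<longlongrightarrow> 0) (at x)" by simp
  qed (use lin in auto)
  then show ?thesis unfolding D_eq .
qed

lemma inverse_fourier_differentiable: "has_all_moments m \<Longrightarrow> inverse_fourier m differentiable (at x)"
  using inverse_fourier_has_derivative differentiable_def by blast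

lemma inverse_fourier_continuous: "has_all_moments m \<Longrightarrow> continuous_on A (inverse_fourier m)"
  by (simp add: continuous_at_imp_continuous_on differentiable_imp_continuous_within inverse_fourier_differentiable)

lemma continuous_on_partial_deriv_inverse_fourier:
  fixes m :: "real^'n::finite \<Rightarrow> complex"
  assumes m: "has_all_moments m"
  shows "continuous_on A (partial_deriv i (inverse_fourier m))"
proof -
  have [measurable]: "m \<in> borel_measurable borel" using m by (simp add: has_all_moments_def)
  have "partial_deriv i (inverse_fourier m) = inverse_fourier (\<lambda>y. - (\<i> * complex_of_real (2 * pi * (axis i 1 \<bullet> y))) * m y)"
    unfolding partial_deriv_def frechet_derivative_at[OF inverse_fourier_has_derivative[OF m], symmetric] ..
  moreover have "has_all_moments (\<lambda>y. - (\<i> * complex_of_real (2 * pi * (axis i 1 \<bullet> y))) * m y)"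
    unfolding has_all_moments_def
  proof (intro conjI allI)
    fix k :: nat
    show "integrable lborel (\<lambda>y. norm y ^ k * norm (- (\<i> * complex_of_real (2 * pi * (axis i 1 \<bullet> y))) * m y))"
    proof (rule has_all_moments_bound[OF m])
      fix y :: "real^'n"
      have "\<bar>y $ i\<bar> \<le> norm y" by (rule component_le_norm_cart)
      then have "norm y ^ k * (2 * pi * \<bar>y $ i\<bar> * norm (m y)) \<le> norm y ^ k * (2 * pi * norm y * norm (m y))"
        by (intro mult_left_mono mult_right_mono) auto
      then show "norm (norm y ^ k * norm (- (\<i> * complex_of_real (2 * pi * (axis i 1 \<bullet> y))) * m y)) \<le> 2 * pi * (norm y ^ Suc k * norm (m y))"
        by (simp add: norm_mult abs_mult inner_axis' mult_ac)
    qed measurable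
  qed measurable
  ultimately show ?thesis by (simp add: inverse_fourier_continuous)
qed

section \<open>The fractional Laplacian and Riesz potentials\<close>

text \<open>The Gamma integral after the substitution \<open>u = 1/t\<close>. It is needed because the Fourier transform
  inverts the parameter of a Gaussian.\<close>

lemma nn_integral_inverse_Gamma_kernel:
  assumes a: "0 < a" and c: "0 < c"
  shows "(\<integral>\<^sup>+ t\<in>{0<..}. ennreal (t powr (- a - 1) * exp (- (c / t))) \<partial>lborel) = ennreal (Gamma a * c powr (- a))"
proof -
  define f where "f u = u powr (a - 1) * exp (- (c * u))" for u
  have f0: "0 \<le> f u" for u by (simp add: f_def)
  have G: "0 \<le> Gamma a * c powr (- a)" using a by (simp add: Gamma_real_pos less_imp_le)
  have "has_bochner_integral lborel (\<lambda>u. indicator {0<..} u * f u) (Gamma a * c powr (- a))"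
  proof (rule has_bochner_integral_nn_integral)
    have "(\<integral>\<^sup>+ u. ennreal (indicator {0<..} u * f u) \<partial>lborel) = (\<integral>\<^sup>+ u\<in>{0<..}. ennreal (f u) \<partial>lborel)"
      by (rule nn_integral_cong) (simp split: split_indicator)
    then show "(\<integral>\<^sup>+ u. ennreal (indicator {0<..} u * f u) \<partial>lborel) = ennreal (Gamma a * c powr (- a))"
      unfolding f_def nn_integral_Gamma_kernel[OF a c] .
  qed (use f0 G in \<open>auto simp: f_def\<close>)
  then have si: "set_integrable lborel {0<..} f" "(LINT u:{0<..}|lborel. f u) = Gamma a * c powr (- a)"
    by (simp_all add: has_bochner_integral_iff set_integrable_def set_lebesgue_integral_def)
  then have f_int: "f integrable_on {0<..}" "integral {0<..} f = Gamma a * c powr (- a)"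
    using set_borel_integral_eq_integral[OF si(1)] by auto
  have inv: "(\<lambda>t::real. 1 / t) ` {0<..} = {0<..}"
    by (auto simp: image_iff intro!: bexI[of _ "1 / _"])
  have "f absolutely_integrable_on {0<..}"
    using f_int f0 by (intro nonnegative_absolutely_integrable_1) auto
  then have "f absolutely_integrable_on ((\<lambda>t. 1 / t) ` {0<..}) \<and> integral ((\<lambda>t. 1 / t) ` {0<..}) f = Gamma a * c powr (- a)"
    unfolding inv using f_int by simp
  then have "(\<lambda>t. \<bar>- (1 / t\<^sup>2)\<bar> * f (1 / t)) absolutely_integrable_on {0<..} \<and>
      integral {0<..} (\<lambda>t. \<bar>- (1 / t\<^sup>2)\<bar> * f (1 / t)) = Gamma a * c powr (- a)"
  proof (rule has_absolute_integral_change_of_variables_1'[THEN iffD2, rotated 3])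
    show "((\<lambda>t. 1 / t) has_field_derivative - (1 / t\<^sup>2)) (at t within {0<..})" if "t \<in> {0<..}" for t :: real
      using that by (auto intro!: derivative_eq_intros simp: power2_eq_square)
  qed (auto simp: inj_on_def)
  then have "((\<lambda>t. \<bar>- (1 / t\<^sup>2)\<bar> * f (1 / t)) has_integral (Gamma a * c powr (- a))) {0<..}"
    using set_lebesgue_integral_eq_integral(1) by (auto simp: has_integral_integrable_integral)
  then have "(\<integral>\<^sup>+ t\<in>{0<..}. ennreal (\<bar>- (1 / t\<^sup>2)\<bar> * f (1 / t)) \<partial>lborel) = ennreal (Gamma a * c powr (- a))"
    using f0 by (intro nn_integral_has_integral_lebesgue') auto
  also have "(\<integral>\<^sup>+ t\<in>{0<..}. ennreal (\<bar>- (1 / t\<^sup>2)\<bar> * f (1 / t)) \<partial>lborel)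
    = (\<integral>\<^sup>+ t\<in>{0<..}. ennreal (t powr (- a - 1) * exp (- (c / t))) \<partial>lborel)"
  proof (rule nn_integral_cong, goal_cases)
    case (1 t)
    show ?case
    proof (cases "0 < t")
      case True
      have "t powr (- a - 1) = t powr (- 2) * t powr (- (a - 1))"
        unfolding powr_add[symmetric] by (intro arg_cong[of _ _ "(powr) t"]) simp
      also have "t powr (- 2) = 1 / t\<^sup>2" using True by (simp add: powr_minus_divide)
      also have "t powr (- (a - 1)) = (1 / t) powr (a - 1)"
        using True by (simp add: powr_divide powr_minus_divide del: minus_diff_eq)
      finally show ?thesis using True by (simp add: f_def)
    qed simp
  qed
  finally show ?thesis .
qed

text \<open>With \<open>\<xi> = 0\<close> and \<open>T = 1\<close> these are Gaussian means of the inverse transform, with \<open>a = 0\<close> and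
  \<open>T\<close> large the transform of a dilate with a Gaussian window.\<close>

lemma Gaussian_mean_inverse_fourier:
  fixes m :: "'a::euclidean_space \<Rightarrow> complex"
  assumes m: "integrable lborel m" and c: "0 < c"
  shows "(\<integral>x. inverse_fourier m (a + T *\<^sub>R x) * (wave x \<xi> * complex_of_real (gauss c x)) \<partial>lborel)
    = (\<integral>y. wave' a y * m y * complex_of_real ((pi / c) powr (real DIM('a) / 2) * exp (- (pi\<^sup>2 * (norm (\<xi> - T *\<^sub>R y))\<^sup>2 / c))) \<partial>lborel)"
proof -
  have [measurable]: "m \<in> borel_measurable borel" using m by auto
  define G where "G x = gauss c x" for x :: 'a
  have [measurable]: "G \<in> borel_measurable borel" unfolding G_def by measurable
  have G: "integrable lborel G" unfolding G_def using c by (rule integrable_Gaussian)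
  have "(\<integral>x. inverse_fourier m (a + T *\<^sub>R x) * (wave x \<xi> * complex_of_real (G x)) \<partial>lborel)
    = (\<integral>x. \<integral>y. wave' a y * m y * (wave x (\<xi> - T *\<^sub>R y) * complex_of_real (G x)) \<partial>lborel \<partial>lborel)"
  proof (rule Bochner_Integration.integral_cong[OF refl], goal_cases)
    case (1 x)
    have "inverse_fourier m (a + T *\<^sub>R x) * (wave x \<xi> * complex_of_real (G x))
      = (\<integral>y. wave' (a + T *\<^sub>R x) y * m y * (wave x \<xi> * complex_of_real (G x)) \<partial>lborel)"
      unfolding inverse_fourier_cis by (rule integral_mult_left_zero[symmetric])
    also have "\<dots> = (\<integral>y. wave' a y * m y * (wave x (\<xi> - T *\<^sub>R y) * complex_of_real (G x)) \<partial>lborel)"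
    proof (rule Bochner_Integration.integral_cong[OF refl], goal_cases)
      case (1 y)
      have "wave' (a + T *\<^sub>R x) y * wave x \<xi>
          = wave' a y * wave x (\<xi> - T *\<^sub>R y)"
        unfolding cis_mult by (rule arg_cong[of _ _ cis]) (simp add: inner_add_left inner_diff_right algebra_simps)
      then show ?case
      proof -
        have "a * b = c * d \<Longrightarrow> a * u * (b * v) = c * u * (d * v)" for a b c d u v :: complex
          by (metis (no_types) mult.assoc mult.left_commute)
        then show ?thesis
          using \<open>wave' (a + T *\<^sub>R x) y * _ = _\<close> by blast
      qed
    qed
    finally show ?case .
  qed
  also have "\<dots> = (\<integral>y. \<integral>x. wave' a y * m y * (wave x (\<xi> - T *\<^sub>R y) * complex_of_real (G x)) \<partial>lborel \<partial>lborel)"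
    by (rule Fubini_swap_product[OF _ m G, symmetric]) (auto simp: norm_mult G_def)
  also have "\<dots> = (\<integral>y. wave' a y * m y * complex_of_real ((pi / c) powr (real DIM('a) / 2) * exp (- (pi\<^sup>2 * (norm (\<xi> - T *\<^sub>R y))\<^sup>2 / c))) \<partial>lborel)"
    unfolding integral_mult_right_zero G_def fourier_Gaussian[OF c] ..
  finally show ?thesis unfolding G_def .
qed

lemma fourier_schwartz_integrable:
  fixes g :: "real^'n::finite \<Rightarrow> complex"
  assumes g: "g \<in> schwartz"
  shows "integrable lborel (fourier g)"
proof -
  have [measurable]: "g \<in> borel_measurable borel" using g by (rule schwartz_measurable)
  obtain C where C: "0 \<le> C" "\<And>y. norm (fourier g y) \<le> C / (1 + norm y) ^ (CARD('n) + 1)"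
    using fourier_schwartz_decay[OF g] by metis
  show ?thesis
  proof (rule Bochner_Integration.integrable_bound)
    show "integrable lborel (\<lambda>y::real^'n. C * (1 / (1 + norm y) ^ (CARD('n) + 1)))"
      by (intro integrable_mult_right integrable_inverse_power) simp
    show "AE y in lborel. norm (fourier g y) \<le> norm (C * (1 / (1 + norm (y::real^'n)) ^ (CARD('n) + 1)))"
      using C by (intro AE_I2) (auto intro: order_trans[OF _ abs_ge_self])
  qed measurable
qed

text \<open>Let \<open>h\<close> be the fractional Laplacian of \<open>g\<close>, and \<open>\<Phi>\<close> the superposition over \<open>t\<close> of the Gaussian
  means of \<open>h\<close> at \<open>x\<close> with the weight \<open>t^(l/2 - 1)\<close>. In space, \<open>\<Phi>\<close> is bounded by the Riesz potential
  of \<open>|h|\<close>. On the Fourier side the Gaussians add up to a multiple of \<open>|y|^(-s)\<close>, which cancels the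
  symbol of the fractional Laplacian and leaves the inversion integral for \<open>g\<close>; so \<open>\<Phi>\<close> is a
  multiple of \<open>g(x)\<close>.\<close>

lemma schwartz_le_Riesz_potential:
  fixes g :: "real^'n::finite \<Rightarrow> complex"
  assumes g: "g \<in> schwartz" and s: "0 < s" and l: "0 < l" and sl: "s + l = real CARD('n)"
  shows "ennreal (norm (g x))
    \<le> ennreal (Gamma (l / 2) / (pi powr (real CARD('n) / 2) * 2 powr s * Gamma (s / 2)))
       * (\<integral>\<^sup>+ z. ennreal (norm (x - z) powr (- l)) * ennreal (norm (frac_laplacian s g z)) \<partial>lborel)"
proof -
  define d where "d = real CARD('n) / 2"
  define m where "m y = complex_of_real ((2 * pi * norm y) powr s) * fourier g y" for y
  define h where "h = inverse_fourier m"
  have h_eq: "frac_laplacian s g = h" unfolding frac_laplacian_def h_def m_def ..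
  have mom: "has_all_moments m" unfolding m_def using g s by (intro fourier_schwartz_moments) auto
  have [measurable]: "g \<in> borel_measurable borel" using g by (rule schwartz_measurable)
  have [measurable]: "m \<in> borel_measurable borel" using mom by (simp add: has_all_moments_def)
  have [measurable]: "h \<in> borel_measurable borel"
    unfolding h_def using mom by (intro borel_measurable_continuous_onI inverse_fourier_continuous)
  have m: "integrable lborel m" using mom by (rule has_all_moments_integrable)
  have gh: "integrable lborel (fourier g)"
    using g by (rule fourier_schwartz_integrable)
  obtain B where B: "norm (g x) \<le> B / (1 + norm x) ^ 0" for x using schwartz_bound[OF g] by metis
  have inv: "inverse_fourier (fourier g) x = g x"
    using B by (intro fourier_inversion schwartz_integrable gh schwartz_continuous g) simp
  define k where "k t = indicator {0<..} t * t powr (l / 2 - 1)" for t :: real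
  have [measurable]: "k \<in> borel_measurable borel" unfolding k_def by measurable
  have k0: "0 \<le> k t" for t by (simp add: k_def)
  define \<Phi> where "\<Phi> = (\<integral>t. \<integral>w. k t *\<^sub>R (h (x + w) * complex_of_real (gauss t w)) \<partial>lborel \<partial>lborel)"
  \<comment> \<open>A divergent Bochner integral is zero, so this holds for every \<open>F\<close>.\<close>
  have norm_int: "ennreal (norm (\<integral>t. F t \<partial>M)) \<le> (\<integral>\<^sup>+ t. ennreal (norm (F t)) \<partial>M)" for F :: "'c \<Rightarrow> complex" and M
    by (cases "integrable M F") (auto simp: not_integrable_integral_eq intro: integral_norm_bound_ennreal)
  have upper: "ennreal (norm \<Phi>) \<le> ennreal (Gamma (l / 2)) * (\<integral>\<^sup>+ z. ennreal (norm (x - z) powr (- l)) * ennreal (norm (h z)) \<partial>lborel)"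
  proof -
    have "ennreal (norm \<Phi>) \<le> (\<integral>\<^sup>+ t. ennreal (norm (\<integral>w. k t *\<^sub>R (h (x + w) * complex_of_real (gauss t w)) \<partial>lborel)) \<partial>lborel)"
      unfolding \<Phi>_def by (rule norm_int)
    also have "\<dots> \<le> (\<integral>\<^sup>+ t. \<integral>\<^sup>+ w. ennreal (norm (k t *\<^sub>R (h (x + w) * complex_of_real (gauss t w)))) \<partial>lborel \<partial>lborel)"
      by (rule nn_integral_mono) (rule norm_int)
    also have "\<dots> = (\<integral>\<^sup>+ w. \<integral>\<^sup>+ t. ennreal (norm (k t *\<^sub>R (h (x + w) * complex_of_real (gauss t w)))) \<partial>lborel \<partial>lborel)"
      by (rule lborel_pair.Fubini') measurable
    also have "\<dots> = (\<integral>\<^sup>+ w. ennreal (norm (h (x + w))) * ennreal (Gamma (l / 2) * norm w powr (- l)) \<partial>lborel)"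
    proof (rule nn_integral_cong_AE, use AE_lborel_singleton[of 0] in eventually_elim)
      case (elim w)
      have "(\<integral>\<^sup>+ t. ennreal (norm (k t *\<^sub>R (h (x + w) * complex_of_real (gauss t w)))) \<partial>lborel)
        = (\<integral>\<^sup>+ t. ennreal (norm (h (x + w))) * (ennreal (t powr (l / 2 - 1) * gauss t w) * indicator {0<..} t) \<partial>lborel)"
        by (rule nn_integral_cong)
          (simp add: k_def norm_mult ennreal_mult[symmetric] mult_ac split: split_indicator)
      also have "\<dots> = ennreal (norm (h (x + w))) * (\<integral>\<^sup>+ t\<in>{0<..}. ennreal (t powr (l / 2 - 1) * gauss t w) \<partial>lborel)"
        by (rule nn_integral_cmult) measurable
      finally show ?case unfolding norm_powr_eq_Gamma_integral[OF elim l] .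
    qed
    also have "\<dots> = (\<integral>\<^sup>+ w. ennreal (Gamma (l / 2)) * (ennreal (norm w powr (- l)) * ennreal (norm (h (x + w)))) \<partial>lborel)"
      using l by (intro nn_integral_cong) (simp add: ennreal_mult mult_ac Gamma_real_pos less_imp_le)
    also have "\<dots> = ennreal (Gamma (l / 2)) * (\<integral>\<^sup>+ w. ennreal (norm w powr (- l)) * ennreal (norm (h (x + w))) \<partial>lborel)"
      by (rule nn_integral_cmult) measurable
    also have "(\<integral>\<^sup>+ w. ennreal (norm w powr (- l)) * ennreal (norm (h (x + w))) \<partial>lborel)
      = (\<integral>\<^sup>+ z. ennreal (norm (x - z) powr (- l)) * ennreal (norm (h z)) \<partial>lborel)"
      using nn_integral_lborel_affine[of "\<lambda>z. ennreal (norm (x - z) powr (- l)) * ennreal (norm (h z))" 1 x] by simp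
    finally show ?thesis .
  qed
  \<comment> \<open>The transform at \<open>y\<close> of the Gaussian with parameter \<open>t\<close>, including the weight
      \<open>t^(l/2 - 1)\<close>; its integral over \<open>t\<close> is \<open>Q y\<close>.\<close>
  define q where "q y t = (pi powr d) * (indicator {0<..} t * (t powr (- (s / 2) - 1) * exp (- (pi\<^sup>2 * (norm y)\<^sup>2 / t))))" for y :: "real^'n" and t
  have [measurable]: "(\<lambda>z. q (f z) (e z)) \<in> borel_measurable M" if [measurable]: "f \<in> borel_measurable M" "e \<in> borel_measurable M" for f e M
    unfolding q_def by measurable
  have q0: "0 \<le> q y t" for y t by (simp add: q_def)
  have Gs: "0 < Gamma (s / 2)" "0 < Gamma (l / 2)" using s l by auto
  define Q where "Q y = pi powr d * (Gamma (s / 2) * (pi\<^sup>2 * (norm y)\<^sup>2) powr (- (s / 2)))" for y :: "real^'n"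
  have Q0: "0 \<le> Q y" for y using Gs by (simp add: Q_def)
  have qQ: "(\<integral>\<^sup>+ t. ennreal (q y t) \<partial>lborel) = ennreal (Q y)" if "y \<noteq> 0" for y
  proof -
    have "(\<integral>\<^sup>+ t. ennreal (q y t) \<partial>lborel) = (\<integral>\<^sup>+ t. ennreal (pi powr d) * (ennreal (t powr (- (s / 2) - 1) * exp (- (pi\<^sup>2 * (norm y)\<^sup>2 / t))) * indicator {0<..} t) \<partial>lborel)"
      by (rule nn_integral_cong) (simp add: q_def ennreal_mult[symmetric] split: split_indicator)
    also have "\<dots> = ennreal (pi powr d) * (\<integral>\<^sup>+ t\<in>{0<..}. ennreal (t powr (- (s / 2) - 1) * exp (- (pi\<^sup>2 * (norm y)\<^sup>2 / t))) \<partial>lborel)"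
      by (rule nn_integral_cmult) measurable
    also have "\<dots> = ennreal (Q y)"
      using s that Gs by (subst nn_integral_inverse_Gamma_kernel) (auto simp: Q_def ennreal_mult[symmetric])
    finally show ?thesis .
  qed
  have Qm: "complex_of_real (Q y) * m y = complex_of_real (pi powr d * 2 powr s * Gamma (s / 2)) * fourier g y" if "y \<noteq> 0" for y
  proof -
    have "(pi\<^sup>2 * (norm y)\<^sup>2) powr (- (s / 2)) = (pi * norm y) powr (- s)"
      using that power2_powr[of "pi * norm y" "- (s / 2)"] by (simp add: power_mult_distrib)
    moreover have "(2 * pi * norm y) powr s = 2 powr s * (pi * norm y) powr s" by (simp add: powr_mult)
    moreover have "(pi * norm y) powr (- s) * (pi * norm y) powr s = 1" using that by (simp flip: powr_add)
    ultimately have "Q y * (2 * pi * norm y) powr s = pi powr d * 2 powr s * Gamma (s / 2)"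
      unfolding Q_def by (simp add: mult_ac)
    then have "complex_of_real (Q y) * complex_of_real ((2 * pi * norm y) powr s) = complex_of_real (pi powr d * 2 powr s * Gamma (s / 2))"
      by (simp only: of_real_mult[symmetric])
    then show ?thesis unfolding m_def by (simp only: mult.assoc[symmetric])
  qed
  have "\<Phi> = (\<integral>t. \<integral>y. wave' x y * m y * complex_of_real (q y t) \<partial>lborel \<partial>lborel)"
    unfolding \<Phi>_def
  proof (rule Bochner_Integration.integral_cong[OF refl], goal_cases)
    case (1 t)
    show ?case
    proof (cases "0 < t")
      case t: True
      have "(\<integral>w. k t *\<^sub>R (h (x + w) * complex_of_real (gauss t w)) \<partial>lborel)
        = k t *\<^sub>R (\<integral>w. h (x + 1 *\<^sub>R w) * (wave w 0 * complex_of_real (gauss t w)) \<partial>lborel)"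
        by simp
      also have "\<dots> = k t *\<^sub>R (\<integral>y. wave' x y * m y * complex_of_real ((pi / t) powr (real DIM(real^'n) / 2) * exp (- (pi\<^sup>2 * (norm (0 - 1 *\<^sub>R y))\<^sup>2 / t))) \<partial>lborel)"
        unfolding h_def Gaussian_mean_inverse_fourier[OF m t] ..
      also have "\<dots> = (\<integral>y. k t *\<^sub>R (wave' x y * m y * complex_of_real ((pi / t) powr (real DIM(real^'n) / 2) * exp (- (pi\<^sup>2 * (norm (0 - 1 *\<^sub>R y))\<^sup>2 / t)))) \<partial>lborel)"
        by (rule integral_scaleR_right[symmetric])
      also have "\<dots> = (\<integral>y. wave' x y * m y * complex_of_real (q y t) \<partial>lborel)"
      proof (rule Bochner_Integration.integral_cong[OF refl], goal_cases)
        case (1 y)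
        have e: "- (s / 2) - 1 = (l / 2 - 1) - d" using sl by (simp add: d_def)
        have "k t * ((pi / t) powr (real DIM(real^'n) / 2) * exp (- (pi\<^sup>2 * (norm (0 - 1 *\<^sub>R y))\<^sup>2 / t))) = q y t"
          unfolding q_def e using t by (simp add: k_def powr_divide powr_diff d_def)
        then show ?case
          unfolding scaleR_conv_of_real mult.left_commute[of "complex_of_real (k t)"] of_real_mult[symmetric]
          by (simp only:)
      qed
      finally show ?thesis .
    qed (simp add: k_def q_def)
  qed
  also have "\<dots> = (\<integral>y. \<integral>t. wave' x y * m y * complex_of_real (q y t) \<partial>lborel \<partial>lborel)"
  proof (rule Fubini_swap[symmetric])
    have "(\<integral>\<^sup>+ y. \<integral>\<^sup>+ t. ennreal (norm (wave' x y * m y * complex_of_real (q y t))) \<partial>lborel \<partial>lborel)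
      = (\<integral>\<^sup>+ y. ennreal (norm (complex_of_real (pi powr d * 2 powr s * Gamma (s / 2)) * fourier g y)) \<partial>lborel)"
    proof (rule nn_integral_cong_AE, use AE_lborel_singleton[of 0] in eventually_elim)
      case (elim y)
      have "(\<integral>\<^sup>+ t. ennreal (norm (wave' x y * m y * complex_of_real (q y t))) \<partial>lborel)
        = (\<integral>\<^sup>+ t. ennreal (norm (m y)) * ennreal (q y t) \<partial>lborel)"
        using q0 by (intro nn_integral_cong) (simp add: norm_mult ennreal_mult)
      also have "\<dots> = ennreal (norm (m y)) * ennreal (Q y)"
        unfolding qQ[OF elim, symmetric] by (rule nn_integral_cmult) measurable
      also have "\<dots> = ennreal (norm (complex_of_real (Q y) * m y))"
        using Q0 by (simp add: norm_mult ennreal_mult mult.commute)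
      finally show ?case unfolding Qm[OF elim] .
    qed
    also have "\<dots> < \<infinity>"
      using integrable_mult_right[OF gh, of "complex_of_real (pi powr d * 2 powr s * Gamma (s / 2))"]
      unfolding integrable_iff_bounded by blast
    finally show "(\<integral>\<^sup>+ y. \<integral>\<^sup>+ t. ennreal (norm (wave' x y * m y * complex_of_real (q y t))) \<partial>lborel \<partial>lborel) < \<infinity>" .
  qed measurable
  also have "\<dots> = (\<integral>y. complex_of_real (pi powr d * 2 powr s * Gamma (s / 2)) * (wave' x y * fourier g y) \<partial>lborel)"
  proof (rule integral_cong_AE)
    show "AE y in lborel. (\<integral>t. wave' x y * m y * complex_of_real (q y t) \<partial>lborel) = complex_of_real (pi powr d * 2 powr s * Gamma (s / 2)) * (wave' x y * fourier g y)"
      using AE_lborel_singleton[of 0]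
    proof eventually_elim
      case (elim y)
      have "has_bochner_integral lborel (q y) (Q y)"
        using qQ[OF elim] q0 Q0 by (intro has_bochner_integral_nn_integral) auto
      then have "(\<integral>t. q y t \<partial>lborel) = Q y" by (simp add: has_bochner_integral_iff)
      then have "(\<integral>t. wave' x y * m y * complex_of_real (q y t) \<partial>lborel) = wave' x y * m y * complex_of_real (Q y)"
        by simp
      also have "\<dots> = wave' x y * (complex_of_real (Q y) * m y)" by (simp only: mult_ac)
      finally show ?case unfolding Qm[OF elim] by (simp only: mult_ac)
    qed
  qed measurable
  also have "\<dots> = complex_of_real (pi powr d * 2 powr s * Gamma (s / 2)) * g x"
    unfolding integral_mult_right_zero inv[unfolded inverse_fourier_cis] ..
  finally have \<Phi>: "\<Phi> = complex_of_real (pi powr d * 2 powr s * Gamma (s / 2)) * g x" .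
  define W where "W = pi powr d * 2 powr s * Gamma (s / 2)"
  have W: "0 < W" unfolding W_def using Gs by simp
  have "ennreal (norm (g x)) = ennreal (1 / W) * ennreal (norm \<Phi>)"
    unfolding \<Phi> W_def[symmetric] using W by (simp add: norm_mult ennreal_mult[symmetric])
  also have "\<dots> \<le> ennreal (1 / W) * (ennreal (Gamma (l / 2)) * (\<integral>\<^sup>+ z. ennreal (norm (x - z) powr (- l)) * ennreal (norm (h z)) \<partial>lborel))"
    by (intro mult_left_mono upper) auto
  also have "\<dots> = ennreal (Gamma (l / 2) / W) * (\<integral>\<^sup>+ z. ennreal (norm (x - z) powr (- l)) * ennreal (norm (h z)) \<partial>lborel)"
    using W Gs by (simp add: mult.assoc[symmetric] ennreal_mult[symmetric])
  finally show ?thesis unfolding h_eq W_def d_def .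
qed

section \<open>Limits along rays\<close>

lemma polynomial_Gaussian_bounded:
  assumes c: "0 < c" and r: "0 \<le> r"
  shows "(1 + r) ^ N * exp (- (c * r\<^sup>2)) \<le> exp ((real N)\<^sup>2 / (4 * c))"
proof -
  have "(1 + r) ^ N \<le> exp r ^ N" using r by (intro power_mono) auto
  also have "\<dots> = exp (real N * r)" by (simp add: exp_of_nat_mult)
  finally have "(1 + r) ^ N * exp (- (c * r\<^sup>2)) \<le> exp (real N * r) * exp (- (c * r\<^sup>2))"
    by (rule mult_right_mono) simp
  also have "\<dots> = exp (real N * r - c * r\<^sup>2)" by (simp flip: exp_add)
  also have "\<dots> \<le> exp ((real N)\<^sup>2 / (4 * c))"
  proof -
    have "0 \<le> (real N - 2 * c * r)\<^sup>2" by simp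
    then have "4 * c * (real N * r - c * r\<^sup>2) \<le> (real N)\<^sup>2"
      by (simp add: power2_eq_square algebra_simps)
    then have "real N * r - c * r\<^sup>2 \<le> (real N)\<^sup>2 / (4 * c)"
      using c by (simp add: pos_le_divide_eq mult.commute)
    then show ?thesis by simp
  qed
  finally show ?thesis .
qed

lemma nn_integral_polynomial_Gaussian_finite:
  assumes c: "0 < c"
  shows "(\<integral>\<^sup>+ (x::'a::euclidean_space). ennreal ((1 + norm x) ^ N * gauss c x) \<partial>lborel) < \<infinity>"
proof -
  define K where "K = DIM('a) + 1"
  define C where "C = exp ((real (N + K))\<^sup>2 / (4 * c))"
  have "(1 + norm x) ^ N * gauss c x \<le> norm (C * (1 / (1 + norm x) ^ K))" for x :: 'a
  proof -
    have "(1 + norm x) ^ (N + K) * gauss c x \<le> C"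
      unfolding C_def using c by (intro polynomial_Gaussian_bounded) auto
    moreover have "0 < 1 + norm x" by (simp add: add_pos_nonneg)
    ultimately have "(1 + norm x) ^ N * gauss c x \<le> C / (1 + norm x) ^ K"
      by (simp add: pos_le_divide_eq power_add mult_ac)
    then show ?thesis by (simp add: C_def)
  qed
  then have "(\<integral>\<^sup>+ (x::'a). ennreal ((1 + norm x) ^ N * gauss c x) \<partial>lborel)
     \<le> (\<integral>\<^sup>+ (x::'a). ennreal (norm (C * (1 / (1 + norm x) ^ K))) \<partial>lborel)"
    by (intro nn_integral_mono ennreal_leI)
  also have "\<dots> < \<infinity>"
    using integrable_mult_right[OF integrable_inverse_power[of K, where 'a='a], of C]
    unfolding integrable_iff_bounded K_def by simp
  finally show ?thesis .
qed

text \<open>For positive \<open>m\<close> the singularity at the origin is absorbed by the composition formula: for a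
  unit vector \<open>e\<close> the Gaussian is at most a multiple of \<open>|e - y|^(-l)\<close>.\<close>

lemma nn_integral_powr_Gaussian_finite:
  assumes m: "m < real DIM('a)" and c: "0 < c"
  shows "(\<integral>\<^sup>+ (x::'a::euclidean_space). ennreal (norm x powr (- m) * gauss c x) \<partial>lborel) < \<infinity>"
proof (cases "0 < m")
  case False
  obtain N :: nat where N: "- m \<le> real N" using real_arch_simple by blast
  have "norm x powr (- m) \<le> (1 + norm x) ^ N" for x :: 'a
  proof -
    have "norm x powr (- m) \<le> (1 + norm x) powr (- m)" using False by (intro powr_mono2) auto
    also have "\<dots> \<le> (1 + norm x) powr real N" using N by (intro powr_mono) auto
    also have "\<dots> = (1 + norm x) ^ N" by (simp add: powr_realpow add_pos_nonneg)
    finally show ?thesis .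
  qed
  then have "(\<integral>\<^sup>+ (x::'a). ennreal (norm x powr (- m) * gauss c x) \<partial>lborel)
    \<le> (\<integral>\<^sup>+ (x::'a). ennreal ((1 + norm x) ^ N * gauss c x) \<partial>lborel)"
    by (intro nn_integral_mono ennreal_leI mult_right_mono) auto
  also have "\<dots> < \<infinity>" by (rule nn_integral_polynomial_Gaussian_finite[OF c])
  finally show ?thesis .
next
  case True
  \<comment> \<open>Any \<open>l\<close> with \<open>n - m < l < n\<close> would do.\<close>
  define l where "l = real DIM('a) - m / 2"
  have l: "0 < l" "l < real DIM('a)" "real DIM('a) < l + m" using True m by (auto simp: l_def)
  obtain N :: nat where N: "l \<le> real N" using real_arch_simple by blast
  define C where "C = exp ((real N)\<^sup>2 / (4 * c))"
  obtain e :: 'a where e: "norm e = 1" using vector_choose_size[of 1] by auto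
  have le: "gauss c y \<le> C * norm (e - y) powr (- l)" if "y \<noteq> e" for y
  proof -
    have "norm (e - y) powr l \<le> (1 + norm y) powr l"
      using norm_triangle_ineq4[of e y] e l by (intro powr_mono2) auto
    also have "\<dots> \<le> (1 + norm y) powr real N" using N by (intro powr_mono) auto
    also have "\<dots> = (1 + norm y) ^ N" by (simp add: powr_realpow add_pos_nonneg)
    finally have "norm (e - y) powr l * gauss c y \<le> (1 + norm y) ^ N * gauss c y"
      by (rule mult_right_mono) simp
    also have "\<dots> \<le> C" unfolding C_def using c by (intro polynomial_Gaussian_bounded) auto
    finally show ?thesis
      using that by (simp add: powr_minus_divide pos_le_divide_eq mult.commute)
  qed
  have "(\<integral>\<^sup>+ (x::'a). ennreal (norm x powr (- m) * gauss c x) \<partial>lborel)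
    \<le> (\<integral>\<^sup>+ (x::'a). ennreal C * ennreal (norm (e - x) powr (- l) * norm x powr (- m)) \<partial>lborel)"
  proof (rule nn_integral_mono_AE, use AE_lborel_singleton[of e] in eventually_elim)
    case (elim y)
    have "norm y powr (- m) * gauss c y \<le> norm y powr (- m) * (C * norm (e - y) powr (- l))"
      using le[OF elim] by (intro mult_left_mono) auto
    then show ?case
      by (simp add: C_def ennreal_mult[symmetric] mult_ac ennreal_leI)
  qed
  also have "\<dots> = ennreal C * (\<integral>\<^sup>+ (x::'a). ennreal (norm (e - x) powr (- l) * norm x powr (- m)) \<partial>lborel)"
    by (rule nn_integral_cmult) measurable
  also have "\<dots> = ennreal C * ennreal (Riesz_const DIM('a) l m * norm e powr (real DIM('a) - l - m))"
    using l True m e by (subst Riesz_composition) auto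
  also have "\<dots> < \<infinity>" by (simp add: ennreal_mult_less_top)
  finally show ?thesis .
qed

text \<open>Hoelder's inequality is Jensen's inequality for the density \<open>b^q\<close> and the function
  \<open>a b^(1 - q)\<close>.\<close>

lemma nn_integral_Holder:
  fixes b :: "'a \<Rightarrow> real"
  assumes p: "1 < p" and q: "1 / p + 1 / q = 1"
    and [measurable]: "a \<in> borel_measurable M" "b \<in> borel_measurable M"
    and b: "AE x in M. 0 < b x" and fin: "(\<integral>\<^sup>+ x. ennreal (b x powr q) \<partial>M) < \<infinity>"
  shows "epow (\<integral>\<^sup>+ x. a x * ennreal (b x) \<partial>M) p
    \<le> epow (\<integral>\<^sup>+ x. ennreal (b x powr q) \<partial>M) (p - 1) * (\<integral>\<^sup>+ x. epow (a x) p \<partial>M)"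
proof -
  have pq: "(1 - q) * p = - q"
  proof -
    have "q \<noteq> 0" using q p by auto
    then have "q + p = p * q" using q p by (simp add: field_simps)
    then show ?thesis by (simp add: algebra_simps)
  qed
  define v where "v x = a x * ennreal (b x powr (1 - q))" for x
  have [measurable]: "v \<in> borel_measurable M" unfolding v_def by measurable
  have "(\<integral>\<^sup>+ x. a x * ennreal (b x) \<partial>M) = (\<integral>\<^sup>+ x. ennreal (b x powr q) * v x \<partial>M)"
  proof (rule nn_integral_cong_AE, use b in eventually_elim)
    case (elim x)
    have "b x powr q * b x powr (1 - q) = b x" using elim by (simp flip: powr_add)
    then have "ennreal (b x) = ennreal (b x powr q) * ennreal (b x powr (1 - q))"
      by (simp add: ennreal_mult[symmetric])
    then show ?case by (simp add: v_def mult_ac)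
  qed
  also have "epow \<dots> p \<le> epow (\<integral>\<^sup>+ x. ennreal (b x powr q) \<partial>M) (p - 1) * (\<integral>\<^sup>+ x. ennreal (b x powr q) * epow (v x) p \<partial>M)"
    using p fin by (intro epow_nn_integral_le) auto
  also have "(\<integral>\<^sup>+ x. ennreal (b x powr q) * epow (v x) p \<partial>M) = (\<integral>\<^sup>+ x. epow (a x) p \<partial>M)"
  proof (rule nn_integral_cong_AE, use b in eventually_elim)
    case (elim x)
    have "b x powr q * b x powr ((1 - q) * p) = 1" unfolding pq using elim by (simp flip: powr_add)
    then have "ennreal (b x powr q) * ennreal (b x powr ((1 - q) * p)) = 1"
      by (simp add: ennreal_mult[symmetric])
    moreover have "epow (v x) p = ennreal (b x powr ((1 - q) * p)) * epow (a x) p"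
      using p unfolding v_def by (simp add: epow_mult powr_powr mult.commute)
    ultimately show ?case by (simp add: mult.assoc[symmetric])
  qed
  finally show ?thesis .
qed

text \<open>A bound for the variation of \<open>f\<close> along the ray from \<open>x\<close> to infinity.\<close>

definition ray_variation :: "(real^'n::finite \<Rightarrow> complex) \<Rightarrow> real^'n \<Rightarrow> ennreal" where
  "ray_variation f x = (\<integral>\<^sup>+ t\<in>{1..}. ennreal (norm x) * ennreal (norm (gradient f (t *\<^sub>R x))) \<partial>lborel)"

lemma ray_variation_measurable:
  assumes "punctured_C1 f"
  shows "ray_variation f \<in> borel_measurable borel"
proof -
  have [measurable]: "gradient f \<in> borel_measurable borel"
    using assms by (rule punctured_C1_gradient_measurable)
  show ?thesis unfolding ray_variation_def[abs_def] by measurable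
qed

text \<open>The variation from \<open>j x\<close> onwards is the tail of a convergent integral.\<close>

lemma ray_variation_tail:
  fixes f :: "real^'n::finite \<Rightarrow> complex"
  assumes f: "punctured_C1 f" and fin: "ray_variation f x < \<infinity>"
  shows "(\<lambda>j. ray_variation f (real (Suc j) *\<^sub>R x)) \<longlonglongrightarrow> 0"
proof -
  have [measurable]: "gradient f \<in> borel_measurable borel"
    using f by (rule punctured_C1_gradient_measurable)
  define u where "u t = ennreal (norm x) * ennreal (norm (gradient f (t *\<^sub>R x)))" for t :: real
  have [measurable]: "u \<in> borel_measurable borel" unfolding u_def by measurable
  have eq: "ray_variation f (real (Suc j) *\<^sub>R x) = (\<integral>\<^sup>+ t. u t * indicator {real (Suc j)..} t \<partial>lborel)" for j
  proof -
    define c where "c = real (Suc j)"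
    have c: "0 < c" by (simp add: c_def)
    have "(\<integral>\<^sup>+ t. u t * indicator {c..} t \<partial>lborel) = ennreal \<bar>c\<bar> * (\<integral>\<^sup>+ t. u (0 + c * t) * indicator {c..} (0 + c * t) \<partial>lborel)"
      using c by (intro nn_integral_real_affine) auto
    also have "\<dots> = (\<integral>\<^sup>+ t. ennreal \<bar>c\<bar> * (u (0 + c * t) * indicator {c..} (0 + c * t)) \<partial>lborel)"
      by (rule nn_integral_cmult[symmetric]) measurable
    also have "\<dots> = (\<integral>\<^sup>+ t\<in>{1..}. ennreal (norm (c *\<^sub>R x)) * ennreal (norm (gradient f (t *\<^sub>R c *\<^sub>R x))) \<partial>lborel)"
    proof (rule nn_integral_cong, goal_cases)
      case (1 t)
      have "indicator {c..} (0 + c * t) = (indicator {1..} t :: ennreal)"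
        using c by (simp add: indicator_def)
      then show ?case
        by (simp add: u_def ennreal_mult mult.assoc mult.commute[of c t])
    qed
    finally show ?thesis unfolding ray_variation_def c_def by simp
  qed
  have "(\<lambda>j. \<integral>\<^sup>+ t. u t * indicator {real (Suc j)..} t \<partial>lborel) \<longlonglongrightarrow> (\<integral>\<^sup>+ t. 0 \<partial>(lborel :: real measure))"
  proof (rule nn_integral_dominated_convergence[where w = "\<lambda>t. u t * indicator {1..} t"])
    show "AE t in lborel. u t * indicator {real (Suc j)..} t \<le> u t * indicator {1..} t" for j
      by (intro AE_I2 mult_left_mono) (auto simp: indicator_def)
    show "(\<integral>\<^sup>+ t. u t * indicator {1..} t \<partial>lborel) < \<infinity>" using fin by (simp add: ray_variation_def u_def)
    show "AE t in lborel. (\<lambda>j. u t * indicator {real (Suc j)..} t) \<longlonglongrightarrow> 0"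
    proof (rule AE_I2)
      fix t :: real
      obtain N :: nat where "t < real N" using reals_Archimedean2 by blast
      then have "\<forall>j\<ge>N. u t * indicator {real (Suc j)..} t = 0" by (auto simp: indicator_def)
      then show "(\<lambda>j. u t * indicator {real (Suc j)..} t) \<longlonglongrightarrow> 0"
        by (intro tendsto_eventually) (auto simp: eventually_sequentially)
    qed
  qed measurable
  then show ?thesis unfolding eq by simp
qed

lemma ray_limit_exists:
  fixes f :: "real^'n::finite \<Rightarrow> complex"
  assumes f: "punctured_C1 f" and x: "x \<noteq> 0" and fin: "ray_variation f x < \<infinity>"
  shows "convergent (\<lambda>k. f (real k *\<^sub>R x))"
proof (rule Cauchy_convergent, rule metric_CauchyI)
  fix e :: real assume e: "0 < e"
  have "\<forall>\<^sub>F j in sequentially. ray_variation f (real (Suc j) *\<^sub>R x) < ennreal (e / 2)"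
    using e by (intro order_tendstoD(2)[OF ray_variation_tail[OF f fin]]) auto
  then obtain j where j: "ray_variation f (real (Suc j) *\<^sub>R x) < ennreal (e / 2)"
    by (auto simp: eventually_sequentially)
  define N where "N = Suc j"
  have close: "dist (f (real k *\<^sub>R x)) (f (real N *\<^sub>R x)) < e / 2" if "N \<le> k" for k
  proof -
    have "ennreal (norm (f ((real k / real N) *\<^sub>R (real N *\<^sub>R x)) - f (real N *\<^sub>R x))) \<le> ray_variation f (real N *\<^sub>R x)"
      unfolding ray_variation_def using x that by (intro ray_increment_le[OF f]) (auto simp: N_def)
    also have "\<dots> < ennreal (e / 2)" using j by (simp add: N_def)
    finally show ?thesis using e by (simp add: N_def dist_norm ennreal_less_iff)
  qed
  show "\<exists>M. \<forall>m\<ge>M. \<forall>n\<ge>M. dist (f (real m *\<^sub>R x)) (f (real n *\<^sub>R x)) < e"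
  proof (intro exI[of _ N] allI impI)
    fix m n assume "N \<le> m" "N \<le> n"
    then show "dist (f (real m *\<^sub>R x)) (f (real n *\<^sub>R x)) < e"
      using close[of m] close[of n] by (rule_tac dist_triangle_half_l)
  qed
qed

lemma ray_limit_dilate:
  fixes f :: "real^'n::finite \<Rightarrow> complex"
  assumes f: "punctured_C1 f" and x: "x \<noteq> 0" and lim: "(\<lambda>k. f (real k *\<^sub>R x)) \<longlonglongrightarrow> L"
    and j: "0 < j"
  shows "ennreal (norm (f (real j *\<^sub>R x) - L)) \<le> ray_variation f (real j *\<^sub>R x)"
  unfolding ray_variation_def
proof (rule ray_limit_le[OF f])
  have "strict_mono (\<lambda>k. k * j)" using j by (intro strict_monoI) auto
  from LIMSEQ_subseq_LIMSEQ[OF lim this]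
  show "(\<lambda>k. f (real k *\<^sub>R (real j *\<^sub>R x))) \<longlonglongrightarrow> L" by (simp add: o_def)
qed (use x j in simp)

text \<open>Hoelder's inequality with the weight \<open>|x|^(\<beta> - 1)\<close>. The factor with the variation is controlled by
  Hardy's inequality and scales with the negative power of \<open>j\<close>; the other factor is the \<open>L^p'\<close> norm
  of \<open>|x|^(-(\<beta> + \<sigma> - 1))\<close> times a Gaussian, which is finite exactly if \<open>\<beta> + \<sigma> - 1 < n/p'\<close>.\<close>

lemma nn_integral_ray_variation_dilate:
  fixes f :: "real^'n::finite \<Rightarrow> complex"
  assumes p: "1 < p" and p': "1 / p + 1 / p' = 1"
    and b: "0 < real CARD('n) / p + \<beta> - 1"
    and bs: "\<beta> + \<sigma> - 1 < real CARD('n) / p'"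
    and f: "punctured_C1 f"
    and fin: "(\<integral>\<^sup>+ x. epow (ennreal (norm x powr \<beta>) * ennreal (norm (gradient f x))) p \<partial>lborel) < \<infinity>"
  obtains C where "0 \<le> C" "\<And>j. 0 < j \<Longrightarrow>
    (\<integral>\<^sup>+ x. ray_variation f (real j *\<^sub>R x) * ennreal (norm x powr (- \<sigma>) * gauss pi x) \<partial>lborel)
      \<le> ennreal (C * real j powr (- (real CARD('n) / p + \<beta> - 1)))"
proof -
  define n where "n = real CARD('n)"
  define \<theta> where "\<theta> = n / p + \<beta> - 1"
  define H where "H = ray_variation f"
  have [measurable]: "H \<in> borel_measurable borel" unfolding H_def by (rule ray_variation_measurable[OF f])
  have [measurable]: "gradient f \<in> borel_measurable borel" using f by (rule punctured_C1_gradient_measurable)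
  define w where "w x = norm x powr (- (\<beta> + \<sigma> - 1)) * gauss pi x" for x :: "real^'n"
  have [measurable]: "w \<in> borel_measurable borel" unfolding w_def by measurable
  have "1 / p < 1" using p by simp
  then have "0 < 1 / p'" using p' by linarith
  then have p'0: "0 < p'" by (simp only: zero_less_divide_1_iff)
  define A where "A = (\<integral>\<^sup>+ x. epow (ennreal (norm x powr (\<beta> - 1)) * H x) p \<partial>lborel)"
  define B where "B = (\<integral>\<^sup>+ x. ennreal (w x powr p') \<partial>lborel)"
  have "A \<le> ennreal ((1 / (n / p + \<beta> - 1)) powr p) * (\<integral>\<^sup>+ x. epow (ennreal (norm x powr \<beta>) * ennreal (norm (gradient f x))) p \<partial>lborel)"
    unfolding A_def H_def ray_variation_def n_def
    using Hardy_inequality[of p \<beta> "\<lambda>x. ennreal (norm (gradient f x))"] p b by simp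
  also have "\<dots> < \<infinity>" using fin by (simp add: ennreal_mult_less_top)
  finally have A: "A < \<infinity>" .
  have B: "B < \<infinity>"
  proof -
    have "w x powr p' = norm x powr (- ((\<beta> + \<sigma> - 1) * p')) * gauss (pi * p') x" for x
    proof -
      have "gauss pi x powr p' = gauss (pi * p') x"
        by (simp add: exp_powr_real mult_ac)
      then show ?thesis unfolding w_def powr_mult powr_powr by (simp only: minus_mult_left)
    qed
    moreover have "(\<beta> + \<sigma> - 1) * p' < real DIM(real^'n)"
      using bs p'0 by (simp add: pos_less_divide_eq)
    moreover have "0 < pi * p'" using p'0 by simp
    ultimately show ?thesis
      unfolding B_def using nn_integral_powr_Gaussian_finite by (simp only:)
  qed
  define C where "C = enn2real (epow (epow B (p - 1) * A) (1 / p))"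
  have C: "ennreal C = epow (epow B (p - 1) * A) (1 / p)"
  proof -
    have "epow (epow B (p - 1) * A) (1 / p) < \<infinity>"
      using A B by (cases A; cases B) (auto simp: ennreal_mult[symmetric])
    then show ?thesis unfolding C_def by simp
  qed
  show thesis
  proof (rule that)
    show "0 \<le> C" by (simp add: C_def)
    fix j :: nat assume j: "0 < j"
    define c where "c = real j"
    have c: "0 < c" using j by (simp add: c_def)
    define I where "I = (\<integral>\<^sup>+ x. H (c *\<^sub>R x) * ennreal (norm x powr (- \<sigma>) * gauss pi x) \<partial>lborel)"
    have "I = (\<integral>\<^sup>+ x. (ennreal (norm x powr (\<beta> - 1)) * H (c *\<^sub>R x)) * ennreal (w x) \<partial>lborel)"
      unfolding I_def
    proof (rule nn_integral_cong, goal_cases)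
      case (1 x)
      have "norm x powr (- \<sigma>) = norm x powr (\<beta> - 1) * norm x powr (- (\<beta> + \<sigma> - 1))"
        unfolding powr_add[symmetric] by (intro arg_cong[of _ _ "(powr) (norm x)"]) simp
      then have "ennreal (norm x powr (- \<sigma>) * gauss pi x) = ennreal (norm x powr (\<beta> - 1)) * ennreal (w x)"
        unfolding w_def by (simp add: ennreal_mult[symmetric] mult.assoc)
      then show ?case
        by (simp only: mult_ac)
    qed
    also have "epow \<dots> p \<le> epow B (p - 1) * (\<integral>\<^sup>+ x. epow (ennreal (norm x powr (\<beta> - 1)) * H (c *\<^sub>R x)) p \<partial>lborel)"
      unfolding B_def
    proof (rule nn_integral_Holder[OF p p'])
      show "AE x in lborel. 0 < w x"
        using AE_lborel_singleton[of 0] by eventually_elim (simp add: w_def)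
      show "(\<integral>\<^sup>+ x. ennreal (w x powr p') \<partial>lborel) < \<infinity>" using B by (simp add: B_def)
    qed measurable
    also have "(\<integral>\<^sup>+ x. epow (ennreal (norm x powr (\<beta> - 1)) * H (c *\<^sub>R x)) p \<partial>lborel) = ennreal (c powr (- (p * \<theta>))) * A"
    proof -
      have A_eq: "A = ennreal (\<bar>c\<bar> ^ DIM(real^'n)) * (\<integral>\<^sup>+ x. epow (ennreal (norm (0 + c *\<^sub>R x) powr (\<beta> - 1)) * H (0 + c *\<^sub>R x)) p \<partial>lborel)"
        unfolding A_def using c by (intro nn_integral_lborel_affine) auto
      have "(\<integral>\<^sup>+ x. epow (ennreal (norm x powr (\<beta> - 1)) * H (c *\<^sub>R x)) p \<partial>lborel)
        = (\<integral>\<^sup>+ x. ennreal (c powr ((1 - \<beta>) * p)) * epow (ennreal (norm (0 + c *\<^sub>R x) powr (\<beta> - 1)) * H (0 + c *\<^sub>R x)) p \<partial>lborel)"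
      proof (rule nn_integral_cong, goal_cases)
        case (1 x)
        have "c powr (1 - \<beta>) * norm (0 + c *\<^sub>R x) powr (\<beta> - 1) = (c powr (1 - \<beta>) * c powr (\<beta> - 1)) * norm x powr (\<beta> - 1)"
          using c by (simp add: powr_mult)
        also have "c powr (1 - \<beta>) * c powr (\<beta> - 1) = 1" using c by (simp flip: powr_add)
        finally have "ennreal (norm x powr (\<beta> - 1)) = ennreal (c powr (1 - \<beta>)) * ennreal (norm (0 + c *\<^sub>R x) powr (\<beta> - 1))"
          by (simp add: ennreal_mult[symmetric])
        then show ?case
          using p by (simp add: epow_mult powr_powr mult.assoc)
      qed
      also have "\<dots> = ennreal (c powr ((1 - \<beta>) * p)) * (\<integral>\<^sup>+ x. epow (ennreal (norm (0 + c *\<^sub>R x) powr (\<beta> - 1)) * H (0 + c *\<^sub>R x)) p \<partial>lborel)"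
        by (rule nn_integral_cmult) measurable
      also have "c powr ((1 - \<beta>) * p) = c powr (- (p * \<theta>)) * \<bar>c\<bar> ^ DIM(real^'n)"
      proof -
        have "(1 - \<beta>) * p = - (p * \<theta>) + n" using p by (simp add: \<theta>_def algebra_simps)
        then have "c powr ((1 - \<beta>) * p) = c powr (- (p * \<theta>)) * c powr n"
          by (simp only: powr_add)
        then show ?thesis using c by (simp add: n_def powr_realpow)
      qed
      finally show ?thesis unfolding A_eq using c by (simp add: ennreal_mult mult.assoc)
    qed
    finally have "epow (epow I p) (1 / p) \<le> epow (epow B (p - 1) * (ennreal (c powr (- (p * \<theta>))) * A)) (1 / p)"
      using p by (intro epow_mono) auto
    also have "epow (epow I p) (1 / p) = I" using p by (simp add: epow_epow)
    also have "epow B (p - 1) * (ennreal (c powr (- (p * \<theta>))) * A) = ennreal (c powr (- (p * \<theta>))) * (epow B (p - 1) * A)"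
      by (simp only: mult_ac)
    also have "epow \<dots> (1 / p) = ennreal (c powr (- \<theta>)) * ennreal C"
      unfolding C using p by (subst epow_mult) (auto simp: powr_powr)
    also have "\<dots> = ennreal (C * c powr (- \<theta>))" by (simp add: ennreal_mult'' mult.commute C_def)
    finally show "(\<integral>\<^sup>+ x. ray_variation f (real j *\<^sub>R x) * ennreal (norm x powr (- \<sigma>) * gauss pi x) \<partial>lborel)
      \<le> ennreal (C * real j powr (- (real CARD('n) / p + \<beta> - 1)))"
      unfolding I_def H_def c_def \<theta>_def n_def .
  qed
qed

lemma punctured_C1_norm_powr_scaleR:
  fixes h :: "real^'n::finite \<Rightarrow> complex"
  assumes diff: "\<And>x. h differentiable (at x)" and cont: "\<And>i. continuous_on UNIV (partial_deriv i h)"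
  shows "punctured_C1 (\<lambda>x. norm x powr \<sigma> *\<^sub>R h x)"
proof -
  define D where "D x = (\<lambda>v. norm x powr \<sigma> *\<^sub>R frechet_derivative h (at x) v
      + (norm x powr \<sigma> * ((sgn x \<bullet> v) * \<sigma> / norm x)) *\<^sub>R h x)" for x
  have der: "((\<lambda>x. norm x powr \<sigma> *\<^sub>R h x) has_derivative D x) (at x)" if x: "x \<noteq> 0" for x
  proof -
    have "((\<lambda>x. norm x powr \<sigma>) has_derivative (\<lambda>v. norm x powr \<sigma> * (0 * ln (norm x) + (sgn x \<bullet> v) * \<sigma> / norm x))) (at x)"
      using x has_derivative_norm[OF x] by (intro has_derivative_powr) (auto simp: inner_commute)
    moreover have "(h has_derivative frechet_derivative h (at x)) (at x)"
      using diff by (simp add: frechet_derivative_works)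
    ultimately show ?thesis
      unfolding D_def using has_derivative_scaleR by fastforce
  qed
  have grad: "gradient (\<lambda>x. norm x powr \<sigma> *\<^sub>R h x) x
    = (\<chi> i. norm x powr \<sigma> *\<^sub>R partial_deriv i h x + (norm x powr \<sigma> * (sgn x $ i * \<sigma> / norm x)) *\<^sub>R h x)" if x: "x \<noteq> 0" for x
    unfolding gradient_def partial_deriv_def frechet_derivative_at[OF der[OF x], symmetric] D_def
    by (simp add: inner_axis)
  have hc: "continuous_on A h" for A
    using diff by (simp add: continuous_at_imp_continuous_on differentiable_imp_continuous_within)
  have "continuous_on (- {0}) (\<lambda>x. \<chi> i. norm x powr \<sigma> *\<^sub>R partial_deriv i h x + (norm x powr \<sigma> * (sgn x $ i * \<sigma> / norm x)) *\<^sub>R h x)"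
    by (intro continuous_on_vec_lambda continuous_intros hc continuous_on_subset[OF cont]) auto
  then have "continuous_on (- {0}) (gradient (\<lambda>x. norm x powr \<sigma> *\<^sub>R h x))"
    by (rule continuous_on_eq) (simp add: grad)
  then show ?thesis
    unfolding punctured_C1_def using der differentiable_def by blast
qed

lemma frac_laplacian_eq_inverse_fourier:
  "frac_laplacian s g = inverse_fourier (\<lambda>y. complex_of_real ((2 * pi * norm y) powr s) * fourier g y)"
  by (simp add: frac_laplacian_def)

lemma punctured_C1_weighted_frac_laplacian:
  fixes g :: "real^'n::finite \<Rightarrow> complex"
  assumes "g \<in> schwartz" "0 \<le> s"
  shows "punctured_C1 (\<lambda>x. norm x powr \<sigma> *\<^sub>R frac_laplacian s g x)"
  unfolding frac_laplacian_eq_inverse_fourier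
  by (intro punctured_C1_norm_powr_scaleR inverse_fourier_differentiable continuous_on_partial_deriv_inverse_fourier
      fourier_schwartz_moments assms)

lemma nn_integral_shifted_Gaussian_finite:
  fixes \<xi> :: "'a::euclidean_space"
  assumes s: "0 \<le> s"
  shows "(\<integral>\<^sup>+ z. ennreal (norm z powr s * gauss pi (\<xi> - z)) \<partial>lborel) < \<infinity>"
proof -
  obtain N :: nat where N: "s \<le> real N" using real_arch_simple by blast
  have le: "norm (\<xi> - v) powr s \<le> (1 + norm \<xi>) ^ N * (1 + norm v) ^ N" for v
  proof -
    have "norm (\<xi> - v) \<le> norm \<xi> + norm v" by (rule norm_triangle_ineq4)
    also have "\<dots> \<le> (1 + norm \<xi>) * (1 + norm v)" by (simp add: algebra_simps)
    finally have "norm (\<xi> - v) powr s \<le> ((1 + norm \<xi>) * (1 + norm v)) powr s"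
      using s by (intro powr_mono2) auto
    also have "\<dots> \<le> ((1 + norm \<xi>) * (1 + norm v)) powr real N"
    proof (rule powr_mono[OF N])
      have "1 * 1 \<le> (1 + norm \<xi>) * (1 + norm v)" by (intro mult_mono) auto
      then show "1 \<le> (1 + norm \<xi>) * (1 + norm v)" by simp
    qed
    also have "\<dots> = ((1 + norm \<xi>) * (1 + norm v)) ^ N"
      by (intro powr_realpow mult_pos_pos) (auto simp: add_pos_nonneg)
    finally show ?thesis by (simp add: power_mult_distrib)
  qed
  have "(\<integral>\<^sup>+ z. ennreal (norm z powr s * gauss pi (\<xi> - z)) \<partial>lborel)
    = (\<integral>\<^sup>+ v. ennreal (norm (\<xi> - v) powr s * gauss pi (\<xi> - (\<xi> - v))) \<partial>lborel)"
    by (rule nn_integral_lborel_reflect[symmetric]) measurable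
  also have "\<dots> \<le> (\<integral>\<^sup>+ (v::'a). ennreal ((1 + norm \<xi>) ^ N) * ennreal ((1 + norm v) ^ N * gauss pi v) \<partial>lborel)"
  proof (rule nn_integral_mono, goal_cases)
    case (1 v)
    have "norm (\<xi> - v) powr s * gauss pi v \<le> (1 + norm \<xi>) ^ N * (1 + norm v) ^ N * gauss pi v"
      using le by (intro mult_right_mono) auto
    then show ?case
      by (simp add: ennreal_mult[symmetric] mult.assoc ennreal_leI)
  qed
  also have "\<dots> = ennreal ((1 + norm \<xi>) ^ N) * (\<integral>\<^sup>+ (v::'a). ennreal ((1 + norm v) ^ N * gauss pi v) \<partial>lborel)"
    by (rule nn_integral_cmult) measurable
  also have "\<dots> < \<infinity>"
    using nn_integral_polynomial_Gaussian_finite[of pi N, where 'a='a] by (simp add: ennreal_mult_less_top)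
  finally show ?thesis .
qed

text \<open>Since the variation along almost every ray is finite, \<open>f\<close> has a limit \<open>L\<close> along almost every ray.
  Multiply the dilates \<open>f(j x)\<close> by \<open>w = |x|^(-\<sigma>)\<close> times a Gaussian. As \<open>j\<close> tends to infinity, they
  converge to \<open>F = w L\<close> in \<open>L^1\<close>, with the rate of \<open>nn_integral_ray_variation_dilate\<close>. They
  are also \<open>j^\<sigma> h(j x)\<close> times the Gaussian, so that the transform at \<open>\<xi>\<close> is \<open>j^\<sigma>\<close> times the
  integral of \<open>(2 \<pi> |y|)^s\<close> times the transform of \<open>g\<close> over the region where \<open>j y\<close> is near \<open>\<xi>\<close>.
  This is of order \<open>j^(\<sigma> - n - s)\<close>, and \<open>\<sigma> < n\<close>. Hence the transform of \<open>F\<close> is zero, and \<open>L = 0\<close>.\<close>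

lemma weighted_frac_laplacian_ray_limit:
  fixes g :: "real^'n::finite \<Rightarrow> complex" and \<sigma> s :: real
  defines "f \<equiv> (\<lambda>y. norm y powr \<sigma> *\<^sub>R frac_laplacian s g y)"
  assumes p: "1 < p" and p': "1 / p + 1 / p' = 1"
    and b: "0 < real CARD('n) / p + \<beta> - 1"
    and bs: "\<beta> + \<sigma> - 1 < real CARD('n) / p'"
    and g: "g \<in> schwartz" and s: "0 < s"
    and fin: "(\<integral>\<^sup>+ x. epow (ennreal (norm x powr \<beta>) * ennreal (norm (gradient f x))) p \<partial>lborel) < \<infinity>"
  shows "AE x in lborel. (\<lambda>k. f (real k *\<^sub>R x)) \<longlonglongrightarrow> 0"
proof -
  define n where "n = real CARD('n)"
  define \<theta> where "\<theta> = n / p + \<beta> - 1"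
  have \<theta>: "0 < \<theta>" using b by (simp add: \<theta>_def n_def)
  have sig: "\<sigma> < n"
  proof -
    have "n / p + n / p' = n * (1 / p + 1 / p')" by (simp add: distrib_left)
    then show ?thesis using b bs by (simp add: p' n_def)
  qed
  define m where "m y = complex_of_real ((2 * pi * norm y) powr s) * fourier g y" for y
  define h where "h = inverse_fourier m"
  have h_eq: "frac_laplacian s g = h" unfolding h_def m_def by (rule frac_laplacian_eq_inverse_fourier)
  have f_eq: "f y = norm y powr \<sigma> *\<^sub>R h y" for y by (simp add: f_def h_eq)
  have mom: "has_all_moments m" unfolding m_def using g s by (intro fourier_schwartz_moments) auto
  have m: "integrable lborel m" using mom by (rule has_all_moments_integrable)
  have C1: "punctured_C1 f" unfolding f_def using g s by (intro punctured_C1_weighted_frac_laplacian) auto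
  have [measurable]: "h \<in> borel_measurable borel"
    unfolding h_def using mom by (intro borel_measurable_continuous_onI inverse_fourier_continuous)
  have [measurable]: "f \<in> borel_measurable borel" unfolding f_eq[abs_def] by measurable
  have [measurable]: "m \<in> borel_measurable borel" using m by auto
  define H where "H = ray_variation f"
  have [measurable]: "H \<in> borel_measurable borel" unfolding H_def by (rule ray_variation_measurable[OF C1])
  define E where "E x = gauss pi x" for x :: "real^'n"
  have E: "0 < E x" for x by (simp add: E_def)
  have [measurable]: "E \<in> borel_measurable borel" unfolding E_def by measurable
  have E_int: "integrable lborel E" unfolding E_def by (intro integrable_Gaussian) simp
  define w where "w x = norm x powr (- \<sigma>) * E x" for x :: "real^'n"
  have w: "0 \<le> w x" for x using E[of x] by (simp add: w_def)
  have [measurable]: "w \<in> borel_measurable borel" unfolding w_def by measurable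
  obtain C where C: "0 \<le> C" "\<And>j. 0 < j \<Longrightarrow> (\<integral>\<^sup>+ x. H (real j *\<^sub>R x) * ennreal (w x) \<partial>lborel) \<le> ennreal (C * real j powr (- \<theta>))"
    using nn_integral_ray_variation_dilate[OF p p' b bs C1 fin]
    unfolding H_def w_def E_def \<theta>_def n_def by blast
  have "AE x in lborel. H x * ennreal (w x) \<noteq> \<infinity>"
  proof (rule nn_integral_PInf_AE)
    show "(\<integral>\<^sup>+ x. H x * ennreal (w x) \<partial>lborel) \<noteq> \<infinity>" using C(2)[of 1] by (auto simp: top_unique)
  qed measurable
  then have conv: "AE x in lborel. x \<noteq> 0 \<and> convergent (\<lambda>k. f (real k *\<^sub>R x))"
    using AE_lborel_singleton[of 0]
  proof eventually_elim
    case (elim x)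
    then have "0 < w x" using E[of x] by (simp add: w_def)
    then have "H x < \<infinity>" using elim by (auto simp: ennreal_mult_eq_top_iff less_top)
    then show ?case using ray_limit_exists[OF C1 \<open>x \<noteq> 0\<close>] elim by (simp add: H_def)
  qed
  define L where "L x = lim (\<lambda>k. f (real k *\<^sub>R x))" for x
  have [measurable]: "L \<in> borel_measurable borel" unfolding L_def by measurable
  define F where "F x = w x *\<^sub>R L x" for x
  have [measurable]: "F \<in> borel_measurable borel" unfolding F_def by measurable
  define Fj where "Fj j x = w x *\<^sub>R f (real j *\<^sub>R x)" for j :: nat and x
  have [measurable]: "Fj j \<in> borel_measurable borel" for j unfolding Fj_def by measurable
  have diff_le: "(\<integral>\<^sup>+ x. ennreal (norm (Fj j x - F x)) \<partial>lborel) \<le> ennreal (C * real j powr (- \<theta>))" if j: "0 < j" for j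
  proof -
    have "(\<integral>\<^sup>+ x. ennreal (norm (Fj j x - F x)) \<partial>lborel) \<le> (\<integral>\<^sup>+ x. H (real j *\<^sub>R x) * ennreal (w x) \<partial>lborel)"
    proof (rule nn_integral_mono_AE, use conv in eventually_elim)
      case (elim x)
      then have "(\<lambda>k. f (real k *\<^sub>R x)) \<longlonglongrightarrow> L x" by (simp add: L_def convergent_LIMSEQ_iff)
      then have "ennreal (norm (f (real j *\<^sub>R x) - L x)) \<le> H (real j *\<^sub>R x)"
        unfolding H_def using elim j by (intro ray_limit_dilate[OF C1]) auto
      then have "ennreal (norm (f (real j *\<^sub>R x) - L x)) * ennreal (w x) \<le> H (real j *\<^sub>R x) * ennreal (w x)"
        by (rule mult_right_mono) simp
      moreover have "norm (Fj j x - F x) = norm (f (real j *\<^sub>R x) - L x) * w x"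
        unfolding Fj_def F_def scaleR_diff_right[symmetric] using w by simp
      ultimately show ?case using w by (simp add: ennreal_mult)
    qed
    then show ?thesis using C(2)[OF j] by (rule order_trans)
  qed
  have Fj_eq: "AE x in lborel. Fj j x = complex_of_real (real j powr \<sigma>) * (h (0 + real j *\<^sub>R x) * complex_of_real (E x))" if j: "0 < j" for j
    using AE_lborel_singleton[of 0]
  proof eventually_elim
    case (elim x)
    have "w x * norm (real j *\<^sub>R x) powr \<sigma> = real j powr \<sigma> * E x * (norm x powr (- \<sigma>) * norm x powr \<sigma>)"
      by (simp add: w_def powr_mult)
    also have "norm x powr (- \<sigma>) * norm x powr \<sigma> = 1" using elim by (simp flip: powr_add)
    finally show ?case by (simp add: Fj_def f_eq scaleR_conv_of_real flip: of_real_mult)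
  qed
  have h_bdd: "norm (h x) \<le> (\<integral>y. norm (m y) \<partial>lborel)" for x
    using integral_norm_bound[of lborel "\<lambda>y. wave' x y * m y"]
    by (simp add: h_def inverse_fourier_cis norm_mult)
  have Fj_int: "integrable lborel (Fj j)" if j: "0 < j" for j
  proof (rule integrable_cong_AE[THEN iffD2, OF _ _ Fj_eq[OF j]])
    show "integrable lborel (\<lambda>x. complex_of_real (real j powr \<sigma>) * (h (0 + real j *\<^sub>R x) * complex_of_real (E x)))"
    proof (rule integrable_mult_right, rule Bochner_Integration.integrable_bound)
      show "integrable lborel (\<lambda>x. (\<integral>y. norm (m y) \<partial>lborel) * E x)" by (intro integrable_mult_right E_int)
      show "AE x in lborel. norm (h (0 + real j *\<^sub>R x) * complex_of_real (E x)) \<le> norm ((\<integral>y. norm (m y) \<partial>lborel) * E x)"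
        using h_bdd E by (intro AE_I2) (auto simp: norm_mult abs_mult intro!: mult_right_mono)
    qed measurable
  qed measurable
  have d_int: "integrable lborel (\<lambda>x. Fj j x - F x)" if j: "0 < j" for j
    using diff_le[OF j] by (intro integrableI_bounded) (auto intro: le_less_trans)
  have F_int: "integrable lborel F"
    using Bochner_Integration.integrable_diff[OF Fj_int[of 1] d_int[of 1]] by simp
  define G where "G = (\<integral>x. norm (g x) \<partial>lborel)"
  have G: "0 \<le> G" by (simp add: G_def)
  have Fj_fourier: "\<exists>K\<ge>0. \<forall>j>0. norm (fourier (Fj j) \<xi>) \<le> K * real j powr (\<sigma> - n - s)" for \<xi>
  proof -
    define J where "J = (\<integral>\<^sup>+ z. ennreal (norm z powr s * gauss pi (\<xi> - z)) \<partial>lborel)"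
    have J: "J < \<infinity>" unfolding J_def using s by (intro nn_integral_shifted_Gaussian_finite) auto
    define K where "K = (2 * pi) powr s * G * enn2real J"
    have "norm (fourier (Fj j) \<xi>) \<le> K * real j powr (\<sigma> - n - s)" if j: "0 < j" for j
    proof -
      define c where "c = real j"
      have c: "0 < c" using j by (simp add: c_def)
      have "fourier (Fj j) \<xi> = (\<integral>x. complex_of_real (c powr \<sigma>) * (h (0 + c *\<^sub>R x) * (wave x \<xi> * complex_of_real (gauss pi x))) \<partial>lborel)"
        unfolding fourier_cis
      proof (rule integral_cong_AE)
        show "AE x in lborel. wave x \<xi> * Fj j x = complex_of_real (c powr \<sigma>) * (h (0 + c *\<^sub>R x) * (wave x \<xi> * complex_of_real (gauss pi x)))"
          using Fj_eq[OF j] by eventually_elim (simp add: c_def E_def)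
      qed measurable
      also have "\<dots> = complex_of_real (c powr \<sigma>) * (\<integral>y. wave' 0 y * m y * complex_of_real ((pi / pi) powr (real DIM(real^'n) / 2) * exp (- (pi\<^sup>2 * (norm (\<xi> - c *\<^sub>R y))\<^sup>2 / pi))) \<partial>lborel)"
        unfolding h_def integral_mult_right_zero Gaussian_mean_inverse_fourier[OF m pi_gt_zero] ..
      also have "\<dots> = complex_of_real (c powr \<sigma>) * (\<integral>y. m y * complex_of_real (gauss pi (\<xi> - c *\<^sub>R y)) \<partial>lborel)"
        by (simp add: power2_eq_square)
      finally have eq: "norm (fourier (Fj j) \<xi>) = c powr \<sigma> * norm (\<integral>y. m y * complex_of_real (gauss pi (\<xi> - c *\<^sub>R y)) \<partial>lborel)"
        by (simp add: norm_mult)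
      have "ennreal (norm (\<integral>y. m y * complex_of_real (gauss pi (\<xi> - c *\<^sub>R y)) \<partial>lborel))
        \<le> (\<integral>\<^sup>+ y. ennreal (norm (m y * complex_of_real (gauss pi (\<xi> - c *\<^sub>R y)))) \<partial>lborel)"
      proof (rule integral_norm_bound_ennreal, rule Bochner_Integration.integrable_bound[OF m])
        show "AE y in lborel. norm (m y * complex_of_real (gauss pi (\<xi> - c *\<^sub>R y))) \<le> norm (m y)"
          by (intro AE_I2) (auto simp: norm_mult intro!: mult_left_le)
      qed measurable
      also have "\<dots> \<le> (\<integral>\<^sup>+ y. ennreal ((2 * pi) powr s * G * c powr (- s)) * ennreal (norm (0 + c *\<^sub>R y) powr s * gauss pi (\<xi> - (0 + c *\<^sub>R y))) \<partial>lborel)"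
      proof (rule nn_integral_mono, goal_cases)
        case (1 y)
        have "norm (m y) \<le> (2 * pi) powr s * norm y powr s * G"
        proof -
          have "norm (m y) = (2 * pi) powr s * norm y powr s * norm (fourier g y)"
            unfolding m_def norm_mult norm_of_real powr_mult[of "2 * pi" "norm y"] by simp
          then show ?thesis unfolding G_def by (simp add: norm_fourier_le mult_left_mono)
        qed
        also have "norm y powr s = c powr (- s) * norm (0 + c *\<^sub>R y) powr s"
        proof -
          have "c powr (- s) * c powr s = 1" using c by (simp flip: powr_add)
          then show ?thesis using c by (simp add: powr_mult mult.assoc[symmetric])
        qed
        finally have "norm (m y) * gauss pi (\<xi> - c *\<^sub>R y)
          \<le> (2 * pi) powr s * (c powr (- s) * norm (0 + c *\<^sub>R y) powr s) * G * gauss pi (\<xi> - c *\<^sub>R y)"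
          by (rule mult_right_mono) simp
        also have "\<dots> = (2 * pi) powr s * G * c powr (- s) * (norm (0 + c *\<^sub>R y) powr s * gauss pi (\<xi> - (0 + c *\<^sub>R y)))"
          by (simp only: add_0 mult_ac)
        finally show ?case
          using G by (simp add: norm_mult ennreal_mult[symmetric] ennreal_leI)
      qed
      also have "\<dots> = ennreal ((2 * pi) powr s * G * c powr (- s)) * (\<integral>\<^sup>+ y. ennreal (norm (0 + c *\<^sub>R y) powr s * gauss pi (\<xi> - (0 + c *\<^sub>R y))) \<partial>lborel)"
        by (rule nn_integral_cmult) measurable
      also have "(\<integral>\<^sup>+ y. ennreal (norm (0 + c *\<^sub>R y) powr s * gauss pi (\<xi> - (0 + c *\<^sub>R y))) \<partial>lborel) = ennreal (c powr (- n)) * J"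
      proof -
        have "J = ennreal (\<bar>c\<bar> ^ DIM(real^'n)) * (\<integral>\<^sup>+ y. ennreal (norm (0 + c *\<^sub>R y) powr s * gauss pi (\<xi> - (0 + c *\<^sub>R y))) \<partial>lborel)"
          unfolding J_def using c by (intro nn_integral_lborel_affine) auto
        moreover have "ennreal (c powr (- n)) * ennreal (\<bar>c\<bar> ^ DIM(real^'n)) = 1"
          using c by (simp add: n_def powr_minus powr_realpow ennreal_mult[symmetric])
        ultimately show ?thesis by (simp add: mult.assoc[symmetric])
      qed
      also have "ennreal (c powr (- n)) * J = ennreal (c powr (- n) * enn2real J)"
        using J by (simp add: ennreal_mult)
      also have "ennreal ((2 * pi) powr s * G * c powr (- s)) * \<dots> = ennreal ((2 * pi) powr s * G * c powr (- s) * (c powr (- n) * enn2real J))"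
        using G by (intro ennreal_mult[symmetric]) auto
      finally have "norm (\<integral>y. m y * complex_of_real (gauss pi (\<xi> - c *\<^sub>R y)) \<partial>lborel)
        \<le> (2 * pi) powr s * G * c powr (- s) * (c powr (- n) * enn2real J)"
        using G by (subst (asm) ennreal_le_iff) auto
      then have "norm (fourier (Fj j) \<xi>) \<le> c powr \<sigma> * ((2 * pi) powr s * G * c powr (- s) * (c powr (- n) * enn2real J))"
        unfolding eq by (rule mult_left_mono) simp
      also have "\<dots> = K * (c powr \<sigma> * c powr (- n) * c powr (- s))" unfolding K_def by (simp only: mult_ac)
      also have "c powr \<sigma> * c powr (- n) * c powr (- s) = c powr (\<sigma> - n - s)"
        unfolding powr_add[symmetric] by simp
      finally show ?thesis unfolding c_def .
    qed
    moreover have "0 \<le> K" unfolding K_def using G by simp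
    ultimately show ?thesis by blast
  qed
  have zero: "fourier F \<xi> = 0" for \<xi>
  proof -
    obtain K where K: "\<And>j. 0 < j \<Longrightarrow> norm (fourier (Fj j) \<xi>) \<le> K * real j powr (\<sigma> - n - s)"
      using Fj_fourier[of \<xi>] by blast
    have le: "norm (fourier F \<xi>) \<le> K * real j powr (\<sigma> - n - s) + C * real j powr (- \<theta>)" if j: "0 < j" for j
    proof -
      have c_int: "integrable lborel (\<lambda>x. wave x \<xi> * e x)" if "integrable lborel e" for e :: "real^'n \<Rightarrow> complex"
      proof -
        have [measurable]: "e \<in> borel_measurable borel" using that by auto
        show ?thesis by (rule Bochner_Integration.integrable_bound[OF that]) (auto simp: norm_mult)
      qed
      have "fourier (Fj j) \<xi> - fourier F \<xi> = (\<integral>x. wave x \<xi> * Fj j x - wave x \<xi> * F x \<partial>lborel)"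
        unfolding fourier_cis using c_int[OF Fj_int[OF j]] c_int[OF F_int] by (rule Bochner_Integration.integral_diff[symmetric])
      also have "\<dots> = fourier (\<lambda>x. Fj j x - F x) \<xi>"
        unfolding fourier_cis by (simp only: right_diff_distrib)
      finally have "norm (fourier (Fj j) \<xi> - fourier F \<xi>) \<le> (\<integral>x. norm (Fj j x - F x) \<partial>lborel)"
        using norm_fourier_le[of "\<lambda>x. Fj j x - F x" \<xi>] by simp
      also have "\<dots> \<le> C * real j powr (- \<theta>)"
      proof -
        have "ennreal (\<integral>x. norm (Fj j x - F x) \<partial>lborel) \<le> ennreal (C * real j powr (- \<theta>))"
          using diff_le[OF j] d_int[OF j] by (subst nn_integral_eq_integral[symmetric]) auto
        then show ?thesis using C(1) by (subst (asm) ennreal_le_iff) auto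
      qed
      finally have "norm (fourier (Fj j) \<xi> - fourier F \<xi>) \<le> C * real j powr (- \<theta>)" .
      then show ?thesis
        using K[OF j] norm_triangle_ineq3[of "fourier (Fj j) \<xi>" "fourier F \<xi>"] by linarith
    qed
    have "(\<lambda>j. K * real j powr (\<sigma> - n - s) + C * real j powr (- \<theta>)) \<longlonglongrightarrow> K * 0 + C * 0"
      using sig s \<theta> by (intro tendsto_add tendsto_mult tendsto_const tendsto_neg_powr filterlim_real_sequentially) auto
    then have "norm (fourier F \<xi>) \<le> K * 0 + C * 0"
      by (rule LIMSEQ_le_const) (use le in \<open>auto intro!: exI[of _ 1]\<close>)
    then show ?thesis by simp
  qed
  have "AE x in lborel. F x = 0" by (rule fourier_injective[OF F_int zero])
  then show ?thesis using conv
  proof eventually_elim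
    case (elim x)
    then have "w x \<noteq> 0" using E[of x] by (auto simp: w_def)
    then have "L x = 0" using elim by (simp add: F_def)
    moreover have "(\<lambda>k. f (real k *\<^sub>R x)) \<longlonglongrightarrow> L x" using elim by (simp add: L_def convergent_LIMSEQ_iff)
    ultimately show ?case by simp
  qed
qed

section \<open>The second inequality\<close>

text \<open>The core estimate for \<open>q = g\<close> and \<open>f = |x|^\<sigma> (-\<Delta>)^(s/2) g\<close>. If the right-hand side is infinite,
  the inequality holds because the constant is positive; if it is finite, \<open>f\<close> vanishes at infinity
  along almost every ray.\<close>

lemma weighted_frac_laplacian_bound_schwartz:
  fixes g :: "real^'n::finite \<Rightarrow> complex"
  defines "n \<equiv> real CARD('n)" 
  assumes p: "1 < p" and p': "1 / p + 1 / p' = 1"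
    and l: "0 < l" "l < real CARD('n)" and a: "\<alpha> < real CARD('n) / p"
    and b: "1 - real CARD('n) / p < \<beta>"
    and hom: "real CARD('n) + 1 = l + \<alpha> + \<beta> + \<sigma>"
    and bs: "0 < real CARD('n) / (2 * p') - (\<beta> + \<sigma> - 1) / 2"
    and g: "g \<in> schwartz"
  shows "Lp_norm p (\<lambda>x. norm x powr (- \<alpha>) *\<^sub>R g x)
        \<le> ennreal (2 powr (- (\<alpha> + \<beta> + \<sigma> - 1)) / (n / p + \<beta> - 1) *
             ((Gamma (n / (2 * p) - \<alpha> / 2) * Gamma (n / (2 * p') - (\<beta> + \<sigma> - 1) / 2)) /
              (Gamma (n / (2 * p') + \<alpha> / 2) * Gamma (n / (2 * p) + (\<beta> + \<sigma> - 1) / 2)))) *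
           Lp_norm p (\<lambda>x. norm x powr \<beta> *\<^sub>R
             gradient (\<lambda>y. norm y powr \<sigma> *\<^sub>R frac_laplacian (\<alpha> + \<beta> + \<sigma> - 1) g y) x)"
proof -
  define s where "s = \<alpha> + \<beta> + \<sigma> - 1"
  have s: "0 < s" "s + l = n" using l hom by (auto simp: s_def n_def)
  define f where "f = (\<lambda>y. norm y powr \<sigma> *\<^sub>R frac_laplacian s g y)"
  \<comment> \<open>\<open>c |x|^(-l)\<close> is the convolution kernel of the inverse of \<open>(-\<Delta>)^(s/2)\<close>.\<close>
  define c where "c = Gamma (l / 2) / (pi powr (n / 2) * 2 powr s * Gamma (s / 2))"
  have G0: "0 < Gamma (s / 2)" "0 < Gamma (l / 2)" using s l by auto
  have c: "0 \<le> c" using G0 by (simp add: c_def)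
  have np': "n / p' = n - n / p"
  proof -
    have "n / p + n / p' = n * (1 / p + 1 / p')" by (simp add: distrib_left)
    then show ?thesis by (simp add: p')
  qed
  have h2: "n / (2 * p) = n / p / 2" "n / (2 * p') = n / p' / 2" by simp_all
  have bs': "\<beta> + \<sigma> - 1 < n / p'" using bs[folded n_def] unfolding h2 by simp
  have pos: "0 < n / (2 * p) - \<alpha> / 2" "0 < n / (2 * p') - (\<beta> + \<sigma> - 1) / 2"
    "0 < n / (2 * p') + \<alpha> / 2" "0 < n / (2 * p) + (\<beta> + \<sigma> - 1) / 2" "0 < n / p + \<beta> - 1"
  proof -
    define q where "q = n / p"
    have np'q: "n / p' = n - q" using np' by (simp add: q_def)
    have "0 < q - \<alpha>" "0 < (n - q) - (\<beta> + \<sigma> - 1)" "0 < (n - q) + \<alpha>" "0 < q + (\<beta> + \<sigma> - 1)" "0 < q + \<beta> - 1"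
      using a[folded n_def, folded q_def] b[folded n_def, folded q_def] bs'[unfolded np'q] l[folded n_def] hom[folded n_def]
      by linarith+
    then have "0 < (q - \<alpha>) / 2" "0 < ((n - q) - (\<beta> + \<sigma> - 1)) / 2" "0 < ((n - q) + \<alpha>) / 2"
      "0 < (q + (\<beta> + \<sigma> - 1)) / 2" "0 < q + \<beta> - 1"
      by simp_all
    then show "0 < n / (2 * p) - \<alpha> / 2" "0 < n / (2 * p') - (\<beta> + \<sigma> - 1) / 2"
      "0 < n / (2 * p') + \<alpha> / 2" "0 < n / (2 * p) + (\<beta> + \<sigma> - 1) / 2" "0 < n / p + \<beta> - 1"
      unfolding h2 np'q q_def[symmetric] by (simp_all only: diff_divide_distrib add_divide_distrib)
  qed
  define K where "K = 2 powr (- s) / (n / p + \<beta> - 1) *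
             ((Gamma (n / (2 * p) - \<alpha> / 2) * Gamma (n / (2 * p') - (\<beta> + \<sigma> - 1) / 2)) /
              (Gamma (n / (2 * p') + \<alpha> / 2) * Gamma (n / (2 * p) + (\<beta> + \<sigma> - 1) / 2)))"
  have K: "0 < K" unfolding K_def using pos
    by (intro mult_pos_pos divide_pos_pos Gamma_real_pos) auto
  have cF: "c * F_const CARD('n) p p' \<alpha> \<beta> \<sigma> = K"
  proof -
    have "(\<alpha> + \<beta> + \<sigma> - 1) / 2 = s / 2" "(n + 1 - \<alpha> - \<beta> - \<sigma>) / 2 = l / 2" using hom by (auto simp: s_def n_def)
    note args = this
    have cancel: "L / (P * T * S) * (P * inverse D * ((S * A * B) / (L * X * Y))) = inverse T / D * ((A * B) / (X * Y))"
      if "P \<noteq> 0" "S \<noteq> 0" "L \<noteq> 0" for L P T S D A B X Y :: real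
      using that by (simp add: divide_simps)
    show ?thesis
      unfolding F_const_def n_def[symmetric] c_def K_def powr_minus[of 2 s] args
      by (rule cancel) (use G0 in auto)
  qed
  define N where "N = (\<integral>\<^sup>+ x. epow (ennreal (norm x powr \<beta>) * ennreal (norm (gradient f x))) p \<partial>lborel)"
  have rhs: "Lp_norm p (\<lambda>x. norm x powr \<beta> *\<^sub>R gradient f x) = epow N (1 / p)"
    by (simp add: Lp_norm_epow N_def ennreal_mult)
  have C1: "punctured_C1 f" unfolding f_def using g s by (intro punctured_C1_weighted_frac_laplacian) auto
  have meas: "f \<in> borel_measurable borel"
  proof -
    have [measurable]: "frac_laplacian s g \<in> borel_measurable borel"
      unfolding frac_laplacian_eq_inverse_fourier using g s
      by (intro borel_measurable_continuous_onI inverse_fourier_continuous fourier_schwartz_moments) auto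
    show ?thesis unfolding f_def by measurable
  qed
  have "Lp_norm p (\<lambda>x. norm x powr (- \<alpha>) *\<^sub>R g x) \<le> ennreal K * Lp_norm p (\<lambda>x. norm x powr \<beta> *\<^sub>R gradient f x)"
  proof (cases "N < \<infinity>")
    case False
    then have "Lp_norm p (\<lambda>x. norm x powr \<beta> *\<^sub>R gradient f x) = \<infinity>" by (simp add: rhs less_top[symmetric])
    then show ?thesis using K by (simp add: ennreal_mult_top)
  next
    case True
    have "AE x in lborel. (\<lambda>k. f (real k *\<^sub>R x)) \<longlonglongrightarrow> 0"
      unfolding f_def using p p' pos(5) bs' g s True
      by (intro weighted_frac_laplacian_ray_limit[where \<beta> = \<beta>]) (auto simp: n_def N_def f_def)
    moreover have "ennreal (norm (g x)) \<le> ennreal c * (\<integral>\<^sup>+ y. ennreal (norm (x - y) powr (- l) * norm y powr (- \<sigma>)) * ennreal (norm (f y)) \<partial>lborel)" for x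
    proof -
      have "(\<integral>\<^sup>+ z. ennreal (norm (x - z) powr (- l)) * ennreal (norm (frac_laplacian s g z)) \<partial>lborel)
        = (\<integral>\<^sup>+ y. ennreal (norm (x - y) powr (- l) * norm y powr (- \<sigma>)) * ennreal (norm (f y)) \<partial>lborel)"
      proof (rule nn_integral_cong_AE, use AE_lborel_singleton[of 0] in eventually_elim)
        case (elim y)
        have "norm y powr (- \<sigma>) * norm y powr \<sigma> = 1" using elim by (simp flip: powr_add)
        then have "norm (frac_laplacian s g y) = norm y powr (- \<sigma>) * norm (f y)"
          by (simp add: f_def mult.assoc[symmetric])
        then show ?case by (simp add: ennreal_mult mult.assoc)
      qed
      then show ?thesis
        using schwartz_le_Riesz_potential[OF g s(1) l(1), of x] s(2) by (simp add: c_def n_def)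
    qed
    ultimately show ?thesis
      using Riesz_potential_gradient_bound[OF p p' l a b hom bs C1 meas, of c g] c by (simp add: cF)
  qed
  then show ?thesis unfolding K_def f_def s_def .
qed

theorem theorem4:
  fixes n :: nat and p p' lam \<alpha> \<beta> \<sigma> :: real
  assumes "n = CARD('n::finite)"
    and "1 < p" and "1 / p + 1 / p' = 1"
    and "0 < lam" and "lam < real n"
    and "\<alpha> < real n / p"
    and "1 - real n / p < \<beta>" and "\<beta> < real n / p'"
    and "real n + 1 = lam + \<alpha> + \<beta> + \<sigma>"
    and Gamma_argument_positive: "0 < real n / (2 * p') - (\<beta> + \<sigma> - 1) / 2"
  shows
    "(\<forall>f \<in> (schwartz :: (real^'n \<Rightarrow> complex) set).
        Lp_norm p (\<lambda>x. norm x powr (- \<alpha>) *\<^sub>R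
            convolution (\<lambda>z. norm z powr (- lam)) (\<lambda>y. norm y powr (- \<sigma>) *\<^sub>R f y) x)
        \<le> ennreal (F_const n p p' \<alpha> \<beta> \<sigma>) *
           Lp_norm p (\<lambda>x. norm x powr \<beta> *\<^sub>R gradient f x)) \<and>
     (\<forall>g \<in> (schwartz :: (real^'n \<Rightarrow> complex) set).
        Lp_norm p (\<lambda>x. norm x powr (- \<alpha>) *\<^sub>R g x)
        \<le> ennreal (2 powr (- (\<alpha> + \<beta> + \<sigma> - 1)) / (real n / p + \<beta> - 1) *
             ((Gamma (real n / (2 * p) - \<alpha> / 2) *
               Gamma (real n / (2 * p') - (\<beta> + \<sigma> - 1) / 2)) /
              (Gamma (real n / (2 * p') + \<alpha> / 2) *
               Gamma (real n / (2 * p) + (\<beta> + \<sigma> - 1) / 2)))) *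
           Lp_norm p (\<lambda>x. norm x powr \<beta> *\<^sub>R
             gradient (\<lambda>y. norm y powr \<sigma> *\<^sub>R
               frac_laplacian (\<alpha> + \<beta> + \<sigma> - 1) g y) x))"
proof (intro conjI ballI)
  note card = assms(1)
  have l: "0 < lam" "lam < real CARD('n)" and a: "\<alpha> < real CARD('n) / p" and b: "1 - real CARD('n) / p < \<beta>"
    and hom: "real CARD('n) + 1 = lam + \<alpha> + \<beta> + \<sigma>"
    and bs: "0 < real CARD('n) / (2 * p') - (\<beta> + \<sigma> - 1) / 2"
    using assms(4-7,9,10) unfolding card by blast+
  fix f :: "real^'n \<Rightarrow> complex" assume f: "f \<in> schwartz"
  show "Lp_norm p (\<lambda>x. norm x powr (- \<alpha>) *\<^sub>R
            convolution (\<lambda>z. norm z powr (- lam)) (\<lambda>y. norm y powr (- \<sigma>) *\<^sub>R f y) x)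
        \<le> ennreal (F_const n p p' \<alpha> \<beta> \<sigma>) * Lp_norm p (\<lambda>x. norm x powr \<beta> *\<^sub>R gradient f x)"
    unfolding card by (rule Stein_Weiss_gradient_schwartz[OF assms(2,3) l a b hom bs f])
  show "Lp_norm p (\<lambda>x. norm x powr (- \<alpha>) *\<^sub>R f x)
        \<le> ennreal (2 powr (- (\<alpha> + \<beta> + \<sigma> - 1)) / (real n / p + \<beta> - 1) *
             ((Gamma (real n / (2 * p) - \<alpha> / 2) *
               Gamma (real n / (2 * p') - (\<beta> + \<sigma> - 1) / 2)) /
              (Gamma (real n / (2 * p') + \<alpha> / 2) *
               Gamma (real n / (2 * p) + (\<beta> + \<sigma> - 1) / 2)))) *
           Lp_norm p (\<lambda>x. norm x powr \<beta> *\<^sub>R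
             gradient (\<lambda>y. norm y powr \<sigma> *\<^sub>R frac_laplacian (\<alpha> + \<beta> + \<sigma> - 1) f y) x)"
    unfolding card by (rule weighted_frac_laplacian_bound_schwartz[OF assms(2,3) l a b hom bs f])
qed

end
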